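(* For integers $n,k,r$ satisfying $n\geq 2k\geq r$ and $k\geq 6$, $$\mathrm{ex}(n,K_r,\mathcal{C}^{odd}_{\geq 2k+1})\leq \frac{n-1}{2k-1}\binom{2k}{r}.$$ The equality holds if and only if $n-1$ is divisible by $2k-1$, for a connected $n$-vertex graph which consists of $\frac{n-1}{2k-1}$ maximal $2$-connected blocks isomorphic to $K_{2k}$.
   Context: $K_r$ denotes the complete graph on $r$ vertices and $C_\ell$ denotes the cycle of length $\ell$. $\mathcal{C}^{odd}_{\geq 2k+1}:=\{C_{2k+1},C_{2k+3},\dots\}$ is the family of all odd cycles of length at least $2k+1$. For a graph $H$ and a set of graphs $\mathcal{F}$, the generalized Turán number $\mathrm{ex}(n,H,\mathcal{F})$ is the maximum number of copies of $H$ in a graph on $n$ vertices that contains no $F$ as a subgraph, for every $F\in\mathcal{F}$. The maximal $2$-connected blocks of a graph are the blocks of its block decomposition.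
   Formalization: The hypothesis r ≥ 3 is added: for r = 2 the bound fails (k = 6, n = 24: K_{12,12} has 144 > 138 edges and no odd cycle), and for r = 0, 1 the equality claim fails (n = 4k−1: n−1 is divisible by 2k−1 but ex is strictly below the bound). *)

theory Defs
  imports Complex_Main "Graph_Theory.Graph_Theory"
begin

text \<open>
  A finite simple graph is a \<^locale>\<open>pair_graph\<close>: a finite vertex set with a symmetric and
  irreflexive adjacency relation, so that an undirected edge is a pair of opposite arcs.
\<close>

definition complete_graph :: "nat \<Rightarrow> nat pair_pre_digraph" where
  "complete_graph r = \<lparr> pverts = {..<r}, parcs = {(i, j). i < r \<and> j < r \<and> i \<noteq> j} \<rparr>"

text \<open>Meaningful for \<open>l \<ge> 3\<close> only.\<close>

definition cycle_graph :: "nat \<Rightarrow> nat pair_pre_digraph" where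
  "cycle_graph l = \<lparr> pverts = {..<l},
     parcs = {(i, j). i < l \<and> j < l \<and> (j = (i + 1) mod l \<or> i = (j + 1) mod l)} \<rparr>"

lemma pair_graph_complete_graph: "pair_graph (complete_graph r)"
proof
  show "finite (parcs (complete_graph r))"
    by (rule finite_subset[of _ "{..<r} \<times> {..<r}"]) (auto simp: complete_graph_def)
qed (auto simp: complete_graph_def symmetric_def sym_def)

lemma pair_graph_cycle_graph:
  assumes "l \<ge> 3"
  shows "pair_graph (cycle_graph l)"
proof
  show "finite (parcs (cycle_graph l))"
    by (rule finite_subset[of _ "{..<l} \<times> {..<l}"]) (auto simp: cycle_graph_def)
next
  fix e assume "e \<in> parcs (cycle_graph l)"
  moreover have "i \<noteq> (i + 1) mod l" if "i < l" for i
    using that assms by (cases "i + 1 = l") (auto simp: mod_if)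
  ultimately show "fst e \<noteq> snd e"
    unfolding cycle_graph_def by fastforce
qed (auto simp: cycle_graph_def symmetric_def sym_def)

definition odd_cycles_from :: "nat \<Rightarrow> nat pair_pre_digraph set" where
  "odd_cycles_from m = {cycle_graph l |l. odd l \<and> l \<ge> m}"

text \<open>
  Copies are subgraphs, not necessarily induced and not counted with automorphisms.
  The condition \<^term>\<open>pair_graph H'\<close> excludes subdigraphs that contain only one of the two
  arcs of an edge.
\<close>

definition copies :: "'b pair_pre_digraph \<Rightarrow> 'a pair_pre_digraph \<Rightarrow> 'a pair_pre_digraph set" where
  "copies H G = {H'. pair_graph H' \<and> subgraph H' G \<and> digraph_iso H' H}"

definition is_free :: "'b pair_pre_digraph set \<Rightarrow> 'a pair_pre_digraph \<Rightarrow> bool" where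
  "is_free \<F> G \<longleftrightarrow> (\<forall>F\<in>\<F>. copies F G = {})"

text \<open>
  Every graph on \<open>n\<close> vertices is isomorphic to one whose vertices are natural numbers.
  The set below is finite, and it is nonempty if every member of \<open>\<F>\<close> has an edge.
\<close>

definition gen_turan :: "nat \<Rightarrow> 'b pair_pre_digraph \<Rightarrow> 'c pair_pre_digraph set \<Rightarrow> nat" where
  "gen_turan n H \<F> = Max {card (copies H G) |G :: nat pair_pre_digraph.
     pair_graph G \<and> card (pverts G) = n \<and> is_free \<F> G}"

lemma gen_turan_wf:
  fixes n :: nat and H :: "'b pair_pre_digraph" and \<F> :: "'c pair_pre_digraph set"
  assumes "\<And>F. F \<in> \<F> \<Longrightarrow> parcs F \<noteq> {}"
  defines "S \<equiv> {card (copies H G) |G :: nat pair_pre_digraph.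
     pair_graph G \<and> card (pverts G) = n \<and> is_free \<F> G}"
  shows "finite S" and "S \<noteq> {}"
proof -
  have sub: "copies H G \<subseteq> (\<lambda>(V, E). \<lparr>pverts = V, parcs = E\<rparr>) ` (Pow (pverts G) \<times> Pow (parcs G))"
    for G :: "nat pair_pre_digraph"
  proof
    fix B assume "B \<in> copies H G"
    then have "pverts B \<subseteq> pverts G" "parcs B \<subseteq> parcs G"
      by (auto simp: copies_def subgraph_def)
    then show "B \<in> (\<lambda>(V, E). \<lparr>pverts = V, parcs = E\<rparr>) ` (Pow (pverts G) \<times> Pow (parcs G))"
      by (intro image_eqI[of _ _ "(pverts B, parcs B)"]) auto
  qed
  have "card (copies H G) \<le> 2 ^ n * 2 ^ (n * n)" if "pair_graph G" "card (pverts G) = n"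
    for G :: "nat pair_pre_digraph"
  proof -
    interpret pair_graph G by (fact that(1))
    have "parcs G \<subseteq> pverts G \<times> pverts G"
      by (auto dest: in_arcsD1 in_arcsD2)
    then have "card (parcs G) \<le> card (pverts G \<times> pverts G)"
      by (intro card_mono) (simp_all add: pair_finite_verts)
    then have le: "card (parcs G) \<le> n * n"
      by (simp add: card_cartesian_product that(2))
    have "card (copies H G) \<le> card (Pow (pverts G) \<times> Pow (parcs G))"
      by (rule surj_card_le[OF _ sub]) (simp add: pair_finite_verts pair_finite_arcs)
    also have "\<dots> = 2 ^ n * 2 ^ card (parcs G)"
      by (simp add: card_cartesian_product card_Pow pair_finite_verts pair_finite_arcs that(2))
    also have "\<dots> \<le> 2 ^ n * 2 ^ (n * n)"
      using le by simp
    finally show ?thesis .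
  qed
  then have "S \<subseteq> {..2 ^ n * 2 ^ (n * n)}"
    by (auto simp: S_def)
  then show "finite S"
    by (rule finite_subset) simp
  define G0 :: "nat pair_pre_digraph" where "G0 = \<lparr>pverts = {..<n}, parcs = {}\<rparr>"
  have "pair_graph G0"
    by unfold_locales (auto simp: G0_def symmetric_def sym_def)
  moreover have "is_free \<F> G0"
    using assms(1) by (auto simp: is_free_def copies_def subgraph_def G0_def digraph_iso_def app_iso_def with_proj_def)
  moreover have "card (pverts G0) = n"
    by (simp add: G0_def)
  ultimately show "S \<noteq> {}"
    unfolding S_def by blast
qed

definition cut_vertex :: "('a, 'b) pre_digraph \<Rightarrow> 'a \<Rightarrow> bool" where
  "cut_vertex G v \<longleftrightarrow> v \<in> verts G \<and>
     (\<exists>x \<in> verts G - {v}. \<exists>y \<in> verts G - {v}.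
        x \<rightarrow>\<^sup>*\<^bsub>G\<^esub> y \<and> \<not> x \<rightarrow>\<^sup>*\<^bsub>pre_digraph.del_vert G v\<^esub> y)"

text \<open>
  The blocks are the maximal connected subgraphs without a cut vertex of their own: the maximal
  2-connected subgraphs, the bridges with their ends, and the isolated vertices.
\<close>

definition blocks :: "'a pair_pre_digraph \<Rightarrow> 'a pair_pre_digraph set" where
  "blocks G = {B :: 'a pair_pre_digraph. pre_digraph.max_subgraph (with_proj G)
     (\<lambda>H. graph H \<and> Digraph_Component.connected H \<and> (\<forall>v. \<not> cut_vertex H v))
     (with_proj B)}"

end

theory Submission
  imports Defs
begin

text \<open>
  Let \<open>T = (2k choose r) / (2k - 1)\<close>. Every graph on at least two vertices without odd cycles longer
  than \<open>2k\<close> has a nonempty proper subset \<open>S\<close> of at most \<open>2k - 1\<close> vertices that meets at most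
  \<open>|S| T\<close> of the \<open>r\<close>-cliques; deleting \<open>S\<close> gives the bound by induction. To find \<open>S\<close>, consider the
  longest paths \<open>p\<^sub>0 \<dots> p\<^sub>N\<close>. All neighbours of \<open>p\<^sub>0\<close> lie on the path.

  If they always lie among the first \<open>2k\<close> vertices, take the path whose \<open>p\<^sub>0\<close> has the largest degree
  \<open>d\<close>. If \<open>d \<le> k\<close>, then \<open>S = {p\<^sub>0}\<close>. Otherwise \<open>S\<close> consists of the \<open>d\<close> predecessors of the
  neighbours of \<open>p\<^sub>0\<close>: they start longest paths as well, so they have degree at most \<open>d\<close> and at most
  \<open>2k - d\<close> neighbours outside \<open>S\<close>. Sharing each clique equally among its vertices in \<open>S\<close>, a vertex
  of \<open>S\<close> receives at most the average of \<open>j choose (r - 1)\<close> over an interval of \<open>j\<close> whose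
  midpoint is at most \<open>k\<close>; by convexity it is at most the average over \<open>1, \<dots>, 2k - 1\<close>, which is \<open>T\<close>.

  Otherwise let \<open>p\<^sub>s\<close> with \<open>s \<ge> 2k\<close> be a neighbour of \<open>p\<^sub>0\<close>, with \<open>s\<close> as large as possible among all
  longest paths. Then \<open>C = p\<^sub>0 \<dots> p\<^sub>s\<close> is an even cycle that contains all neighbours of \<open>p\<^sub>0\<close> and of
  \<open>p\<^bsub>s-1\<^esub>\<close>. Chords that split \<open>C\<close> into two odd cycles have a large span, and crossing chords give further odd
  cycles. It follows that \<open>p\<^sub>0\<close> or \<open>p\<^bsub>s-1\<^esub>\<close> is in at most
  \<open>(k choose (r - 1)) + ((k - 1) choose (r - 2)) \<le> T\<close> cliques; the last inequality needs \<open>k \<ge> 6\<close>.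

  For equality, split the graph at its cut vertices until the parts are blocks. A block with more than \<open>2k\<close>
  vertices cannot be extremal: deleting \<open>S\<close> would leave an extremal graph, hence a \<open>2k\<close>-clique, and
  an ear of that clique closes up to a long odd cycle.
\<close>

section \<open>Averages of binomial coefficients\<close>

text \<open>The value \<open>T\<close> of the overview: gluing a further complete graph on
  \<open>2 * k\<close> vertices to one vertex brings in \<open>2 * k - 1\<close> new vertices and
  \<open>2 * k choose r\<close> cliques.\<close>

definition clique_density :: "nat \<Rightarrow> nat \<Rightarrow> real" where
  "clique_density k r = real (2 * k choose r) / (2 * real k - 1)"

text \<open>The appended value is the largest one, so the average cannot drop. Denominators are
  cleared, and the shorter interval may be empty.\<close>

lemma average_Suc_le:
  fixes f :: "nat \<Rightarrow> real"
  assumes "\<And>i j. i \<le> j \<Longrightarrow> f i \<le> f j" and "s \<le> Suc t"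
  shows "(real (Suc t) - real s + 1) * sum f {s..t} \<le> (real t - real s + 1) * sum f {s..Suc t}"
proof -
  have "sum f {s..t} \<le> (\<Sum>j\<in>{s..t}. f (Suc t))"
    using assms(1) by (intro sum_mono) simp
  also have "\<dots> = (real t - real s + 1) * f (Suc t)"
    using assms(2) by (simp add: of_nat_diff)
  finally have "sum f {s..t} \<le> (real t - real s + 1) * f (Suc t)" .
  then show ?thesis
    using assms(2) by (simp add: algebra_simps)
qed

lemma convex_spread:
  fixes f :: "nat \<Rightarrow> real"
  assumes "\<And>j. f (Suc j) - f j \<le> f (Suc (Suc j)) - f (Suc j)"
  shows "i \<le> j \<Longrightarrow> f (Suc i) - f i \<le> f (Suc j) - f j"
proof (induction j rule: dec_induct)
  case (step j)
  then show ?case using assms[of j] by linarith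
qed simp

text \<open>Each unit step outwards adds an increment on the right and subtracts one on the left,
  which convexity makes no larger.\<close>

lemma convex_pair_le:
  fixes f :: "nat \<Rightarrow> real"
  assumes conv: "\<And>j. f (Suc j) - f j \<le> f (Suc (Suc j)) - f (Suc j)"
  shows "d \<le> s \<Longrightarrow> s \<le> t \<Longrightarrow> f s + f t \<le> f (s - d) + f (t + d)"
proof (induction d)
  case (Suc d)
  have "f (Suc (s - Suc d)) - f (s - Suc d) \<le> f (Suc (t + d)) - f (t + d)"
    using Suc.prems by (intro convex_spread[where f = f, OF conv]) linarith
  moreover have "Suc (s - Suc d) = s - d" using Suc.prems by linarith
  ultimately show ?case using Suc by simp
qed simp

text \<open>Pairing \<open>j\<close> with its mirror image \<open>s + Suc t - j\<close> bounds the
  average over the inner interval by the average of the two new end points. Hence including these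
  end points does not lower the average.\<close>

lemma average_widen_le:
  fixes f :: "nat \<Rightarrow> real"
  assumes conv: "\<And>j. f (Suc j) - f j \<le> f (Suc (Suc j)) - f (Suc j)"
    and "s \<le> t"
  shows "(real t - real s + 2) * sum f {Suc s..t} \<le> (real t - real s) * sum f {s..Suc t}"
proof -
  \<comment> \<open>The smaller of \<open>j\<close> and its mirror image moves left to
    \<open>s\<close>, the other one moves right to \<open>Suc t\<close> by the same
    distance.\<close>
  have pair: "f j + f (s + Suc t - j) \<le> f s + f (Suc t)" if "j \<in> {Suc s..t}" for j
  proof (cases "j \<le> s + Suc t - j")
    case True
    then show ?thesis
      using that convex_pair_le[where f = f, OF conv, of "j - s" j "s + Suc t - j"] by simp
  next
    case False
    then have "Suc t - j \<le> s + Suc t - j" by simp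
    then show ?thesis
      using that False convex_pair_le[where f = f, OF conv, of "Suc t - j" "s + Suc t - j" j] by simp
  qed
  have "sum f {Suc s..t} = (\<Sum>j\<in>{Suc s..t}. f (s + Suc t - j))"
    by (rule sum.reindex_bij_witness[of _ "\<lambda>j. s + Suc t - j" "\<lambda>j. s + Suc t - j"]) auto
  then have "2 * sum f {Suc s..t} = (\<Sum>j\<in>{Suc s..t}. f j + f (s + Suc t - j))"
    by (simp add: sum.distrib)
  also have "\<dots> \<le> (\<Sum>j\<in>{Suc s..t}. f s + f (Suc t))"
    using pair by (rule sum_mono)
  also have "\<dots> = (real t - real s) * (f s + f (Suc t))"
    using \<open>s \<le> t\<close> by (simp add: of_nat_diff)
  finally have "2 * sum f {Suc s..t} \<le> (real t - real s) * (f s + f (Suc t))" .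
  moreover have "sum f {s..Suc t} = f s + sum f {Suc s..t} + f (Suc t)"
    using \<open>s \<le> t\<close> by (simp add: sum.atLeast_Suc_atMost[of s])
  ultimately show ?thesis by (simp add: algebra_simps del: sum.cl_ivl_Suc)
qed

lemma average_mono:
  fixes f :: "nat \<Rightarrow> real"
  assumes mono: "\<And>i j. i \<le> j \<Longrightarrow> f i \<le> f j" and "s \<le> t" "t \<le> t'"
  shows "sum f {s..t} / (real t - real s + 1) \<le> sum f {s..t'} / (real t' - real s + 1)"
  using \<open>t \<le> t'\<close>
proof (induction t' rule: dec_induct)
  case (step n)
  have "sum f {s..n} / (real n - real s + 1) \<le> sum f {s..Suc n} / (real (Suc n) - real s + 1)"
    using average_Suc_le[of f s n, OF mono] step \<open>s \<le> t\<close> by (simp add: field_simps)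
  then show ?case using step by linarith
qed simp

text \<open>Symmetric widening until the left end is \<open>1\<close> gives the right end
  \<open>s + t - 1\<close>, which is at most \<open>m\<close>. Lengthening to \<open>m\<close> then
  does not lower the average either.\<close>

lemma average_le_initial:
  fixes f :: "nat \<Rightarrow> real"
  assumes mono: "\<And>i j. i \<le> j \<Longrightarrow> f i \<le> f j"
    and conv: "\<And>j. f (Suc j) - f j \<le> f (Suc (Suc j)) - f (Suc j)"
    and "1 \<le> s" "s \<le> t" "s + t \<le> Suc m"
  shows "sum f {s..t} / (real t - real s + 1) \<le> sum f {1..m} / real m"
  using assms(3-5)
proof (induction s arbitrary: t rule: nat_induct_at_least)
  case base
  then show ?case using average_mono[of f 1 t m, OF mono] by simp
next
  case (Suc s)
  have "sum f {Suc s..t} / (real t - real (Suc s) + 1) \<le> sum f {s..Suc t} / (real (Suc t) - real s + 1)"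
    using average_widen_le[of f s t, OF conv] Suc.prems by (simp add: field_simps)
  also have "\<dots> \<le> sum f {1..m} / real m"
    using Suc.prems by (intro Suc.IH) auto
  finally show ?case .
qed

text \<open>The hockey-stick identity, truncated at \<open>s\<close>.\<close>

lemma sum_binomial_interval:
  assumes "s \<le> t"
  shows "(\<Sum>j=s..t. j choose q) + (s choose Suc q) = Suc t choose Suc q"
  using assms by (induction t rule: dec_induct) (simp_all add: sum.atLeast_Suc_atMost)

text \<open>For positive \<open>q\<close> the numbers \<open>j choose q\<close> are nondecreasing
  and convex in \<open>j\<close>, and by the hockey-stick identity their average over
  \<open>1, \<dots>, 2 * k - 1\<close> is exactly the clique density.\<close>

lemma average_binomial_le_clique_density:
  assumes "1 \<le> q" "s \<le> t" "t \<le> 2 * k - 1" "s + t \<le> 2 * k" "1 \<le> k"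
  shows "(\<Sum>j=s..t. real (j choose q)) / (real t - real s + 1) \<le> clique_density k (Suc q)"
proof -
  define f where "f j = real (j choose q)" for j
  have mono: "f i \<le> f j" if "i \<le> j" for i j
    using that by (simp add: f_def binomial_right_mono)
  obtain p where p: "q = Suc p" using \<open>1 \<le> q\<close> by (cases q) auto
  have conv: "f (Suc j) - f j \<le> f (Suc (Suc j)) - f (Suc j)" for j
    by (simp add: f_def p binomial_right_mono)
  have total: "sum f {1..2 * k - 1} / real (2 * k - 1) = clique_density k (Suc q)"
  proof -
    have "(\<Sum>j=1..2 * k - 1. j choose q) = 2 * k choose Suc q"
      using sum_binomial_interval[of 1 "2 * k - 1" q] assms by (simp add: p)
    moreover have "real (2 * k - 1) = 2 * real k - 1" using \<open>1 \<le> k\<close> by linarith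
    ultimately show ?thesis
      unfolding f_def clique_density_def by (metis of_nat_sum)
  qed
  have initial: "sum f {s'..t'} / (real t' - real s' + 1) \<le> clique_density k (Suc q)"
    if "1 \<le> s'" "s' \<le> t'" "s' + t' \<le> 2 * k" for s' t'
    using average_le_initial[of f s' t' "2 * k - 1", OF mono conv] that total by simp
  have "sum f {s..t} / (real t - real s + 1) \<le> clique_density k (Suc q)"
  proof (cases "s = 0")
    case True
    show ?thesis
    proof (cases "t = 0")
      case True
      then show ?thesis using \<open>s = 0\<close> \<open>1 \<le> k\<close> by (simp add: f_def p clique_density_def)
    next
      case False
      \<comment> \<open>The term \<open>0 choose q\<close> vanishes, so dropping it does not lower
        the average and leaves an interval that starts at \<open>1\<close>.\<close>
      have "sum f {0..t} = sum f {1..t}"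
        by (simp add: sum.atLeast_Suc_atMost f_def p)
      moreover have "sum f {1..t} \<ge> 0" by (simp add: f_def sum_nonneg)
      ultimately have "sum f {0..t} / (real t - real 0 + 1) \<le> sum f {1..t} / (real t - real 1 + 1)"
        using False by (simp add: frac_le)
      also have "\<dots> \<le> clique_density k (Suc q)"
        using False assms by (intro initial) auto
      finally show ?thesis using \<open>s = 0\<close> by simp
    qed
  qed (use assms initial in auto)
  then show ?thesis by (simp add: f_def)
qed

section \<open>Binomial estimates for vertices of small degree\<close>

lemma binomial_Suc_absorb: "Suc j * (n choose Suc j) = (n - j) * (n choose j)"
  by (metis binomial_absorb_comp binomial_absorption diff_Suc_1 nat_arith.rule0)

text \<open>Induction on \<open>p\<close>. For \<open>p = 1\<close>, cancelling \<open>k - 1\<close>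
  leaves \<open>3 * (k + 2) \<le> 4 * k\<close>, which is exactly \<open>6 \<le> k\<close>. From
  \<open>p\<close> to \<open>Suc p\<close> the right binomial gains at least twice the factor of the
  left one, while the polynomial factor on the left at most doubles.\<close>

lemma binomial_comparison:
  assumes "6 \<le> k" "1 \<le> p"
  shows "(k + p + 1) * (p + 2) * ((k - 1) choose p) \<le> 2 * k * ((2 * k - 2) choose p)"
  using assms(2)
proof (induction p rule: nat_induct_at_least)
  case base
  obtain l where "k = l + 6" using \<open>6 \<le> k\<close> by (metis add.commute le_Suc_ex)
  then show ?case by (simp add: algebra_simps)
next
  case (Suc p)
  show ?case
  proof (cases "p < k - 1")
    case False
    then show ?thesis by (simp add: binomial_eq_0)
  next
    case True
    \<comment> \<open>In terms of \<open>l\<close> the quotients of consecutive binomial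
      coefficients are \<open>l / Suc p\<close> on the left and \<open>(2 * l + p) / Suc p\<close>
      on the right.\<close>
    define l where "l = k - 1 - p"
    have l: "l \<ge> 1" "k = l + p + 1" using True by (auto simp: l_def)
    have 1: "Suc p * ((k - 1) choose Suc p) = l * ((k - 1) choose p)"
      using binomial_Suc_absorb[of p "k - 1"] l by simp
    have 2: "Suc p * ((2 * k - 2) choose Suc p) = (2 * l + p) * ((2 * k - 2) choose p)"
      using binomial_Suc_absorb[of p "2 * k - 2"] l by (simp add: algebra_simps)
    have ratio: "(k + Suc p + 1) * (Suc p + 2) * l \<le> (k + p + 1) * (p + 2) * (2 * l + p)"
    proof -
      have "(k + Suc p + 1) * (Suc p + 2) \<le> (k + p + 1) * (p + 2) * 2"
        using Suc \<open>6 \<le> k\<close> by (simp add: algebra_simps)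
      then have "(k + Suc p + 1) * (Suc p + 2) * l \<le> (k + p + 1) * (p + 2) * 2 * l"
        by (rule mult_le_mono1)
      also have "\<dots> \<le> (k + p + 1) * (p + 2) * (2 * l + p)"
        by (simp add: algebra_simps)
      finally show ?thesis .
    qed
    have "Suc p * ((k + Suc p + 1) * (Suc p + 2) * ((k - 1) choose Suc p)) =
      (k + Suc p + 1) * (Suc p + 2) * (Suc p * ((k - 1) choose Suc p))"
      by (simp only: mult.left_commute mult.assoc mult.commute)
    also have "\<dots> = (k + Suc p + 1) * (Suc p + 2) * l * ((k - 1) choose p)"
      unfolding 1 by (simp only: mult.assoc)
    also have "\<dots> \<le> (k + p + 1) * (p + 2) * (2 * l + p) * ((k - 1) choose p)"
      using ratio by (rule mult_le_mono1)
    also have "\<dots> = (2 * l + p) * ((k + p + 1) * (p + 2) * ((k - 1) choose p))"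
      by (simp only: mult.left_commute mult.assoc mult.commute)
    also have "\<dots> \<le> (2 * l + p) * (2 * k * ((2 * k - 2) choose p))"
      using Suc.IH by (rule mult_le_mono2)
    also have "\<dots> = 2 * k * (Suc p * ((2 * k - 2) choose Suc p))"
      unfolding 2 by (simp only: mult.left_commute mult.assoc mult.commute)
    also have "\<dots> = Suc p * (2 * k * ((2 * k - 2) choose Suc p))"
      by (simp only: mult.left_commute mult.assoc mult.commute)
    finally show ?thesis by (simp only: mult_le_cancel1 zero_less_Suc)
  qed
qed

text \<open>With \<open>q = Suc p\<close> the left side is \<open>(k + p + 1) / (p + 1)\<close>
  times \<open>(k - 1) choose p\<close>, and the density is
  \<open>2 * k / ((p + 1) * (p + 2))\<close> times \<open>(2 * k - 2) choose p\<close>. The claim is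
  thus \<open>binomial_comparison\<close>.\<close>

lemma choose_plus_choose_le_clique_density:
  assumes "6 \<le> k" "2 \<le> q"
  shows "real (k choose q) + real ((k - 1) choose (q - 1)) \<le> clique_density k (Suc q)"
proof -
  obtain p where q: "q = Suc p" "1 \<le> p" using \<open>2 \<le> q\<close> by (cases q) auto
  have 1: "real (Suc p) * real (k choose Suc p) = real k * real ((k - 1) choose p)"
    using binomial_absorption[of p k] by (metis of_nat_mult)
  have "Suc (Suc p) * (2 * k choose Suc (Suc p)) = 2 * k * ((2 * k - 1) choose Suc p)"
    by (rule binomial_absorption)
  moreover have "Suc p * ((2 * k - 1) choose Suc p) = (2 * k - 1) * ((2 * k - 2) choose p)"
    using binomial_absorption[of p "2 * k - 1"] by (simp add: numeral_2_eq_2)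
  ultimately have "Suc p * (Suc (Suc p) * (2 * k choose Suc (Suc p)))
      = (2 * k - 1) * (2 * k * ((2 * k - 2) choose p))"
    by (metis mult.left_commute)
  then have 4: "real (Suc p * (Suc (Suc p) * (2 * k choose Suc (Suc p))))
      = real ((2 * k - 1) * (2 * k * ((2 * k - 2) choose p)))"
    by (rule arg_cong)
  then have 2: "real (Suc p) * (real (Suc (Suc p)) * real (2 * k choose Suc (Suc p)))
      = (2 * real k - 1) * (2 * real k * real ((2 * k - 2) choose p))"
  proof -
    have "real (2 * k - 1) = 2 * real k - 1" using \<open>6 \<le> k\<close> by linarith
    then show ?thesis using 4 by (simp only: of_nat_mult of_nat_numeral)
  qed
  have "real ((k + p + 1) * (p + 2) * ((k - 1) choose p)) \<le> real (2 * k * ((2 * k - 2) choose p))"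
    using binomial_comparison[OF \<open>6 \<le> k\<close> q(2)] by (rule of_nat_mono)
  then have 3: "(real k + real p + 1) * (real p + 2) * real ((k - 1) choose p)
      \<le> 2 * real k * real ((2 * k - 2) choose p)"
    by (simp only: of_nat_mult of_nat_add of_nat_numeral of_nat_1)
  have pos: "2 * real k - 1 > 0" using \<open>6 \<le> k\<close> by simp
  have "real (Suc p) * real (Suc (Suc p)) * ((2 * real k - 1) * (real (k choose q) + real ((k - 1) choose (q - 1))))
    = (2 * real k - 1) * real (Suc (Suc p)) * (real (Suc p) * real (k choose Suc p) + real (Suc p) * real ((k - 1) choose p))"
    by (simp add: q algebra_simps)
  also have "\<dots> = (2 * real k - 1) * ((real k + real p + 1) * (real p + 2) * real ((k - 1) choose p))"
    unfolding 1 by (simp add: algebra_simps)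
  also have "\<dots> \<le> (2 * real k - 1) * (2 * real k * real ((2 * k - 2) choose p))"
    using 3 pos by (intro mult_left_mono) auto
  also have "\<dots> = real (Suc p) * real (Suc (Suc p)) * real (2 * k choose Suc q)"
    unfolding 2[symmetric] q by (simp only: mult.assoc)
  finally have "(2 * real k - 1) * (real (k choose q) + real ((k - 1) choose (q - 1))) \<le> real (2 * k choose Suc q)"
    by (subst (asm) mult_le_cancel_left_pos) simp_all
  then show ?thesis
    using pos by (simp add: clique_density_def pos_le_divide_eq mult.commute)
qed

section \<open>Weighted counts of subsets\<close>

text \<open>Here \<open>R\<close> is a clique through a vertex \<open>x\<close> of \<open>S\<close>
  with \<open>x\<close> removed, and \<open>A\<close> consists of the neighbours of \<open>x\<close>
  in \<open>S\<close>, so \<open>1 + card (R \<inter> A)\<close> counts the clique's vertices in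
  \<open>S\<close>. The weights are absorbed into binomial coefficients of
  \<open>Suc (card A)\<close>, and Vandermonde's identity yields an average over consecutive
  \<open>j\<close>.\<close>

lemma weighted_subsets_sum:
  assumes "finite A" "finite B" "A \<inter> B = {}"
  shows "(\<Sum>R | R \<subseteq> A \<union> B \<and> card R = q. 1 / (1 + real (card (R \<inter> A))))
    = (\<Sum>j=card B..card B + card A. real (j choose q)) / (real (card A) + 1)"
proof -
  define P where "P j = {X. X \<subseteq> A \<and> card X = j} \<times> {Y. Y \<subseteq> B \<and> card Y = q - j}" for j
  define a b where "a = card A" and "b = card B"
  have finP: "finite (P j)" for j
    using assms by (simp add: P_def)
  have cardP: "card (P j) = (a choose j) * (b choose (q - j))" for j
    using assms by (simp add: P_def card_cartesian_product n_subsets a_def b_def)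
  have "(\<Sum>R | R \<subseteq> A \<union> B \<and> card R = q. 1 / (1 + real (card (R \<inter> A))))
    = (\<Sum>(j, X, Y)\<in>Sigma {..q} P. 1 / (1 + real j))"
  proof (rule sum.reindex_bij_witness[of _ "\<lambda>(j, X, Y). X \<union> Y" "\<lambda>R. (card (R \<inter> A), R \<inter> A, R \<inter> B)"])
    fix R assume "R \<in> {R. R \<subseteq> A \<union> B \<and> card R = q}"
    then have R: "R \<subseteq> A \<union> B" "card R = q" by auto
    then have fin: "finite R" using assms finite_subset by blast
    have "R = (R \<inter> A) \<union> (R \<inter> B)" "(R \<inter> A) \<inter> (R \<inter> B) = {}" using R assms(3) by auto
    then have "card R = card (R \<inter> A) + card (R \<inter> B)"
      using fin by (metis card_Un_disjoint finite_Int)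
    then show "(card (R \<inter> A), R \<inter> A, R \<inter> B) \<in> Sigma {..q} P"
      using R by (auto simp: P_def)
    show "(\<lambda>(j, X, Y). X \<union> Y) (card (R \<inter> A), R \<inter> A, R \<inter> B) = R" using R by auto
    show "(case (card (R \<inter> A), R \<inter> A, R \<inter> B) of (j, X, Y) \<Rightarrow> 1 / (1 + real j)) = 1 / (1 + real (card (R \<inter> A)))"
      by simp
  next
    fix z assume "z \<in> Sigma {..q} P"
    then obtain j X Y where z: "z = (j, X, Y)" "j \<le> q" "X \<subseteq> A" "card X = j" "Y \<subseteq> B" "card Y = q - j"
      by (auto simp: P_def)
    have "(X \<union> Y) \<inter> A = X" "(X \<union> Y) \<inter> B = Y" using z assms(3) by auto
    then show "(\<lambda>R. (card (R \<inter> A), R \<inter> A, R \<inter> B)) ((\<lambda>(j, X, Y). X \<union> Y) z) = z" using z by simp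
    have "card (X \<union> Y) = card X + card Y"
      using z assms by (intro card_Un_disjoint) (auto dest: finite_subset)
    then show "(\<lambda>(j, X, Y). X \<union> Y) z \<in> {R. R \<subseteq> A \<union> B \<and> card R = q}" using z by auto
  qed
  also have "\<dots> = (\<Sum>j\<le>q. real ((a choose j) * (b choose (q - j))) / (1 + real j))"
    using finP by (subst sum.Sigma[symmetric]) (simp_all add: split_def cardP)
  also have "\<dots> = (\<Sum>j\<le>q. real ((Suc a choose Suc j) * (b choose (q - j)))) / (real a + 1)"
    unfolding sum_divide_distrib
  proof (rule sum.cong)
    fix j assume "j \<in> {..q}"
    have "real (Suc j * (Suc a choose Suc j)) = real (Suc a * (a choose j))"
      by (metis Suc_times_binomial)
    then have "real (a choose j) / (1 + real j) = real (Suc a choose Suc j) / (real a + 1)"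
      by (simp add: field_simps)
    then show "real ((a choose j) * (b choose (q - j))) / (1 + real j)
      = real ((Suc a choose Suc j) * (b choose (q - j))) / (real a + 1)"
      by (metis of_nat_mult times_divide_eq_left)
  qed simp
  also have "(\<Sum>j\<le>q. real ((Suc a choose Suc j) * (b choose (q - j)))) = (\<Sum>j=b..b + a. real (j choose q))"
  proof -
    \<comment> \<open>The term \<open>j = 0\<close> of Vandermonde's sum is
      \<open>b choose Suc q\<close>, the same number that the hockey-stick sum from \<open>b\<close>
      lacks, so it cancels.\<close>
    have "(\<Sum>j\<le>Suc q. (Suc a choose j) * (b choose (Suc q - j))) = (Suc a + b) choose Suc q"
      by (rule vandermonde)
    then have "(b choose Suc q) + (\<Sum>j\<le>q. (Suc a choose Suc j) * (b choose (q - j))) = (Suc a + b) choose Suc q"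
      by (simp only: sum.atMost_Suc_shift) simp
    moreover have "(\<Sum>j=b..b + a. j choose q) + (b choose Suc q) = Suc (b + a) choose Suc q"
      by (rule sum_binomial_interval) simp
    ultimately have "(\<Sum>j\<le>q. (Suc a choose Suc j) * (b choose (q - j))) = (\<Sum>j=b..b + a. j choose q)"
      by (simp add: add.commute)
    then show ?thesis by (metis of_nat_sum)
  qed
  finally show ?thesis by (simp add: a_def b_def)
qed

text \<open>\<open>N\<close> is to be the neighbourhood of a vertex of \<open>S\<close>. The average
  runs from \<open>card (N - S)\<close> to \<open>card N\<close>, and these end points add up to at
  most \<open>(2 * k - d) + d\<close>.\<close>

lemma weighted_subsets_le:
  assumes "finite N" "card N \<le> d" "card (N - S) \<le> 2 * k - d" "d \<le> 2 * k - 1" "1 \<le> q" "1 \<le> k"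
  shows "(\<Sum>R | R \<subseteq> N \<and> card R = q. 1 / (1 + real (card (R \<inter> S)))) \<le> clique_density k (Suc q)"
proof -
  have N: "N \<inter> S \<union> (N - S) = N" by blast
  have card: "card (N - S) + card (N \<inter> S) = card N"
    using \<open>finite N\<close> by (metis N Int_Diff_disjoint card_Un_disjoint finite_Diff finite_Int add.commute)
  have "(\<Sum>R | R \<subseteq> N \<and> card R = q. 1 / (1 + real (card (R \<inter> S))))
    = (\<Sum>R | R \<subseteq> N \<inter> S \<union> (N - S) \<and> card R = q. 1 / (1 + real (card (R \<inter> (N \<inter> S)))))"
    unfolding N by (rule sum.cong) (auto intro!: arg_cong[of _ _ card])
  also have "\<dots> = (\<Sum>j=card (N - S)..card (N - S) + card (N \<inter> S). real (j choose q)) / (real (card (N \<inter> S)) + 1)"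
    using \<open>finite N\<close> by (intro weighted_subsets_sum) auto
  also have "\<dots> = (\<Sum>j=card (N - S)..card N. real (j choose q)) / (real (card N) - real (card (N - S)) + 1)"
    using card by (simp flip: card)
  also have "\<dots> \<le> clique_density k (Suc q)"
    using assms card by (intro average_binomial_le_clique_density) auto
  finally show ?thesis .
qed

text \<open>Lowering all elements but the least by \<open>h - 1\<close> turns a set with gaps \<open>h\<close> into an arbitrary set.\<close>

lemma card_sets_with_gaps_le:
  assumes "1 \<le> h" "2 \<le> q"
  shows "card {A. A \<subseteq> {..<n + h - 1} \<and> card A = q \<and> (\<forall>a\<in>A. \<forall>b\<in>A. a < b \<longrightarrow> a + h \<le> b)} \<le> n choose q"
proof -
  define F where "F = {A. A \<subseteq> {..<n + h - 1} \<and> card A = q \<and> (\<forall>a\<in>A. \<forall>b\<in>A. a < b \<longrightarrow> a + h \<le> b)}"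
  define g where "g A = insert (Min A) ((\<lambda>b. b - (h - 1)) ` (A - {Min A}))" for A
  have A: "finite A" "Min A \<in> A" "\<And>b. b \<in> A - {Min A} \<Longrightarrow> Min A < b - (h - 1) \<and> h \<le> b" "A - {Min A} \<noteq> {}"
    if "A \<in> F" for A
  proof -
    show fin: "finite A" using that finite_subset by (fastforce simp: F_def)
    have "A \<noteq> {}" using that \<open>2 \<le> q\<close> by (auto simp: F_def)
    then show Min: "Min A \<in> A" using fin by simp
    show "A - {Min A} \<noteq> {}"
    proof
      assume "A - {Min A} = {}"
      then have "card A \<le> card {Min A}" by (intro card_mono) auto
      then show False using that \<open>2 \<le> q\<close> by (simp add: F_def)
    qed
    fix b assume "b \<in> A - {Min A}"
    moreover from this have "Min A < b" using fin by (metis DiffE Min_le insertI1 le_neq_implies_less)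
    ultimately have "Min A + h \<le> b" using that Min by (auto simp: F_def)
    then show "Min A < b - (h - 1) \<and> h \<le> b" using \<open>1 \<le> h\<close> by auto
  qed
  have Min_g: "Min (g A) = Min A" if "A \<in> F" for A
  proof (rule Min_eqI)
    show "finite (g A)" using A(1)[OF that] by (simp add: g_def)
    show "Min A \<in> g A" by (simp add: g_def)
    fix y assume "y \<in> g A"
    then consider "y = Min A" | b where "b \<in> A - {Min A}" "y = b - (h - 1)"
      unfolding g_def by blast
    then show "Min A \<le> y"
    proof cases
      case (2 b)
      then show ?thesis using A(3)[OF that, of b] by linarith
    qed simp
  qed
  have rest_g: "g A - {Min A} = (\<lambda>b. b - (h - 1)) ` (A - {Min A})" if "A \<in> F" for A
  proof -
    have "Min A \<notin> (\<lambda>b. b - (h - 1)) ` (A - {Min A})" using A(3)[OF that] by (metis imageE nat_less_le)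
    then show ?thesis unfolding g_def by blast
  qed
  have inv: "A = insert (Min (g A)) ((\<lambda>b. b + (h - 1)) ` (g A - {Min (g A)}))" if "A \<in> F" for A
  proof -
    have "(\<lambda>b. b + (h - 1)) ` (g A - {Min A}) = (\<lambda>b. b) ` (A - {Min A})"
      unfolding rest_g[OF that] image_image
    proof (rule image_cong[OF refl])
      fix b assume "b \<in> A - {Min A}"
      then have "h \<le> b" using A(3)[OF that] by blast
      then show "b - (h - 1) + (h - 1) = b" by simp
    qed
    then show ?thesis using A(2)[OF that] Min_g[OF that] by auto
  qed
  have "inj_on g F"
    by (rule inj_onI) (metis inv)
  moreover have "g ` F \<subseteq> {B. B \<subseteq> {..<n} \<and> card B = q}"
  proof (rule image_subsetI)
    fix X assume X: "X \<in> F"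
    have inj: "inj_on (\<lambda>b. b - (h - 1)) (X - {Min X})"
    proof (rule inj_onI)
      fix b c assume "b \<in> X - {Min X}" "c \<in> X - {Min X}" "b - (h - 1) = c - (h - 1)"
      moreover from this have "h \<le> b" "h \<le> c" using A(3)[OF X] by blast+
      ultimately show "b = c" by linarith
    qed
    have "Min X \<notin> (\<lambda>b. b - (h - 1)) ` (X - {Min X})"
      using A(3)[OF X] by (metis imageE nat_less_le)
    then have "card (g X) = Suc (card (X - {Min X}))"
      using A(1)[OF X] inj by (simp add: g_def card_image)
    also have "\<dots> = card X" using A(1,2)[OF X] by (rule card_Suc_Diff1)
    finally have "card (g X) = q" using X by (simp add: F_def)
    moreover have small: "b - (h - 1) < n" if "b \<in> X - {Min X}" for b
    proof -
      have "b < n + h - 1" using that X by (auto simp: F_def)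
      then show ?thesis using A(3)[OF X that] by linarith
    qed
    \<comment> \<open>The minimum itself is not lowered, so its bound comes from a second element,
      which \<open>2 \<le> q\<close> provides.\<close>
    have "Min X < n"
    proof -
      obtain b where "b \<in> X - {Min X}" using A(4)[OF X] by blast
      then show ?thesis using small[of b] A(3)[OF X, of b] by linarith
    qed
    then have "g X \<subseteq> {..<n}" using small by (auto simp: g_def)
    ultimately show "g X \<in> {B. B \<subseteq> {..<n} \<and> card B = q}" by simp
  qed
  ultimately have "card F \<le> card {B. B \<subseteq> {..<n} \<and> card B = q}"
    by (intro card_inj_on_le) auto
  then show ?thesis by (simp add: n_subsets F_def)
qed

text \<open>\<open>A\<close> misses \<open>B\<close>, because equal elements violate the gap, and
  also the \<open>h - 2\<close> numbers that follow \<open>Max B\<close>. These three disjoint sets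
  lie below \<open>k + h - 1\<close>.\<close>

lemma card_add_card_le_if_avoiding:
  fixes A B :: "nat set"
  assumes "A \<subseteq> {..<k + h - 1}" "B \<subseteq> {..<k - 1}" "B \<noteq> {}" "2 \<le> h"
    and avoid: "\<And>a b. a \<in> A \<Longrightarrow> b \<in> B \<Longrightarrow> b \<le> a \<Longrightarrow> b + h - 1 \<le> a"
  shows "card A + card B \<le> k + 1"
proof -
  have fin: "finite A" "finite B" using assms(1,2) finite_subset by blast+
  define M where "M = Max B"
  have M: "M \<in> B" "\<And>b. b \<in> B \<Longrightarrow> b \<le> M" using fin assms(3) by (auto simp: M_def)
  define I where "I = {Suc M..<M + h - 1}"
  have disj: "B \<inter> I = {}" using M(2) by (force simp: I_def)
  have "A \<inter> (B \<union> I) = {}"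
  proof -
    have "a \<notin> B" if "a \<in> A" for a using avoid[OF that, of a] \<open>2 \<le> h\<close> by auto
    moreover have "a \<notin> I" if "a \<in> A" for a using avoid[OF that M(1)] \<open>2 \<le> h\<close> by (auto simp: I_def)
    ultimately show ?thesis by blast
  qed
  then have "card A + card (B \<union> I) = card (A \<union> (B \<union> I))"
    using fin by (simp add: card_Un_disjoint I_def)
  also have "\<dots> \<le> card {..<k + h - 1}"
  proof (rule card_mono)
    have "M < k - 1" using assms(2) M(1) by blast
    then have "I \<subseteq> {..<k + h - 1}" "B \<subseteq> {..<k + h - 1}" using assms(2) by (auto simp: I_def)
    then show "A \<union> (B \<union> I) \<subseteq> {..<k + h - 1}" using assms(1) by blast
  qed simp
  finally have "card A + card (B \<union> I) \<le> k + h - 1" by simp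
  moreover have "card (B \<union> I) = card B + (h - 2)"
    using fin disj by (subst card_Un_disjoint) (auto simp: I_def)
  ultimately show ?thesis using \<open>2 \<le> h\<close> by linarith
qed

section \<open>Cliques, paths and cycles\<close>

text \<open>The graph is a relation on the whole type and vertex sets are separate arguments, so
  that deleting vertices in the inductions only shrinks a set \<open>U\<close>.\<close>

locale adjacency =
  fixes E :: "'a \<Rightarrow> 'a \<Rightarrow> bool"
  assumes sym: "E x y \<Longrightarrow> E y x" and irrefl: "\<not> E x x"
begin

definition cliques :: "'a set \<Rightarrow> nat \<Rightarrow> 'a set set" where
  "cliques U r = {Q. Q \<subseteq> U \<and> card Q = r \<and> (\<forall>x\<in>Q. \<forall>y\<in>Q. x \<noteq> y \<longrightarrow> E x y)}"

definition nbrs :: "'a set \<Rightarrow> 'a \<Rightarrow> 'a set" where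
  "nbrs U v = {w \<in> U. E v w}"

text \<open>Irreflexivity excludes length one. An edge counts as a cycle of length two, which is
  harmless because only odd lengths are bounded.\<close>

definition cycle :: "'a list \<Rightarrow> bool" where
  "cycle xs \<longleftrightarrow> distinct xs \<and> successively E xs \<and> E (last xs) (hd xs)"

definition odd_cycles_le :: "nat \<Rightarrow> 'a set \<Rightarrow> bool" where
  "odd_cycles_le l U \<longleftrightarrow> (\<forall>xs. set xs \<subseteq> U \<and> cycle xs \<and> odd (length xs) \<longrightarrow> length xs \<le> l)"

lemma odd_cycles_leD:
  "odd_cycles_le l U \<Longrightarrow> set xs \<subseteq> U \<Longrightarrow> cycle xs \<Longrightarrow> odd (length xs) \<Longrightarrow> length xs \<le> l"
  by (simp add: odd_cycles_le_def)

lemma odd_cycles_le_mono: "odd_cycles_le l U \<Longrightarrow> W \<subseteq> U \<Longrightarrow> odd_cycles_le l W"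
  unfolding odd_cycles_le_def by blast

lemma finite_cliques [simp]: "finite U \<Longrightarrow> finite (cliques U r)"
  by (simp add: cliques_def)

lemma cliques_subset_subsets: "cliques U r \<subseteq> {Q. Q \<subseteq> U \<and> card Q = r}"
  by (auto simp: cliques_def)

lemma card_cliques_le: "finite U \<Longrightarrow> card (cliques U r) \<le> card U choose r"
  using card_mono[OF _ cliques_subset_subsets, of U r] by (simp add: n_subsets)

lemma nbrs_subset: "nbrs U v \<subseteq> U"
  by (auto simp: nbrs_def)

lemma finite_nbrs [simp]: "finite U \<Longrightarrow> finite (nbrs U v)"
  by (simp add: nbrs_def)

lemma not_in_nbrs: "v \<notin> nbrs U v"
  by (simp add: nbrs_def irrefl)

section \<open>Counting the cliques that meet a given set\<close>

lemma card_cliques_remove: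
  assumes "finite U"
  shows "card (cliques U r) = card (cliques (U - S) r) + card {Q \<in> cliques U r. Q \<inter> S \<noteq> {}}"
proof -
  have "cliques U r = cliques (U - S) r \<union> {Q \<in> cliques U r. Q \<inter> S \<noteq> {}}"
    by (auto simp: cliques_def)
  moreover have "cliques (U - S) r \<inter> {Q \<in> cliques U r. Q \<inter> S \<noteq> {}} = {}"
    by (auto simp: cliques_def)
  ultimately show ?thesis
    using assms by (metis (no_types, lifting) card_Un_disjoint finite_Un finite_cliques)
qed

lemma clique_remove_vertex:
  assumes "Q \<in> cliques U (Suc q)" "v \<in> Q"
  shows "Q - {v} \<in> cliques (nbrs U v) q" and "insert v (Q - {v}) = Q" and "finite Q"
proof -
  show "finite Q" using assms by (auto simp: cliques_def intro: card_ge_0_finite)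
  then show "Q - {v} \<in> cliques (nbrs U v) q"
    using assms by (auto simp: cliques_def nbrs_def)
  show "insert v (Q - {v}) = Q" using assms by auto
qed

lemma card_cliques_through_le:
  assumes "finite U"
  shows "card {Q \<in> cliques U (Suc q). Q \<inter> {v} \<noteq> {}} \<le> card (cliques (nbrs U v) q)"
proof (rule card_inj_on_le[of "\<lambda>Q. Q - {v}"])
  show "inj_on (\<lambda>Q. Q - {v}) {Q \<in> cliques U (Suc q). Q \<inter> {v} \<noteq> {}}"
    by (rule inj_onI) blast
  show "(\<lambda>Q. Q - {v}) ` {Q \<in> cliques U (Suc q). Q \<inter> {v} \<noteq> {}} \<subseteq> cliques (nbrs U v) q"
    using clique_remove_vertex(1) by blast
qed (use assms in simp)

text \<open>Every clique gives the share \<open>1 / card (Q \<inter> S)\<close> to each of its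
  vertices in \<open>S\<close>, in total 1. At a vertex \<open>x\<close> the cliques become subsets
  \<open>Q - {x}\<close> of its neighbourhood, whose shares \<open>weighted_subsets_le\<close>
  bounds.\<close>

lemma card_cliques_meeting_le:
  assumes "finite U" "S \<subseteq> U" "1 \<le> q" "1 \<le> k" "d \<le> 2 * k - 1"
    and deg: "\<And>x. x \<in> S \<Longrightarrow> card (nbrs U x) \<le> d"
    and out: "\<And>x. x \<in> S \<Longrightarrow> card (nbrs U x - S) \<le> 2 * k - d"
  shows "real (card {Q \<in> cliques U (Suc q). Q \<inter> S \<noteq> {}}) \<le> real (card S) * clique_density k (Suc q)"
proof -
  define M where "M = {Q \<in> cliques U (Suc q). Q \<inter> S \<noteq> {}}"
  have fin: "finite M" "finite S" using assms(1,2) finite_subset by (auto simp: M_def)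
  have pos: "card (Q \<inter> S) > 0" if "Q \<in> M" for Q
    using that fin(2) by (auto simp: M_def card_gt_0_iff)
  have "real (card M) = (\<Sum>Q\<in>M. \<Sum>x\<in>{x\<in>S. x \<in> Q}. 1 / real (card (Q \<inter> S)))"
  proof -
    have "(\<Sum>x\<in>{x\<in>S. x \<in> Q}. 1 / real (card (Q \<inter> S))) = 1" if "Q \<in> M" for Q
    proof -
      have "{x\<in>S. x \<in> Q} = Q \<inter> S" by auto
      then show ?thesis using pos[OF that] by simp
    qed
    then have "(\<Sum>Q\<in>M. \<Sum>x\<in>{x\<in>S. x \<in> Q}. 1 / real (card (Q \<inter> S))) = (\<Sum>Q\<in>M. 1)"
      by (rule sum.cong[OF refl])
    then show ?thesis by simp
  qed
  also have "\<dots> = (\<Sum>x\<in>S. \<Sum>Q\<in>{Q\<in>M. x \<in> Q}. 1 / real (card (Q \<inter> S)))"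
    using fin by (rule sum.swap_restrict)
  also have "\<dots> \<le> (\<Sum>x\<in>S. clique_density k (Suc q))"
  proof (rule sum_mono)
    fix x assume x: "x \<in> S"
    have card: "card (Q \<inter> S) = 1 + card ((Q - {x}) \<inter> S)" if "Q \<in> M" "x \<in> Q" for Q
    proof -
      have "Q \<inter> S = insert x ((Q - {x}) \<inter> S)" using that x by auto
      moreover have "finite ((Q - {x}) \<inter> S)" using fin(2) by simp
      ultimately show ?thesis by (simp only: card_insert_if) simp
    qed
    have inj: "inj_on (\<lambda>Q. Q - {x}) {Q\<in>M. x \<in> Q}"
      by (rule inj_onI) blast
    have sub: "(\<lambda>Q. Q - {x}) ` {Q\<in>M. x \<in> Q} \<subseteq> {R. R \<subseteq> nbrs U x \<and> card R = q}"
      using clique_remove_vertex(1) cliques_subset_subsets by (fastforce simp: M_def)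
    have "(\<Sum>Q\<in>{Q\<in>M. x \<in> Q}. 1 / real (card (Q \<inter> S)))
      = (\<Sum>R\<in>(\<lambda>Q. Q - {x}) ` {Q\<in>M. x \<in> Q}. 1 / (1 + real (card (R \<inter> S))))"
      by (subst sum.reindex[OF inj]) (auto intro!: sum.cong simp: card)
    \<comment> \<open>Adjacency inside the neighbourhood is given up: every \<open>q\<close>-subset
      is counted.\<close>
    also have "\<dots> \<le> (\<Sum>R | R \<subseteq> nbrs U x \<and> card R = q. 1 / (1 + real (card (R \<inter> S))))"
      using \<open>finite U\<close> by (intro sum_mono2[OF _ sub]) auto
    also have "\<dots> \<le> clique_density k (Suc q)"
      using assms x by (intro weighted_subsets_le) auto
    finally show "(\<Sum>Q\<in>{Q\<in>M. x \<in> Q}. 1 / real (card (Q \<inter> S))) \<le> clique_density k (Suc q)" .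
  qed
  finally show ?thesis by (simp add: M_def)
qed

text \<open>The cliques avoiding \<open>u\<close> live on at most \<open>k\<close> vertices. Those
  through \<open>u\<close> avoid \<open>w\<close>, so their other vertices are among at most
  \<open>k - 1\<close>.\<close>

lemma card_cliques_nonadjacent_le:
  assumes "finite N" "card N \<le> Suc k" "u \<in> N" "w \<in> N" "u \<noteq> w" "\<not> E u w" "1 \<le> q"
  shows "card (cliques N q) \<le> (k choose q) + ((k - 1) choose (q - 1))"
proof -
  obtain p where q: "q = Suc p" using \<open>1 \<le> q\<close> by (cases q) auto
  have "card (cliques N q) = card (cliques (N - {u}) q) + card {Q \<in> cliques N q. Q \<inter> {u} \<noteq> {}}"
    using \<open>finite N\<close> by (rule card_cliques_remove)
  moreover have "card (cliques (N - {u}) q) \<le> k choose q"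
  proof -
    have "card (cliques (N - {u}) q) \<le> card (N - {u}) choose q"
      using \<open>finite N\<close> by (simp add: card_cliques_le)
    also have "\<dots> \<le> k choose q"
      using assms by (intro binomial_right_mono) simp
    finally show ?thesis .
  qed
  moreover have "card {Q \<in> cliques N q. Q \<inter> {u} \<noteq> {}} \<le> (k - 1) choose (q - 1)"
  proof -
    have "nbrs N u \<subseteq> N - {u, w}" using assms(6) irrefl by (auto simp: nbrs_def)
    then have "card (nbrs N u) \<le> card (N - {u, w})"
      using \<open>finite N\<close> by (intro card_mono) auto
    also have "\<dots> \<le> k - 1" using assms by (simp add: card_Diff_subset)
    finally have "card (nbrs N u) choose p \<le> (k - 1) choose p" by (rule binomial_right_mono)
    moreover have "card {Q \<in> cliques N q. Q \<inter> {u} \<noteq> {}} \<le> card (cliques (nbrs N u) p)"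
      unfolding q using \<open>finite N\<close> by (rule card_cliques_through_le)
    moreover have "card (cliques (nbrs N u) p) \<le> card (nbrs N u) choose p"
      using \<open>finite N\<close> by (simp add: card_cliques_le)
    ultimately show ?thesis by (simp add: q)
  qed
  ultimately show ?thesis by linarith
qed

subsection \<open>Longest paths\<close>

definition path :: "'a set \<Rightarrow> 'a list \<Rightarrow> bool" where
  "path U xs \<longleftrightarrow> xs \<noteq> [] \<and> distinct xs \<and> successively E xs \<and> set xs \<subseteq> U"

definition longest_path :: "'a set \<Rightarrow> 'a list \<Rightarrow> bool" where
  "longest_path U xs \<longleftrightarrow> path U xs \<and> (\<forall>ys. path U ys \<longrightarrow> length ys \<le> length xs)"

lemma length_path_le: "finite U \<Longrightarrow> path U xs \<Longrightarrow> length xs \<le> card U"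
  unfolding path_def by (metis card_mono distinct_card)

lemma longest_path_exists:
  assumes "finite U" "U \<noteq> {}"
  shows "\<exists>xs. longest_path U xs"
proof -
  obtain u where "u \<in> U" using assms by blast
  then have "path U [u]" by (simp add: path_def)
  moreover have "\<forall>ys. path U ys \<longrightarrow> length ys < Suc (card U)"
    using length_path_le[OF \<open>finite U\<close>] by (simp add: less_Suc_eq_le)
  ultimately show ?thesis
    unfolding longest_path_def by (rule ex_has_greatest_nat)
qed

text \<open>A neighbour off the path could be prepended.\<close>

lemma nbrs_longest_path:
  assumes "longest_path U xs"
  shows "nbrs U (hd xs) \<subseteq> set xs"
proof
  fix w assume w: "w \<in> nbrs U (hd xs)"
  show "w \<in> set xs"
  proof (rule ccontr)
    assume "w \<notin> set xs"
    then have "path U (w # xs)"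
      using assms w sym by (auto simp: longest_path_def path_def nbrs_def successively_Cons)
    then have "length (w # xs) \<le> length xs" using assms unfolding longest_path_def by blast
    then show False by simp
  qed
qed

lemma successively_rev_sym: "successively E (rev xs) \<longleftrightarrow> successively E xs"
  unfolding successively_rev by (rule successively_cong) (use sym in blast)+

text \<open>Posa's rotation: for positive \<open>i\<close> within the path,
  \<open>xs ! (i - 1)\<close> becomes the first vertex.\<close>

definition rotate_at :: "nat \<Rightarrow> 'b list \<Rightarrow> 'b list" where
  "rotate_at i xs = rev (take i xs) @ drop i xs"

lemma successively_take_drop:
  assumes "successively P xs"
  shows "successively P (take i xs)" "successively P (drop i xs)"
  using assms successively_append_iff[of P "take i xs" "drop i xs"] by auto

lemma length_rotate_at [simp]: "length (rotate_at i xs) = length xs"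
  by (simp add: rotate_at_def)

lemma set_rotate_at [simp]: "set (rotate_at i xs) = set xs"
  by (metis append_take_drop_id rotate_at_def set_append set_rev)

lemma hd_rotate_at: "0 < i \<Longrightarrow> i < length xs \<Longrightarrow> hd (rotate_at i xs) = xs ! (i - 1)"
  by (cases "xs = []") (simp_all add: rotate_at_def hd_append hd_rev last_conv_nth)

text \<open>This allows the neighbourhoods of different rotated ends to be confined to one fixed
  initial segment.\<close>

lemma set_take_rotate_at:
  assumes "i \<le> j"
  shows "set (take j (rotate_at i xs)) = set (take j xs)"
proof (cases "i \<le> length xs")
  case True
  have "take j xs = take i xs @ take (j - i) (drop i xs)"
    using assms by (metis le_add_diff_inverse take_add)
  moreover have "take j (rotate_at i xs) = rev (take i xs) @ take (j - i) (drop i xs)"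
    using assms True by (simp add: rotate_at_def)
  ultimately show ?thesis by simp
next
  case False
  then show ?thesis using assms by (simp add: rotate_at_def)
qed

text \<open>The edge from \<open>hd xs\<close> to \<open>xs ! i\<close> replaces the one between
  \<open>xs ! (i - 1)\<close> and \<open>xs ! i\<close>; the vertex set and the length stay the
  same.\<close>

lemma longest_path_rotate_at:
  assumes "longest_path U xs" "0 < i" "i < length xs" "E (hd xs) (xs ! i)"
  shows "longest_path U (rotate_at i xs)"
proof -
  have xs: "distinct xs" "successively E xs" "set xs \<subseteq> U" "xs \<noteq> []"
    using assms(1) by (auto simp: longest_path_def path_def)
  have "successively E (rev (take i xs))"
    unfolding successively_rev_sym using xs(2) by (rule successively_take_drop)
  moreover have "last (rev (take i xs)) = hd xs"
    using assms(2) xs(4) by (simp add: last_rev)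
  ultimately have "successively E (rotate_at i xs)"
    using xs assms(2-4) unfolding rotate_at_def successively_append_iff
    by (simp add: successively_take_drop hd_drop_conv_nth del: successively_rev)
  moreover have "distinct (rotate_at i xs)"
    using xs by (auto simp: rotate_at_def dest: set_take_disj_set_drop_if_distinct[of xs i i])
  ultimately have "path U (rotate_at i xs)"
    using xs unfolding path_def by (metis length_0_conv length_rotate_at set_rotate_at)
  then show ?thesis using assms(1) by (simp add: longest_path_def)
qed

section \<open>Longest paths whose first vertex has only near neighbours\<close>

lemma removable_set_of_short_ends:
  assumes "finite U" "2 \<le> card U" "6 \<le> k" "2 \<le> q"
    and short: "\<And>xs. longest_path U xs \<Longrightarrow> nbrs U (hd xs) \<subseteq> set (take (2 * k) xs)"
  shows "\<exists>S\<subseteq>U. S \<noteq> {} \<and> card S < card U \<and> card S \<le> 2 * k - 1 \<and>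
    real (card {Q \<in> cliques U (Suc q). Q \<inter> S \<noteq> {}}) \<le> real (card S) * clique_density k (Suc q)"
proof -
  obtain xs0 where "longest_path U xs0" using longest_path_exists assms(1,2) by fastforce
  moreover have "\<forall>ys. longest_path U ys \<longrightarrow> card (nbrs U (hd ys)) < Suc (card U)"
    using \<open>finite U\<close> by (simp add: card_mono less_Suc_eq_le nbrs_subset)
  \<comment> \<open>The first vertex has maximum degree among all ends of longest paths, so no
    rotation leads to an end of larger degree.\<close>
  ultimately obtain xs where xs: "longest_path U xs"
    and max: "\<And>ys. longest_path U ys \<Longrightarrow> card (nbrs U (hd ys)) \<le> card (nbrs U (hd xs))"
    using ex_has_greatest_nat[of "longest_path U" xs0 "\<lambda>ys. card (nbrs U (hd ys))" "Suc (card U)"] by blast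
  define d where "d = card (nbrs U (hd xs))"
  define W where "W = set (take (2 * k) xs)"
  have dist: "distinct xs" and ne: "xs \<noteq> []" and sub: "set xs \<subseteq> U"
    using xs by (auto simp: longest_path_def path_def)
  have hdU: "hd xs \<in> U" using ne sub by (meson hd_in_set subsetD)
  have WU: "W \<subseteq> U" using sub set_take_subset unfolding W_def by fast
  have cardW: "card W \<le> 2 * k" unfolding W_def by (metis card_length le_trans length_take min.cobounded2)
  have finW: "finite W" by (simp add: W_def)
  show ?thesis
  proof (cases "d \<le> k")
    case True
    have "real (card {Q \<in> cliques U (Suc q). Q \<inter> {hd xs} \<noteq> {}}) \<le> real (d choose q)"
      using card_cliques_through_le[OF \<open>finite U\<close>, of q "hd xs"] card_cliques_le[of "nbrs U (hd xs)" q]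
        \<open>finite U\<close> by (simp add: d_def)
    also have "\<dots> \<le> real (k choose q)"
      using True by (simp add: binomial_right_mono)
    also have "\<dots> \<le> clique_density k (Suc q)"
      using choose_plus_choose_le_clique_density[OF \<open>6 \<le> k\<close> \<open>2 \<le> q\<close>] by linarith
    finally show ?thesis
      using hdU assms by (intro exI[of _ "{hd xs}"]) auto
  next
    case False
    define I where "I = {i. 0 < i \<and> i < length xs \<and> E (hd xs) (xs ! i)}"
    \<comment> \<open>The predecessors of the neighbours of \<open>hd xs\<close> are the first
      vertices of the paths that one rotation produces.\<close>
    define S where "S = (\<lambda>i. xs ! (i - 1)) ` I"
    have finI: "finite I" by (simp add: I_def)
    have I: "nbrs U (hd xs) = (\<lambda>i. xs ! i) ` I"
    proof
      show "nbrs U (hd xs) \<subseteq> (\<lambda>i. xs ! i) ` I"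
      proof
        fix w assume w: "w \<in> nbrs U (hd xs)"
        then obtain i where i: "i < length xs" "w = xs ! i"
          using nbrs_longest_path[OF xs] by (metis in_set_conv_nth subsetD)
        have "i \<noteq> 0" using w i not_in_nbrs by (metis hd_conv_nth ne)
        then show "w \<in> (\<lambda>i. xs ! i) ` I" using w i by (auto simp: I_def nbrs_def)
      qed
      show "(\<lambda>i. xs ! i) ` I \<subseteq> nbrs U (hd xs)"
        using sub by (auto simp: I_def nbrs_def)
    qed
    have "inj_on (\<lambda>i. xs ! i) I"
      using dist by (auto simp: inj_on_def I_def nth_eq_iff_index_eq)
    then have cardI: "card I = d" by (simp add: d_def I card_image)
    have "inj_on (\<lambda>i. xs ! (i - 1)) I"
    proof (rule inj_onI)
      fix i j assume "i \<in> I" "j \<in> I" "xs ! (i - 1) = xs ! (j - 1)"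
      then have "i - 1 = j - 1" "0 < i" "0 < j" using dist by (auto simp: I_def nth_eq_iff_index_eq)
      then show "i = j" by simp
    qed
    then have cardS: "card S = d" by (simp add: S_def card_image cardI)
    have I_le: "i < 2 * k" if "i \<in> I" for i
    proof -
      have "xs ! i \<in> set (take (2 * k) xs)" using I that short[OF xs] by blast
      then obtain j where "j < length xs" "j < 2 * k" "xs ! i = xs ! j"
        by (auto simp: in_set_conv_nth)
      then show ?thesis using that dist by (simp add: I_def nth_eq_iff_index_eq)
    qed
    have SW: "S \<subseteq> W"
    proof
      fix x assume "x \<in> S"
      then obtain i where "i \<in> I" "x = xs ! (i - 1)" by (auto simp: S_def)
      then show "x \<in> W" using I_le[of i] by (auto simp: W_def I_def in_set_conv_nth intro!: exI[of _ "i - 1"])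
    qed
    have nbrsS: "nbrs U x \<subseteq> W" "card (nbrs U x) \<le> d" if x: "x \<in> S" for x
    proof -
      from x obtain i where i: "i \<in> I" "x = xs ! (i - 1)" by (auto simp: S_def)
      then have l: "longest_path U (rotate_at i xs)" and h: "hd (rotate_at i xs) = x"
        using xs by (auto simp: I_def hd_rotate_at intro: longest_path_rotate_at)
      show "nbrs U x \<subseteq> W"
        using short[OF l] I_le[OF i(1)] by (simp add: h W_def set_take_rotate_at)
      show "card (nbrs U x) \<le> d" using max[OF l] by (simp add: h d_def)
    qed
    \<comment> \<open>Besides the \<open>d\<close> neighbours, \<open>W\<close> contains
      \<open>hd xs\<close> itself. The resulting \<open>d < card W\<close> gives both
      \<open>d \<le> 2 * k - 1\<close> and \<open>card S < card U\<close>.\<close>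
    have "hd xs \<in> W" using ne \<open>6 \<le> k\<close> by (auto simp: W_def hd_conv_nth in_set_conv_nth)
    then have "insert (hd xs) (nbrs U (hd xs)) \<subseteq> W" using short[OF xs] by (simp add: W_def)
    then have "card (insert (hd xs) (nbrs U (hd xs))) \<le> card W" using finW by (rule card_mono[rotated])
    then have d: "Suc d \<le> card W"
      using \<open>finite U\<close> not_in_nbrs by (simp add: d_def)
    then have d2: "d \<le> 2 * k - 1" using cardW by simp
    \<comment> \<open>All neighbours lie in \<open>W\<close>, which has at most \<open>2 * k\<close>
      vertices, and \<open>S\<close> takes up \<open>d\<close> of them.\<close>
    have "card (nbrs U x - S) \<le> 2 * k - d" if "x \<in> S" for x
    proof -
      have "card (nbrs U x - S) \<le> card (W - S)" using nbrsS(1)[OF that] finW by (intro card_mono) auto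
      also have "\<dots> = card W - d" using SW finW by (metis cardS card_Diff_subset finite_subset)
      finally show ?thesis using cardW by linarith
    qed
    then have "real (card {Q \<in> cliques U (Suc q). Q \<inter> S \<noteq> {}}) \<le> real (card S) * clique_density k (Suc q)"
      using assms SW WU d2 nbrsS by (intro card_cliques_meeting_le[of _ _ _ _ d]) auto
    moreover have "card W \<le> card U" using WU \<open>finite U\<close> by (simp add: card_mono)
    moreover have "S \<noteq> {}" using cardS False by auto
    ultimately show ?thesis using SW WU cardS d d2 by (intro exI[of _ S]) auto
  qed
qed

subsection \<open>Chords of a long even cycle\<close>

text \<open>In the application \<open>c\<close> is the initial segment of a longest path up to the
  farthest neighbour of its first vertex. Both \<open>c ! 0\<close> and the last but one entry are
  then ends of longest paths.\<close>

definition long_even_cycle :: "nat \<Rightarrow> 'a set \<Rightarrow> 'a list \<Rightarrow> bool" where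
  "long_even_cycle k U c \<longleftrightarrow> cycle c \<and> set c \<subseteq> U \<and> even (length c) \<and> 2 * k + 2 \<le> length c
    \<and> odd_cycles_le (2 * k) U"

text \<open>Positions are halved, so that conditions on chords become conditions on gaps between
  integers.\<close>

definition odd_nbrs :: "'a list \<Rightarrow> nat set" where
  "odd_nbrs c = {a. 2 * a + 1 < length c \<and> E (c ! 0) (c ! (2 * a + 1))}"

definition even_nbrs :: "'a list \<Rightarrow> nat set" where
  "even_nbrs c = {a. 2 * a < length c \<and> E (c ! 0) (c ! (2 * a))}"

text \<open>Everything but the last vertex is reversed: the last but one vertex changes places with
  the first, and the last vertex stays as their common neighbour.\<close>

definition reflect :: "'a list \<Rightarrow> 'a list" where
  "reflect c = rotate_at (length c - 1) c"

lemma finite_odd_nbrs: "finite (odd_nbrs c)"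
  by (rule finite_subset[of _ "{..<length c}"]) (auto simp: odd_nbrs_def)

lemma finite_even_nbrs: "finite (even_nbrs c)"
  by (rule finite_subset[of _ "{..<length c}"]) (auto simp: even_nbrs_def)

lemma last_take_Suc: "i < length xs \<Longrightarrow> last (take (Suc i) xs) = xs ! i"
  by (simp add: take_Suc_conv_app_nth)

lemma cycle_nth_Suc: "cycle c \<Longrightarrow> Suc i < length c \<Longrightarrow> E (c ! i) (c ! Suc i)"
  by (simp add: cycle_def successively_nth)

lemma cycle_cut_chord:
  assumes "cycle c" "i < j" "j < length c" "E (c ! i) (c ! j)"
  shows "cycle (take (i + 1) c @ drop j c)"
proof -
  have "distinct (take (i + 1) c @ drop j c)"
    using assms set_take_disj_set_drop_if_distinct[of c "i + 1" j] by (simp add: cycle_def)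
  moreover have "last (take (i + 1) c) = c ! i" "hd (drop j c) = c ! j"
    using assms by (simp_all add: last_take_Suc hd_drop_conv_nth)
  then have "successively E (take (i + 1) c @ drop j c)"
    using assms unfolding successively_append_iff by (simp add: cycle_def successively_take_drop)
  moreover have "hd (take (i + 1) c @ drop j c) = hd c" "last (take (i + 1) c @ drop j c) = last c"
    using assms by (auto simp: hd_append)
  ultimately show ?thesis using assms(1) unfolding cycle_def by metis
qed

lemma cycle_chord_segment:
  assumes "cycle c" "i < j" "j < length c" "E (c ! i) (c ! j)"
  shows "cycle (drop i (take (j + 1) c))"
proof -
  have "hd (drop i (take (j + 1) c)) = c ! i" "last (drop i (take (j + 1) c)) = c ! j"
    using assms by (simp_all add: hd_drop_conv_nth last_take_Suc)
  then show ?thesis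
    using assms sym unfolding cycle_def by (simp add: successively_take_drop)
qed

text \<open>The cycle runs from \<open>0\<close> to \<open>j\<close>, crosses to
  \<open>l - 1\<close>, runs backwards to \<open>i\<close> and returns to \<open>0\<close>. It
  misses the positions strictly between \<open>j\<close> and \<open>i\<close> and the last
  vertex.\<close>

lemma cycle_crossing_chords:
  assumes "cycle c" "length c = l + 1" "j < i" "i < l"
    and "E (c ! 0) (c ! i)" "E (c ! (l - 1)) (c ! j)"
  shows "cycle (take (j + 1) c @ rev (drop i (take l c)))"
proof -
  have "set (drop i (take l c)) \<subseteq> set (drop i c)"
    by (metis drop_take set_take_subset)
  then have "distinct (take (j + 1) c @ rev (drop i (take l c)))"
    using assms set_take_disj_set_drop_if_distinct[of c "j + 1" i]
    by (auto simp: cycle_def)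
  moreover have last: "last (take (j + 1) c) = c ! j"
    using assms by (simp add: last_take_Suc)
  moreover have hd: "hd (rev (drop i (take l c))) = c ! (l - 1)"
    using assms by (simp add: hd_rev last_conv_nth)
  moreover have "successively E (rev (drop i (take l c)))"
    using assms unfolding successively_rev_sym by (simp add: cycle_def successively_take_drop)
  then have "successively E (take (j + 1) c @ rev (drop i (take l c)))"
    using assms sym unfolding successively_append_iff last hd
    by (simp add: cycle_def successively_take_drop del: successively_rev)
  moreover have "last (take (j + 1) c @ rev (drop i (take l c))) = c ! i"
    using assms by (simp add: last_rev hd_drop_conv_nth)
  moreover have "hd (take (j + 1) c @ rev (drop i (take l c))) = c ! 0"
    using assms by (cases c) auto
  ultimately show ?thesis using assms(5) sym unfolding cycle_def by metis
qed

text \<open>A chord of even span splits the even cycle into two odd cycles. The one through both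
  ends of the list has \<open>i + 1 + (length c - j)\<close> vertices; it has to be short, so the
  span is large.\<close>

lemma even_chord_span:
  assumes "long_even_cycle k U c" "i < j" "j < length c" "even (j - i)" "E (c ! i) (c ! j)"
  shows "i + length c + 2 \<le> j + 2 * k"
proof -
  have "cycle (take (i + 1) c @ drop j c)"
    using assms by (intro cycle_cut_chord) (auto simp: long_even_cycle_def)
  moreover have "set (take (i + 1) c @ drop j c) \<subseteq> U"
    using assms by (auto simp: long_even_cycle_def dest: in_set_takeD in_set_dropD)
  moreover have len: "length (take (i + 1) c @ drop j c) = i + 1 + (length c - j)"
    using assms by simp
  moreover have "odd (i + 1 + (length c - j))"
    using assms by (auto simp: long_even_cycle_def)
  ultimately have "i + 1 + (length c - j) \<le> 2 * k" "odd (i + 1 + (length c - j))"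
    using assms(1) odd_cycles_leD unfolding long_even_cycle_def by metis+
  \<comment> \<open>An odd number that is at most \<open>2 * k\<close> is at most
    \<open>2 * k - 1\<close>, which improves the bound by one.\<close>
  then have "i + 2 + (length c - j) \<le> 2 * k" by presburger
  then show ?thesis using assms by linarith
qed

lemma length_reflect [simp]: "length (reflect c) = length c"
  by (simp add: reflect_def)

lemma set_reflect [simp]: "set (reflect c) = set c"
  by (simp add: reflect_def)

lemma nth_reflect:
  assumes "i + 2 \<le> length c"
  shows "reflect c ! i = c ! (length c - 2 - i)"
proof -
  have "i < length c - 1" using assms by simp
  then have "reflect c ! i = take (length c - 1) c ! (length c - 1 - Suc i)"
    by (simp add: reflect_def rotate_at_def nth_append rev_nth)
  also have "\<dots> = c ! (length c - 1 - Suc i)" using assms by simp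
  also have "length c - 1 - Suc i = length c - 2 - i" by simp
  finally show ?thesis .
qed

lemma reflect_nth_last:
  assumes "c \<noteq> []"
  shows "last (reflect c) = last c"
proof -
  have "drop (length c - 1) c \<noteq> []" using assms by (cases c) auto
  then show ?thesis using assms by (simp add: reflect_def rotate_at_def)
qed

lemma cycle_reflect:
  assumes "cycle c" "2 \<le> length c"
  shows "cycle (reflect c)"
proof -
  have ne: "c \<noteq> []" using assms(2) by auto
  have "distinct (reflect c)"
    using assms set_take_disj_set_drop_if_distinct[of c "length c - 1" "length c - 1"]
    by (auto simp: reflect_def rotate_at_def cycle_def)
  \<comment> \<open>The last vertex is adjacent to both ends of the reversed segment, as its
    neighbour on the cycle in either direction.\<close>
  moreover have E: "E (c ! 0) (last c)" "E (last c) (c ! (length c - 2))"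
  proof -
    show "E (c ! 0) (last c)" using assms(1) ne sym by (auto simp: cycle_def hd_conv_nth)
    have "E (c ! (length c - 2)) (c ! Suc (length c - 2))"
      using assms by (intro cycle_nth_Suc) auto
    moreover have "Suc (length c - 2) = length c - 1" using assms(2) by simp
    ultimately show "E (last c) (c ! (length c - 2))" using sym ne by (simp add: last_conv_nth)
  qed
  have last: "last (rev (take (length c - 1) c)) = c ! 0"
    using assms(2) ne by (simp add: last_rev hd_take hd_conv_nth)
  have drop: "hd (drop (length c - 1) c) = last c"
    using ne by (simp add: hd_drop_conv_nth last_conv_nth)
  have "successively E (rev (take (length c - 1) c))"
    using assms unfolding successively_rev_sym by (simp add: cycle_def successively_take_drop)
  then have "successively E (reflect c)"
    using assms(1) E(1) unfolding reflect_def rotate_at_def successively_append_iff last drop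
    by (simp add: cycle_def successively_take_drop del: successively_rev)
  moreover have "hd (reflect c) = c ! (length c - 2)"
    using nth_reflect[of 0 c] assms(2) by (metis add_0 diff_zero hd_conv_nth length_0_conv length_reflect ne)
  ultimately show ?thesis
    using E(2) reflect_nth_last[OF ne] by (simp add: cycle_def)
qed

lemma long_even_cycle_reflect: "long_even_cycle k U c \<Longrightarrow> long_even_cycle k U (reflect c)"
  by (simp add: long_even_cycle_def cycle_reflect)

lemma reflect_reflect:
  assumes "c \<noteq> []"
  shows "reflect (reflect c) = c"
proof (rule nth_equalityI)
  fix i assume i: "i < length (reflect (reflect c))"
  show "reflect (reflect c) ! i = c ! i"
  proof (cases "i + 2 \<le> length c")
    case True
    have "reflect (reflect c) ! i = reflect c ! (length c - 2 - i)"
      using True by (simp add: nth_reflect)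
    also have "\<dots> = c ! (length c - 2 - (length c - 2 - i))"
      using True by (intro nth_reflect) simp
    also have "length c - 2 - (length c - 2 - i) = i" using True by simp
    finally show ?thesis .
  next
    case False
    then have "i = length c - 1" using i by simp
    then show ?thesis
      using reflect_nth_last[OF assms] reflect_nth_last[of "reflect c"] assms
      by (metis last_conv_nth length_0_conv length_reflect)
  qed
qed simp

lemma nbrs_eq_odd_even:
  assumes "nbrs U (c ! 0) \<subseteq> set c"
  shows "nbrs U (c ! 0) \<subseteq> (\<lambda>a. c ! (2 * a + 1)) ` odd_nbrs c \<union> (\<lambda>a. c ! (2 * a)) ` even_nbrs c"
proof
  fix w assume w: "w \<in> nbrs U (c ! 0)"
  then obtain i where i: "i < length c" "w = c ! i" using assms by (metis in_set_conv_nth subsetD)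
  have "E (c ! 0) (c ! i)" using w i by (simp add: nbrs_def)
  then show "w \<in> (\<lambda>a. c ! (2 * a + 1)) ` odd_nbrs c \<union> (\<lambda>a. c ! (2 * a)) ` even_nbrs c"
    using i by (cases "even i") (auto simp: odd_nbrs_def even_nbrs_def elim!: evenE oddE)
qed

lemma card_nbrs_le_odd_even:
  assumes "nbrs U (c ! 0) \<subseteq> set c"
  shows "card (nbrs U (c ! 0)) \<le> card (odd_nbrs c) + card (even_nbrs c)"
proof -
  have "card (nbrs U (c ! 0)) \<le> card ((\<lambda>a. c ! (2 * a + 1)) ` odd_nbrs c \<union> (\<lambda>a. c ! (2 * a)) ` even_nbrs c)"
    using nbrs_eq_odd_even[OF assms] finite_odd_nbrs finite_even_nbrs by (intro card_mono) auto
  also have "\<dots> \<le> card ((\<lambda>a. c ! (2 * a + 1)) ` odd_nbrs c) + card ((\<lambda>a. c ! (2 * a)) ` even_nbrs c)"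
    by (rule card_Un_le)
  also have "\<dots> \<le> card (odd_nbrs c) + card (even_nbrs c)"
    using finite_odd_nbrs finite_even_nbrs by (intro add_mono card_image_le)
  finally show ?thesis .
qed

text \<open>All neighbours sit at odd positions, so two adjacent ones form a chord of even span.
  Halving the positions turns the cliques into sets with gaps of at least \<open>h\<close>, counted
  by \<open>card_sets_with_gaps_le\<close>.\<close>

lemma card_cliques_no_even_nbrs:
  assumes c: "long_even_cycle k U c" and nbrs: "nbrs U (c ! 0) \<subseteq> set c"
    and even: "even_nbrs c = {}" and "2 \<le> q"
  shows "card (cliques (nbrs U (c ! 0)) q) \<le> k choose q"
proof -
  define m where "m = length c div 2"
  have len: "length c = 2 * m" and km: "k + 1 \<le> m" and dist: "distinct c"
    using c by (auto simp: long_even_cycle_def m_def cycle_def)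
  \<comment> \<open>The gap that \<open>even_chord_span\<close> gives after halving. The halved
    positions are those below \<open>m = k + h - 1\<close>.\<close>
  define h where "h = m + 1 - k"
  define \<phi> where "\<phi> Q = {a. 2 * a + 1 < length c \<and> c ! (2 * a + 1) \<in> Q}" for Q
  have nbrs_odd: "nbrs U (c ! 0) \<subseteq> (\<lambda>a. c ! (2 * a + 1)) ` odd_nbrs c"
    using nbrs_eq_odd_even[OF nbrs] even by simp
  have image: "(\<lambda>a. c ! (2 * a + 1)) ` \<phi> Q = Q" if "Q \<in> cliques (nbrs U (c ! 0)) q" for Q
    using that nbrs_odd by (force simp: cliques_def \<phi>_def odd_nbrs_def)
  have inj: "inj_on (\<lambda>a. c ! (2 * a + 1)) (\<phi> Q)" for Q
    using dist by (auto simp: inj_on_def \<phi>_def nth_eq_iff_index_eq)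
  define G where "G = {A. A \<subseteq> {..<k + h - 1} \<and> card A = q \<and> (\<forall>a\<in>A. \<forall>b\<in>A. a < b \<longrightarrow> a + h \<le> b)}"
  have "card (cliques (nbrs U (c ! 0)) q) \<le> card G"
  proof (rule card_inj_on_le[of \<phi>])
    show "inj_on \<phi> (cliques (nbrs U (c ! 0)) q)"
      by (rule inj_onI) (metis image)
    show "\<phi> ` cliques (nbrs U (c ! 0)) q \<subseteq> G"
    proof (rule image_subsetI)
      fix Q assume Q: "Q \<in> cliques (nbrs U (c ! 0)) q"
      have "card (\<phi> Q) = card Q"
        using image[OF Q] card_image[OF inj, of Q] by simp
      then have "card (\<phi> Q) = q" using Q by (simp add: cliques_def)
      moreover have "\<phi> Q \<subseteq> {..<k + h - 1}" using km by (auto simp: \<phi>_def len h_def)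
      moreover have "a + h \<le> b" if "a \<in> \<phi> Q" "b \<in> \<phi> Q" "a < b" for a b
      proof -
        have "c ! (2 * a + 1) \<noteq> c ! (2 * b + 1)"
          using that dist by (auto simp: \<phi>_def nth_eq_iff_index_eq)
        then have "E (c ! (2 * a + 1)) (c ! (2 * b + 1))"
          using that Q by (simp add: \<phi>_def cliques_def)
        then have "2 * a + 1 + length c + 2 \<le> 2 * b + 1 + 2 * k"
          using that by (intro even_chord_span[OF c]) (auto simp: \<phi>_def)
        then show ?thesis using km by (simp add: len h_def)
      qed
      ultimately show "\<phi> Q \<in> G" by (auto simp: G_def)
    qed
    show "finite G" by (simp add: G_def)
  qed
  also have "\<dots> \<le> k choose q"
    unfolding G_def using km \<open>2 \<le> q\<close> by (intro card_sets_with_gaps_le) (auto simp: h_def)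
  finally show ?thesis .
qed

text \<open>If \<open>c ! 0\<close> is adjacent to position \<open>2 * a + 1\<close> and the last
  but one vertex to position \<open>2 * b\<close> with \<open>b \<le> a\<close>, the crossing chords
  give an odd cycle; its shortness forces \<open>b + h - 1 \<le> a\<close>. Even chords keep all
  \<open>b\<close> below \<open>k - 1\<close>, and \<open>card_add_card_le_if_avoiding\<close> does
  the counting.\<close>

lemma card_odd_even_nbrs_le:
  assumes c: "long_even_cycle k U c" and ne: "even_nbrs (reflect c) \<noteq> {}"
  shows "card (odd_nbrs c) + card (even_nbrs (reflect c)) \<le> k + 1"
proof -
  define m where "m = length c div 2"
  have len: "length c = 2 * m" and km: "k + 1 \<le> m" and cyc: "cycle c"
    using c by (auto simp: long_even_cycle_def m_def)
  define h where "h = m + 1 - k"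
  \<comment> \<open>Position \<open>2 * a\<close> of the reflected cycle is position
    \<open>2 * (m - 1 - a)\<close> of \<open>c\<close>.\<close>
  define B where "B = (\<lambda>a. m - 1 - a) ` even_nbrs (reflect c)"
  have r0: "reflect c ! 0 = c ! (2 * m - 2)" using km by (simp add: nth_reflect len)
  have B: "E (c ! (2 * m - 2)) (c ! (2 * b))" "b < k - 1" if b: "b \<in> B" for b
  proof -
    obtain a where a: "a \<in> even_nbrs (reflect c)" "b = m - 1 - a" using b unfolding B_def by blast
    then have "2 * a < length c" and E: "E (reflect c ! 0) (reflect c ! (2 * a))"
      by (auto simp: even_nbrs_def)
    then have "a < m" by (simp add: len)
    moreover from this have "2 * a + 2 \<le> length c" by (simp add: len)
    ultimately have "reflect c ! (2 * a) = c ! (2 * b)"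
      by (simp add: nth_reflect len a diff_mult_distrib2)
    then show "E (c ! (2 * m - 2)) (c ! (2 * b))" using E r0 by simp
    have "a \<noteq> 0" using E irrefl by (metis mult_0_right)
    then have "0 + length (reflect c) + 2 \<le> 2 * a + 2 * k"
      using E \<open>2 * a < length c\<close>
      by (intro even_chord_span[OF long_even_cycle_reflect[OF c]]) auto
    then show "b < k - 1" using a \<open>a < m\<close> km by (simp add: len)
  qed
  have "inj_on (\<lambda>a. m - 1 - a) (even_nbrs (reflect c))"
    by (auto simp: inj_on_def even_nbrs_def len)
  then have cardB: "card B = card (even_nbrs (reflect c))"
    by (simp add: B_def card_image)
  have "card (odd_nbrs c) + card B \<le> k + 1"
  proof (rule card_add_card_le_if_avoiding[of _ k h])
    show "odd_nbrs c \<subseteq> {..<k + h - 1}" using km by (auto simp: odd_nbrs_def len h_def)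
    show "B \<subseteq> {..<k - 1}" using B(2) by auto
    show "B \<noteq> {}" using ne by (simp add: B_def)
    show "2 \<le> h" using km by (simp add: h_def)
    fix a b assume a: "a \<in> odd_nbrs c" and b: "b \<in> B" and "b \<le> a"
    have "a < m" using a by (simp add: odd_nbrs_def len)
    show "b + h - 1 \<le> a"
    proof (cases "a = m - 1")
      \<comment> \<open>Position \<open>2 * m - 1\<close> is the last vertex, so its edge to
        \<open>c ! 0\<close> belongs to the cycle and crosses nothing; the bound on \<open>b\<close>
        suffices.\<close>
      case True
      then show ?thesis using B(2)[OF b] km by (simp add: h_def)
    next
      case False
      then have "2 * a + 1 < 2 * m - 1" using \<open>a < m\<close> by linarith
      moreover have "2 * m - 1 - 1 = 2 * m - 2" by simp
      then have E': "E (c ! (2 * m - 1 - 1)) (c ! (2 * b))" using B(1)[OF b] by metis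
      ultimately have cy: "cycle (take (2 * b + 1) c @ rev (drop (2 * a + 1) (take (2 * m - 1) c)))"
        using cyc a E' \<open>b \<le> a\<close> km
        by (intro cycle_crossing_chords) (auto simp: len odd_nbrs_def)
      have sub: "set (take (2 * b + 1) c @ rev (drop (2 * a + 1) (take (2 * m - 1) c))) \<subseteq> U"
        using c by (auto simp: long_even_cycle_def dest: in_set_takeD in_set_dropD)
      have l: "length (take (2 * b + 1) c @ rev (drop (2 * a + 1) (take (2 * m - 1) c)))
        = 2 * b + 1 + (2 * m - 1 - (2 * a + 1))"
        using \<open>a < m\<close> \<open>b \<le> a\<close> by (simp add: len)
      have "odd (2 * b + 1 + (2 * m - 1 - (2 * a + 1)))"
        using \<open>a < m\<close> by simp
      then have "2 * b + 1 + (2 * m - 1 - (2 * a + 1)) \<le> 2 * k"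
        using c odd_cycles_leD[OF _ sub cy] unfolding l long_even_cycle_def by blast
      then show ?thesis using \<open>a < m\<close> km \<open>2 * a + 1 < 2 * m - 1\<close> unfolding h_def by linarith
    qed
  qed
  then show ?thesis by (simp add: cardB)
qed

text \<open>The neighbours \<open>c ! 1\<close> and \<open>last c\<close> of \<open>c ! 0\<close>
  are not adjacent: otherwise deleting \<open>c ! 0\<close> would leave an odd cycle of at least
  \<open>2 * k + 1\<close> vertices.\<close>

lemma card_cliques_small_degree:
  assumes c: "long_even_cycle k U c" and deg: "card (nbrs U (c ! 0)) \<le> k + 1"
    and "finite U" "2 \<le> q" "2 \<le> k"
  shows "card (cliques (nbrs U (c ! 0)) q) \<le> (k choose q) + ((k - 1) choose (q - 1))"
proof (rule card_cliques_nonadjacent_le)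
  have cyc: "cycle c" "set c \<subseteq> U" "2 * k + 2 \<le> length c" "even (length c)" "c \<noteq> []" "distinct c"
    "odd_cycles_le (2 * k) U"
    using c by (auto simp: long_even_cycle_def cycle_def)
  have "E (c ! 0) (c ! Suc 0)"
    using cyc by (intro cycle_nth_Suc) auto
  then show "c ! 1 \<in> nbrs U (c ! 0)" using cyc by (auto simp: nbrs_def)
  have "E (c ! 0) (last c)" using cyc sym by (auto simp: cycle_def hd_conv_nth)
  then show "last c \<in> nbrs U (c ! 0)" using cyc by (auto simp: nbrs_def)
  show "c ! 1 \<noteq> last c" using cyc \<open>2 \<le> k\<close> by (simp add: last_conv_nth nth_eq_iff_index_eq)
  show "\<not> E (c ! 1) (last c)"
  proof
    assume E: "E (c ! 1) (last c)"
    have "cycle (drop 1 (take (length c - 1 + 1) c))"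
      using cyc E \<open>2 \<le> k\<close> by (intro cycle_chord_segment) (auto simp: last_conv_nth)
    then have "cycle (drop 1 c)" using cyc by simp
    moreover have "set (drop 1 c) \<subseteq> U" using cyc by (auto dest: in_set_dropD)
    ultimately have "length (drop 1 c) \<le> 2 * k"
      using cyc by (intro odd_cycles_leD[of _ U]) (auto simp del: drop_Suc)
    then show False using cyc by simp
  qed
qed (use assms in auto)

lemma card_cliques_long_even_cycle:
  assumes c: "long_even_cycle k U c" and "finite U" "2 \<le> q" "6 \<le> k"
    and nbrs: "nbrs U (c ! 0) \<subseteq> set c" "nbrs U (reflect c ! 0) \<subseteq> set c"
  shows "\<exists>v\<in>set c. real (card (cliques (nbrs U v) q)) \<le> clique_density k (Suc q)"
proof -
  have "c \<noteq> []" using c by (auto simp: long_even_cycle_def)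
  then have in_c: "c ! 0 \<in> set c" "reflect c ! 0 \<in> set c"
    using nth_mem[of 0 c] nth_mem[of 0 "reflect c"] by simp_all
  have rr: "reflect (reflect c) = c" using \<open>c \<noteq> []\<close> by (rule reflect_reflect)
  have r: "long_even_cycle k U (reflect c)" using c by (rule long_even_cycle_reflect)
  have "\<exists>v\<in>set c. card (cliques (nbrs U v) q) \<le> (k choose q) + ((k - 1) choose (q - 1))"
  proof (cases "even_nbrs c = {} \<or> even_nbrs (reflect c) = {}")
    case True
    then show ?thesis
      using card_cliques_no_even_nbrs[OF c nbrs(1) _ \<open>2 \<le> q\<close>] card_cliques_no_even_nbrs[OF r _ _ \<open>2 \<le> q\<close>] nbrs(2)
        in_c by (metis set_reflect trans_le_add1)
  next
    case False
    \<comment> \<open>The inequalities for \<open>c\<close> and for its reflection are added; each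
      bounds the odd positions of one end together with the even positions of the other.\<close>
    have "card (nbrs U (c ! 0)) + card (nbrs U (reflect c ! 0)) \<le> 2 * k + 2"
      using False card_odd_even_nbrs_le[OF c] card_odd_even_nbrs_le[OF r] nbrs
        card_nbrs_le_odd_even[of U c] card_nbrs_le_odd_even[of U "reflect c"] by (simp add: rr)
    then have "card (nbrs U (c ! 0)) \<le> k + 1 \<or> card (nbrs U (reflect c ! 0)) \<le> k + 1"
      by linarith
    then show ?thesis
      using card_cliques_small_degree[OF c _ \<open>finite U\<close> \<open>2 \<le> q\<close>]
        card_cliques_small_degree[OF r _ \<open>finite U\<close> \<open>2 \<le> q\<close>] in_c \<open>6 \<le> k\<close> by fastforce
  qed
  then show ?thesis
    using choose_plus_choose_le_clique_density[OF \<open>6 \<le> k\<close> \<open>2 \<le> q\<close>]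
    by (metis (mono_tags, lifting) le_trans of_nat_add of_nat_mono order_trans)
qed

section \<open>Longest paths whose first vertex has a far neighbour\<close>

lemma removable_vertex_of_long_end:
  assumes "finite U" "6 \<le> k" "2 \<le> q" and odd: "odd_cycles_le (2 * k) U"
    and "longest_path U xs0" "\<not> nbrs U (hd xs0) \<subseteq> set (take (2 * k) xs0)"
  shows "\<exists>v\<in>U. real (card (cliques (nbrs U v) q)) \<le> clique_density k (Suc q)"
proof -
  \<comment> \<open>A pair is a longest path with the position of a neighbour of its first vertex;
    this position is maximised over all longest paths at once.\<close>
  define P where "P z \<longleftrightarrow> longest_path U (fst z) \<and> snd z < length (fst z) \<and> E (hd (fst z)) (fst z ! snd z)"
    for z :: "'a list \<times> nat"
  obtain w where w: "w \<in> nbrs U (hd xs0)" "w \<notin> set (take (2 * k) xs0)" using assms(6) by blast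
  then obtain s0 where s0: "s0 < length xs0" "w = xs0 ! s0"
    using nbrs_longest_path[OF assms(5)] by (metis in_set_conv_nth subsetD)
  have s0k: "2 * k \<le> s0"
  proof (rule ccontr)
    assume "\<not> 2 * k \<le> s0"
    then have "w \<in> set (take (2 * k) xs0)" using s0 by (auto simp: in_set_conv_nth intro!: exI[of _ s0])
    then show False using w(2) by simp
  qed
  have "P (xs0, s0)" using assms(5) s0 w by (simp add: P_def nbrs_def)
  moreover have "\<forall>z. P z \<longrightarrow> snd z < Suc (card U)"
  proof (intro allI impI)
    fix z assume "P z"
    then have "snd z < length (fst z)" "length (fst z) \<le> card U"
      using length_path_le[OF \<open>finite U\<close>] by (auto simp: P_def longest_path_def)
    then show "snd z < Suc (card U)" by simp
  qed
  ultimately obtain z where "P z" and max: "\<And>z'. P z' \<Longrightarrow> snd z' \<le> snd z"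
    using ex_has_greatest_nat[of P "(xs0, s0)" snd "Suc (card U)"] by blast
  define xs s where "xs = fst z" and "s = snd z"
  have xs: "longest_path U xs" "s < length xs" "E (hd xs) (xs ! s)"
    using \<open>P z\<close> by (auto simp: P_def xs_def s_def)
  have maxs: "t \<le> s" if "longest_path U ys" "t < length ys" "E (hd ys) (ys ! t)" for ys t
    using max[of "(ys, t)"] that by (simp add: P_def s_def)
  have sk: "2 * k \<le> s" using max[OF \<open>P (xs0, s0)\<close>] s0k by (simp add: s_def)
  have xs': "distinct xs" "successively E xs" "set xs \<subseteq> U" "xs \<noteq> []"
    using xs(1) by (auto simp: longest_path_def path_def)
  define c where "c = take (s + 1) xs"
  have len: "length c = s + 1" using xs by (simp add: c_def)
  have hd: "c ! 0 = hd xs" using xs' by (simp add: c_def hd_conv_nth)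
  have cU: "set c \<subseteq> U" using xs' by (auto simp: c_def dest: in_set_takeD)
  have "last c = xs ! s" "hd c = hd xs" using xs by (simp_all add: c_def last_take_Suc)
  then have cyc: "cycle c"
    using xs xs' sym by (simp add: cycle_def c_def successively_take_drop)
  \<comment> \<open>A neighbour beyond position \<open>s\<close> would contradict the maximal
    choice, whichever longest path it occurs on.\<close>
  have end_nbrs: "nbrs U (hd ys) \<subseteq> set (take (s + 1) ys)" if ys: "longest_path U ys" for ys
  proof
    fix w assume w: "w \<in> nbrs U (hd ys)"
    then obtain t where t: "t < length ys" "w = ys ! t"
      using nbrs_longest_path[OF ys] by (metis in_set_conv_nth subsetD)
    then have "t \<le> s" using maxs[OF ys] w by (simp add: nbrs_def)
    then show "w \<in> set (take (s + 1) ys)" using t by (auto simp: in_set_conv_nth intro!: exI[of _ t])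
  qed
  have "even (length c)"
  proof (rule ccontr)
    assume "odd (length c)"
    then have "length c \<le> 2 * k" using odd_cycles_leD[OF odd cU cyc] by simp
    then show False using len sk by simp
  qed
  then have "2 * k + 2 \<le> length c" using len sk by presburger
  then have long: "long_even_cycle k U c"
    using \<open>even (length c)\<close> cyc cU odd by (simp add: long_even_cycle_def)
  have "nbrs U (c ! 0) \<subseteq> set c" using end_nbrs[OF xs(1)] unfolding hd c_def[symmetric] .
  moreover have "nbrs U (reflect c ! 0) \<subseteq> set c"
  proof -
    \<comment> \<open>Rotation at \<open>s\<close> makes the last but one vertex of \<open>c\<close>
      the first vertex of a longest path and permutes the first \<open>s + 1\<close>
      vertices.\<close>
    have l: "longest_path U (rotate_at s xs)"
      using xs sk \<open>6 \<le> k\<close> by (intro longest_path_rotate_at) auto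
    have "hd (rotate_at s xs) = reflect c ! 0"
      using xs sk \<open>6 \<le> k\<close> len by (subst hd_rotate_at) (auto simp: nth_reflect c_def)
    then show ?thesis
      using end_nbrs[OF l] by (simp add: set_take_rotate_at c_def)
  qed
  ultimately have "\<exists>v\<in>set c. real (card (cliques (nbrs U v) q)) \<le> clique_density k (Suc q)"
    using assms by (intro card_cliques_long_even_cycle[OF long]) auto
  then show ?thesis using cU by blast
qed

end

section \<open>Strictness below \<open>2 * k\<close> vertices\<close>

lemma clique_density_pos: "1 \<le> k \<Longrightarrow> r \<le> 2 * k \<Longrightarrow> 0 < clique_density k r"
  by (simp add: clique_density_def)

text \<open>With \<open>r = p + 2\<close>, the quotient of \<open>n choose r\<close> by
  \<open>n - 1\<close> is \<open>n * ((n - 2) choose p)\<close> up to a constant factor. It is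
  therefore smaller than at \<open>n = 2 * k\<close>, where it equals the density.\<close>

lemma choose_less_clique_density:
  assumes "2 \<le> n" "n < 2 * k" "3 \<le> r" "r \<le> 2 * k"
  shows "real (n choose r) < (real n - 1) * clique_density k r"
proof -
  obtain p where r: "r = Suc (Suc p)" "1 \<le> p" using \<open>3 \<le> r\<close> by (metis Suc_le_D Suc_le_mono numeral_3_eq_3 One_nat_def)
  have absorb: "Suc p * (Suc (Suc p) * (N choose r)) = N * ((N - 1) * ((N - 2) choose p))" for N
  proof -
    have "Suc (Suc p) * (N choose r) = N * ((N - 1) choose Suc p)"
      unfolding r by (rule binomial_absorption)
    moreover have "Suc p * ((N - 1) choose Suc p) = (N - 1) * ((N - 2) choose p)"
      using binomial_absorption[of p "N - 1"] by (simp add: numeral_2_eq_2)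
    ultimately show ?thesis by (metis mult.left_commute)
  qed
  have pos: "0 < (2 * k - 2) choose p" using assms r by simp
  have le: "(n - 2) choose p \<le> (2 * k - 2) choose p"
    using assms by (intro binomial_right_mono) simp
  have "Suc p * (Suc (Suc p) * ((2 * k - 1) * (n choose r)))
      = (2 * k - 1) * (Suc p * (Suc (Suc p) * (n choose r)))"
    by (simp only: mult.left_commute)
  also have "\<dots> = (2 * k - 1) * (n * ((n - 1) * ((n - 2) choose p)))"
    by (simp only: absorb)
  also have "\<dots> \<le> (2 * k - 1) * (n * ((n - 1) * ((2 * k - 2) choose p)))"
    using le by (intro mult_le_mono2)
  also have "\<dots> < (2 * k - 1) * (2 * k * ((n - 1) * ((2 * k - 2) choose p)))"
    using assms pos by (intro mult_strict_left_mono mult_strict_right_mono) auto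
  also have "\<dots> = (n - 1) * (2 * k * ((2 * k - 1) * ((2 * k - 2) choose p)))"
    by (simp only: mult.left_commute)
  also have "\<dots> = (n - 1) * (Suc p * (Suc (Suc p) * (2 * k choose r)))"
    by (simp only: absorb)
  also have "\<dots> = Suc p * (Suc (Suc p) * ((n - 1) * (2 * k choose r)))"
    by (simp only: mult.left_commute)
  finally have "(2 * k - 1) * (n choose r) < (n - 1) * (2 * k choose r)"
    by (simp only: mult_less_cancel1)
  then have "real ((2 * k - 1) * (n choose r)) < real ((n - 1) * (2 * k choose r))"
    by (rule of_nat_less_iff[THEN iffD2])
  moreover have "real (2 * k - 1) = 2 * real k - 1" "real (n - 1) = real n - 1"
    using assms by linarith+
  ultimately have "(2 * real k - 1) * real (n choose r) < (real n - 1) * real (2 * k choose r)"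
    by (simp only: of_nat_mult)
  moreover have "2 * real k - 1 > 0" using assms by simp
  ultimately show ?thesis
    by (simp add: clique_density_def pos_less_divide_eq mult.commute)
qed

context adjacency begin

subsection \<open>The upper bound\<close>

lemma removable_set_exists:
  assumes "finite U" "2 \<le> card U" "6 \<le> k" "2 \<le> q" "odd_cycles_le (2 * k) U"
  shows "\<exists>S\<subseteq>U. S \<noteq> {} \<and> card S < card U \<and> card S \<le> 2 * k - 1 \<and>
    real (card {Q \<in> cliques U (Suc q). Q \<inter> S \<noteq> {}}) \<le> real (card S) * clique_density k (Suc q)"
proof (cases "\<forall>xs. longest_path U xs \<longrightarrow> nbrs U (hd xs) \<subseteq> set (take (2 * k) xs)")
  case True
  then show ?thesis using removable_set_of_short_ends[OF assms(1-4)] by blast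
next
  case False
  then obtain v where v: "v \<in> U" "real (card (cliques (nbrs U v) q)) \<le> clique_density k (Suc q)"
    using removable_vertex_of_long_end[OF assms(1,3,4,5)] by blast
  have "real (card {Q \<in> cliques U (Suc q). Q \<inter> {v} \<noteq> {}}) \<le> clique_density k (Suc q)"
    using card_cliques_through_le[OF \<open>finite U\<close>, of q v] v(2) by linarith
  then show ?thesis using v(1) assms by (intro exI[of _ "{v}"]) auto
qed

text \<open>A removable set \<open>S\<close> accounts for at most \<open>card S\<close> times the
  density, and the rest is nonempty, so the induction hypothesis applies. For a single vertex both
  sides are 0.\<close>

lemma card_cliques_le_density:
  assumes "finite U" "U \<noteq> {}" "6 \<le> k" "2 \<le> q" "odd_cycles_le (2 * k) U"
  shows "real (card (cliques U (Suc q))) \<le> (real (card U) - 1) * clique_density k (Suc q)"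
  using assms(1,2,5)
proof (induction U rule: finite_psubset_induct)
  case (psubset U)
  show ?case
  proof (cases "2 \<le> card U")
    case False
    have "card (cliques U (Suc q)) \<le> card U choose Suc q"
      using psubset.hyps by (rule card_cliques_le)
    moreover have "card U = 1"
      using False psubset by (metis One_nat_def Suc_leI card_gt_0_iff le_antisym not_less_eq_eq numeral_2_eq_2)
    moreover from this have "card U choose Suc q = 0" using \<open>2 \<le> q\<close> by (intro binomial_eq_0) simp
    ultimately have "card (cliques U (Suc q)) = 0" "card U = 1" by linarith+
    then show ?thesis by simp
  next
    case True
    then obtain S where S: "S \<subseteq> U" "S \<noteq> {}" "card S < card U"
      "real (card {Q \<in> cliques U (Suc q). Q \<inter> S \<noteq> {}}) \<le> real (card S) * clique_density k (Suc q)"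
      using removable_set_exists[OF psubset.hyps _ assms(3,4)] psubset.prems by blast
    have "U - S \<noteq> {}"
      using S by auto
    then have IH: "real (card (cliques (U - S) (Suc q))) \<le> (real (card (U - S)) - 1) * clique_density k (Suc q)"
      using S psubset.prems by (intro psubset.IH) (auto intro: odd_cycles_le_mono)
    have "card (U - S) = card U - card S"
      using S psubset.hyps by (meson card_Diff_subset finite_subset)
    then have "real (card (U - S)) = real (card U) - real (card S)"
      using S(3) by simp
    with IH S(4) show ?thesis
      using card_cliques_remove[OF psubset.hyps, of "Suc q" S] by (simp add: algebra_simps)
  qed
qed

subsection \<open>Connectedness\<close>

text \<open>Connectedness is phrased by cuts instead of walks, which reduces unions and vertex
  deletions to set computations.\<close>

definition conn :: "'a set \<Rightarrow> bool" where
  "conn U \<longleftrightarrow> U \<noteq> {} \<and> (\<forall>A. A \<subseteq> U \<and> A \<noteq> {} \<and> A \<noteq> U \<longrightarrow> (\<exists>a\<in>A. \<exists>b\<in>U - A. E a b))"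

text \<open>Single vertices and edges qualify along with the 2-connected sets. The guard exempts a
  single vertex, whose deletion leaves the empty set, which is not \<open>conn\<close>.\<close>

definition nonsep :: "'a set \<Rightarrow> bool" where
  "nonsep X \<longleftrightarrow> conn X \<and> (\<forall>v\<in>X. X - {v} \<noteq> {} \<longrightarrow> conn (X - {v}))"

definition max_nonsep :: "'a set \<Rightarrow> 'a set set" where
  "max_nonsep U = {X. X \<subseteq> U \<and> nonsep X \<and> (\<forall>Y. Y \<subseteq> U \<and> nonsep Y \<and> X \<subseteq> Y \<longrightarrow> Y = X)}"

lemma connD:
  "conn U \<Longrightarrow> A \<subseteq> U \<Longrightarrow> A \<noteq> {} \<Longrightarrow> A \<noteq> U \<Longrightarrow> \<exists>a\<in>A. \<exists>b\<in>U - A. E a b"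
  by (auto simp: conn_def)

lemma max_nonsepD:
  assumes "X \<in> max_nonsep U"
  shows "X \<subseteq> U" "nonsep X" "Y \<subseteq> U \<Longrightarrow> nonsep Y \<Longrightarrow> X \<subseteq> Y \<Longrightarrow> Y = X"
  using assms unfolding max_nonsep_def by blast+

lemma max_nonsepI:
  "X \<subseteq> U \<Longrightarrow> nonsep X \<Longrightarrow> (\<And>Y. Y \<subseteq> U \<Longrightarrow> nonsep Y \<Longrightarrow> X \<subseteq> Y \<Longrightarrow> Y = X) \<Longrightarrow> X \<in> max_nonsep U"
  unfolding max_nonsep_def by blast

lemma max_nonsep_subset:
  assumes "X \<in> max_nonsep U" "X \<subseteq> W" "W \<subseteq> U"
  shows "X \<in> max_nonsep W"
proof (rule max_nonsepI)
  fix Y assume "Y \<subseteq> W" "nonsep Y" "X \<subseteq> Y"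
  moreover from this have "Y \<subseteq> U" using assms(3) by simp
  ultimately show "Y = X" using max_nonsepD(3)[OF assms(1)] by simp
qed (use assms max_nonsepD(2) in simp_all)

lemma finite_max_nonsep: "finite U \<Longrightarrow> finite (max_nonsep U)"
  by (rule finite_subset[of _ "Pow U"]) (auto simp: max_nonsep_def)

lemma nonsep_extend:
  assumes "finite U" "X \<subseteq> U" "nonsep X"
  shows "\<exists>Y\<in>max_nonsep U. X \<subseteq> Y"
proof -
  define F where "F = {Y. Y \<subseteq> U \<and> nonsep Y \<and> X \<subseteq> Y}"
  have "finite F" "X \<in> F" using assms by (simp_all add: F_def)
  from finite_has_maximal2[OF this]
  obtain Y where Y: "Y \<in> F" "X \<subseteq> Y" "\<forall>Z\<in>F. Y \<subseteq> Z \<longrightarrow> Y = Z"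
    by (elim bexE conjE)
  have "Z = Y" if "Z \<subseteq> U" "nonsep Z" "Y \<subseteq> Z" for Z
  proof -
    have "Z \<in> F" using that Y(2) by (simp add: F_def)
    then show ?thesis using Y(3) that(3) by blast
  qed
  then have "Y \<in> max_nonsep U" using Y(1) unfolding max_nonsep_def F_def by simp
  then show ?thesis using Y(2) by (rule bexI[rotated])
qed

text \<open>A set that no edge leaves contains all or nothing of \<open>X\<close>, and likewise of
  \<open>Y\<close>; a common vertex makes the two cases agree.\<close>

lemma conn_Un:
  assumes "conn X" "conn Y" "X \<inter> Y \<noteq> {}"
  shows "conn (X \<union> Y)"
  unfolding conn_def
proof (intro conjI allI impI)
  show "X \<union> Y \<noteq> {}" using assms(3) by blast
  fix A assume A: "A \<subseteq> X \<union> Y \<and> A \<noteq> {} \<and> A \<noteq> X \<union> Y"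
  show "\<exists>a\<in>A. \<exists>b\<in>X \<union> Y - A. E a b"
  proof (rule ccontr)
    assume no: "\<not> (\<exists>a\<in>A. \<exists>b\<in>X \<union> Y - A. E a b)"
    have "A \<inter> X = {} \<or> A \<inter> X = X" using connD[OF assms(1), of "A \<inter> X"] no by blast
    moreover have "A \<inter> Y = {} \<or> A \<inter> Y = Y" using connD[OF assms(2), of "A \<inter> Y"] no by blast
    ultimately show False using A assms(3) by blast
  qed
qed

lemma conn_path:
  assumes "successively E xs" "xs \<noteq> []"
  shows "conn (set xs)"
  using assms
proof (induction xs)
  case (Cons x xs)
  show ?case
  proof (cases "xs = []")
    case True
    then show ?thesis by (auto simp: conn_def)
  next
    case False
    then have "conn (set xs)" and E: "E x (hd xs)" using Cons by (auto simp: successively_Cons)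
    moreover have "conn {x, hd xs}"
      unfolding conn_def
    proof (intro conjI allI impI)
      fix A assume "A \<subseteq> {x, hd xs} \<and> A \<noteq> {} \<and> A \<noteq> {x, hd xs}"
      then have "A = {x} \<and> hd xs \<noteq> x \<or> A = {hd xs} \<and> hd xs \<noteq> x" by blast
      then show "\<exists>a\<in>A. \<exists>b\<in>{x, hd xs} - A. E a b" using E sym[OF E] by auto
    qed simp
    moreover have "hd xs \<in> set xs" using False by simp
    ultimately have "conn ({x, hd xs} \<union> set xs)" by (intro conn_Un) auto
    moreover have "{x, hd xs} \<union> set xs = set (x # xs)" using False by auto
    ultimately show ?thesis by simp
  qed
qed simp

text \<open>Deleting \<open>v\<close> opens the cycle into one path: the part after
  \<open>v\<close>, the closing edge, the part before \<open>v\<close>.\<close>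

lemma nonsep_cycle:
  assumes "cycle xs" "xs \<noteq> []"
  shows "nonsep (set xs)"
  unfolding nonsep_def
proof (intro conjI ballI impI)
  show "conn (set xs)" using assms by (intro conn_path) (auto simp: cycle_def)
  fix v assume "v \<in> set xs" and ne: "set xs - {v} \<noteq> {}"
  then obtain ys zs where xs: "xs = ys @ v # zs" by (meson split_list)
  have "successively E (zs @ ys)"
    using assms by (auto simp: cycle_def xs successively_append_iff successively_Cons)
  moreover have "set (zs @ ys) = set xs - {v}"
    using assms by (auto simp: cycle_def xs)
  ultimately show "conn (set xs - {v})"
    using ne conn_path by (metis empty_set)
qed

definition clique :: "'a set \<Rightarrow> bool" where
  "clique X \<longleftrightarrow> (\<forall>x\<in>X. \<forall>y\<in>X. x \<noteq> y \<longrightarrow> E x y)"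

lemma successively_clique:
  assumes "clique X" "distinct xs" "set xs \<subseteq> X"
  shows "successively E xs"
  unfolding successively_conv_nth
proof (intro allI impI)
  fix i assume "Suc i < length xs"
  then show "E (xs ! i) (xs ! Suc i)"
    using assms by (metis Suc_lessD clique_def n_not_Suc_n nth_eq_iff_index_eq nth_mem subsetD)
qed

lemma conn_clique: "clique X \<Longrightarrow> X \<noteq> {} \<Longrightarrow> conn X"
  unfolding conn_def clique_def by (metis DiffI equalityI subsetI subsetD all_not_in_conv)

lemma nonsep_clique: "clique X \<Longrightarrow> X \<noteq> {} \<Longrightarrow> nonsep X"
  unfolding nonsep_def by (auto intro!: conn_clique simp: clique_def)

text \<open>Whichever vertex is deleted, \<open>x\<close> or \<open>y\<close> remains common to both
  parts.\<close>

lemma nonsep_Un: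
  assumes "nonsep X" "nonsep Y" "x \<in> X \<inter> Y" "y \<in> X \<inter> Y" "x \<noteq> y"
  shows "nonsep (X \<union> Y)"
  unfolding nonsep_def
proof (intro conjI ballI impI)
  show "conn (X \<union> Y)" using assms by (intro conn_Un) (auto simp: nonsep_def)
  have del: "conn (Z - {v})" if "nonsep Z" "x \<in> Z" "y \<in> Z" for Z v
    using that assms(5) unfolding nonsep_def by (cases "v \<in> Z") (metis Diff_iff empty_iff singletonD, simp)
  fix v assume "v \<in> X \<union> Y"
  have "(X - {v}) \<inter> (Y - {v}) \<noteq> {}"
    using assms(3-5) by (cases "v = x") auto
  then have "conn ((X - {v}) \<union> (Y - {v}))"
    using assms del by (intro conn_Un) auto
  then show "conn (X \<union> Y - {v})" by (simp add: Un_Diff)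
qed

subsection \<open>The extremal graphs\<close>

text \<open>A path outside \<open>X\<close> joins two clique vertices \<open>x\<close> and
  \<open>b\<close>. It closes up through the whole clique or through all but one of its vertices,
  whichever makes the length odd.\<close>

lemma nonsep_clique_odd_cycle:
  assumes "finite U" "nonsep U" "X \<subseteq> U" "clique X" "card X = 2 * k" "2 \<le> k" "2 * k < card U"
  shows "\<not> odd_cycles_le (2 * k) U"
proof
  assume odd: "odd_cycles_le (2 * k) U"
  have finX: "finite X" using assms finite_subset by blast
  have "X \<noteq> {}" "X \<noteq> U" using assms by auto
  then obtain x w where xw: "x \<in> X" "w \<in> U - X" "E x w"
    using connD[of U X] assms by (auto simp: nonsep_def)
  \<comment> \<open>\<open>A\<close> is what paths from \<open>w\<close> reach outside
    \<open>X\<close>. Since \<open>U - {x}\<close> is connected, some edge leaves \<open>A\<close>,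
    and it can only lead back to \<open>X\<close>.\<close>
  define A where "A = {z. \<exists>p. path (U - X) p \<and> hd p = w \<and> last p = z}"
  have A: "A \<subseteq> U - X" unfolding A_def path_def using last_in_set by blast
  have "path (U - X) [w]" using xw by (simp add: path_def)
  then have "w \<in> A" by (force simp: A_def)
  have "X - {x} \<noteq> {}"
  proof
    assume "X - {x} = {}"
    then have "card X \<le> card {x}" by (intro card_mono) auto
    then show False using assms by simp
  qed
  then have "A \<noteq> U - {x}" using A assms(3) by blast
  moreover have "conn (U - {x})"
    using assms(2,3) xw by (auto simp: nonsep_def)
  moreover have "A \<subseteq> U - {x}" using A xw by blast
  ultimately obtain a b where ab: "a \<in> A" "b \<in> U - {x} - A" "E a b"
    using \<open>w \<in> A\<close> connD[of "U - {x}" A] by blast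
  obtain p where p: "path (U - X) p" "hd p = w" "last p = a" using ab(1) by (auto simp: A_def)
  have "b \<in> X"
  proof (rule ccontr)
    assume "b \<notin> X"
    \<comment> \<open>The path is cut off at \<open>b\<close> or extended by \<open>b\<close>, which
      puts \<open>b\<close> into \<open>A\<close>.\<close>
    have "\<exists>p'. path (U - X) p' \<and> hd p' = w \<and> last p' = b"
    proof (cases "b \<in> set p")
      case True
      then obtain ys zs where "p = ys @ b # zs" by (meson split_list)
      then have "path (U - X) (ys @ [b]) \<and> hd (ys @ [b]) = w \<and> last (ys @ [b]) = b"
        using p by (cases ys) (auto simp: path_def successively_append_iff successively_Cons hd_append split: if_splits)
      then show ?thesis by blast
    next
      case False
      then have "path (U - X) (p @ [b]) \<and> hd (p @ [b]) = w \<and> last (p @ [b]) = b"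
        using p ab \<open>b \<notin> X\<close> by (auto simp: path_def successively_append_iff)
      then show ?thesis by blast
    qed
    then show False using ab(2) by (auto simp: A_def)
  qed
  then have "b \<noteq> x" using ab by auto
  obtain zs where zs: "set zs = X - {x, b}" "distinct zs"
    using finX by (meson finite_Diff finite_distinct_list)
  have "length zs = 2 * k - 2"
    using zs xw \<open>b \<in> X\<close> \<open>b \<noteq> x\<close> finX assms(5) by (metis (no_types, lifting) card_Diff_subset card_2_iff distinct_card empty_subsetI finite.emptyI finite.insertI insert_subset)
  \<comment> \<open>For an even number of outer vertices one clique vertex is left out. There are
    then at least two outer vertices, so the cycle still exceeds \<open>2 * k\<close>.\<close>
  define zs' where "zs' = (if odd (length p) then zs else tl zs)"
  have zs': "set zs' \<subseteq> X - {x, b}" "distinct zs'"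
    using zs set_drop_subset[of 1 zs] by (auto simp: zs'_def distinct_tl drop_Suc)
  define c where "c = p @ (b # zs' @ [x])"
  have pX: "set p \<subseteq> U - X" "distinct p" "p \<noteq> []" "successively E p" using p by (auto simp: path_def)
  have "successively E (b # zs' @ [x])"
    using zs' \<open>b \<in> X\<close> \<open>b \<noteq> x\<close> xw by (intro successively_clique[OF \<open>clique X\<close>]) auto
  then have "successively E c"
    using pX p ab(3) by (simp add: c_def successively_append_iff)
  moreover have "distinct c" using pX zs' \<open>b \<in> X\<close> \<open>b \<noteq> x\<close> xw by (auto simp: c_def)
  moreover have "E (last c) (hd c)" using pX p xw by (simp add: c_def)
  ultimately have "cycle c" by (simp add: cycle_def)
  moreover have "set c \<subseteq> U" using pX zs' xw \<open>b \<in> X\<close> assms(3) by (auto simp: c_def)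
  moreover have "odd (length c)" "2 * k < length c"
  proof -
    have "length p > 0" using pX by simp
    obtain j where j: "k = j + 2" using \<open>2 \<le> k\<close> by (metis add.commute le_Suc_ex)
    have len: "length c = length p + length zs' + 2" by (simp add: c_def)
    have "odd (length c) \<and> 2 * k < length c"
    proof (cases "odd (length p)")
      case True
      then have "length zs' = 2 * j + 2" using \<open>length zs = 2 * k - 2\<close> by (simp add: zs'_def j)
      then show ?thesis using True \<open>length p > 0\<close> by (simp add: len j)
    next
      case False
      then have "length zs' = 2 * j + 1" using \<open>length zs = 2 * k - 2\<close> by (simp add: zs'_def j)
      moreover have "2 \<le> length p" using False \<open>length p > 0\<close> by presburger
      ultimately show ?thesis using False by (simp add: len j)
    qed
    then show "odd (length c)" "2 * k < length c" by auto
  qed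
  ultimately show False using odd_cycles_leD[OF odd] by fastforce
qed

text \<open>No clique contains both a vertex private to \<open>U1\<close> and one private to
  \<open>U2\<close>.\<close>

lemma card_cliques_Un_le:
  assumes "finite U1" "finite U2" and no: "\<And>a b. a \<in> U1 - U2 \<Longrightarrow> b \<in> U2 - U1 \<Longrightarrow> \<not> E a b"
  shows "card (cliques (U1 \<union> U2) r) \<le> card (cliques U1 r) + card (cliques U2 r)"
proof -
  have "cliques (U1 \<union> U2) r \<subseteq> cliques U1 r \<union> cliques U2 r"
  proof
    fix Q assume Q: "Q \<in> cliques (U1 \<union> U2) r"
    have "Q \<subseteq> U1 \<or> Q \<subseteq> U2"
    proof (rule ccontr)
      assume "\<not> (Q \<subseteq> U1 \<or> Q \<subseteq> U2)"
      then obtain a b where "a \<in> Q" "a \<notin> U2" "b \<in> Q" "b \<notin> U1" by blast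
      moreover from this have ab: "a \<in> U1 - U2" "b \<in> U2 - U1" using Q by (auto simp: cliques_def)
      moreover have "a \<noteq> b" using ab by blast
      ultimately have "E a b" using Q by (simp add: cliques_def)
      with ab show False using no by blast
    qed
    then show "Q \<in> cliques U1 r \<union> cliques U2 r" using Q by (auto simp: cliques_def)
  qed
  then have "card (cliques (U1 \<union> U2) r) \<le> card (cliques U1 r \<union> cliques U2 r)"
    using assms by (intro card_mono) auto
  also have "\<dots> \<le> card (cliques U1 r) + card (cliques U2 r)" by (rule card_Un_le)
  finally show ?thesis .
qed

text \<open>The maximal count makes every \<open>r\<close>-subset a clique, and any two vertices lie
  in such a subset.\<close>

lemma clique_if_all_subsets_cliques:
  assumes "finite U" "card (cliques U r) = card U choose r" "2 \<le> r" "r \<le> card U"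
  shows "clique U"
  unfolding clique_def
proof (intro ballI impI)
  fix x y assume xy: "x \<in> U" "y \<in> U" "x \<noteq> y"
  have "cliques U r = {Q. Q \<subseteq> U \<and> card Q = r}"
    using assms cliques_subset_subsets by (intro card_subset_eq) (auto simp: n_subsets)
  moreover obtain Q where "{x, y} \<subseteq> Q" "Q \<subseteq> U" "card Q = r"
    using assms xy exists_subset_between[of "{x, y}" r U] by auto
  ultimately show "E x y" using xy by (auto simp: cliques_def)
qed

text \<open>Induction on \<open>U\<close>. A nonseparable extremal set has to be a
  \<open>2 * k\<close>-clique; at a cut vertex both sides are extremal again, and their blocks
  together are the blocks of \<open>U\<close>.\<close>

lemma extremal_structure:
  assumes "finite U" "2 \<le> card U" "6 \<le> k" "2 \<le> q" "Suc q \<le> 2 * k" "odd_cycles_le (2 * k) U"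
    and "real (card (cliques U (Suc q))) = (real (card U) - 1) * clique_density k (Suc q)"
  shows "conn U \<and> (\<forall>X\<in>max_nonsep U. card X = 2 * k \<and> clique X) \<and>
    (2 * k - 1) * card (max_nonsep U) = card U - 1"
  using assms(1,2,6,7)
proof (induction U rule: finite_psubset_induct)
  case (psubset U)
  define T where "T = clique_density k (Suc q)"
  have T: "0 < T" using clique_density_pos assms by (simp add: T_def)
  have fin: "finite W" if "W \<subseteq> U" for W using that psubset.hyps finite_subset by blast
  have bound: "real (card (cliques W (Suc q))) \<le> (real (card W) - 1) * T"
    if "W \<subseteq> U" "W \<noteq> {}" for W
    using that psubset.prems(2) fin[OF that(1)] assms unfolding T_def
    by (intro card_cliques_le_density odd_cycles_le_mono[OF psubset.prems(2)])
  have eq: "real (card (cliques U (Suc q))) = (real (card U) - 1) * T"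
    using psubset.prems by (simp add: T_def)
  have U: "U \<noteq> {}" using psubset.prems(1) by auto
  \<comment> \<open>Adding the bounds for two sides without edges between them gives only
    \<open>card U - 2\<close> times the density.\<close>
  have conn: "conn U"
  proof (rule ccontr)
    assume "\<not> conn U"
    then obtain A where A: "A \<subseteq> U" "A \<noteq> {}" "A \<noteq> U" and no: "\<And>a b. a \<in> A \<Longrightarrow> b \<in> U - A \<Longrightarrow> \<not> E a b"
      using U by (auto simp: conn_def)
    have "U = A \<union> (U - A)" using A by blast
    then have "card (cliques U (Suc q)) \<le> card (cliques A (Suc q)) + card (cliques (U - A) (Suc q))"
      using card_cliques_Un_le[of A "U - A" "Suc q"] no fin[OF A(1)] psubset.hyps by auto
    moreover have "real (card (cliques A (Suc q))) \<le> (real (card A) - 1) * T"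
      using A by (intro bound)
    moreover have "real (card (cliques (U - A) (Suc q))) \<le> (real (card (U - A)) - 1) * T"
      using A by (intro bound) auto
    moreover have "card U = card A + card (U - A)"
      using A(1) psubset.hyps by (metis card_Diff_subset card_mono fin le_add_diff_inverse)
    then have "real (card (cliques U (Suc q))) = (real (card A) + real (card (U - A)) - 1) * T"
      using eq by simp
    ultimately have "(real (card A) + real (card (U - A)) - 1) * T
      \<le> (real (card A) - 1) * T + (real (card (U - A)) - 1) * T"
      by linarith
    then show False using T by (simp add: algebra_simps)
  qed
  show ?case
  proof (cases "nonsep U")
    case True
    then have max: "max_nonsep U = {U}" by (auto simp: max_nonsep_def)
    have "card U \<le> 2 * k"
    proof (rule ccontr)
      assume large: "\<not> card U \<le> 2 * k"
      obtain S where S: "S \<subseteq> U" "S \<noteq> {}" "card S \<le> 2 * k - 1"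
        "real (card {Q \<in> cliques U (Suc q). Q \<inter> S \<noteq> {}}) \<le> real (card S) * T"
        using removable_set_exists[OF psubset.hyps psubset.prems(1) assms(3,4) psubset.prems(2)]
        unfolding T_def by blast
      \<comment> \<open>More than \<open>2 * k\<close> vertices minus at most
        \<open>2 * k - 1\<close> leaves at least two, so the remaining graph, once shown extremal,
        has a block.\<close>
      have "card (U - S) = card U - card S"
        using S fin by (simp add: card_Diff_subset)
      then have cardD: "real (card (U - S)) = real (card U) - real (card S)" and ge2: "2 \<le> card (U - S)"
        using S(3) large \<open>6 \<le> k\<close> by auto
      have "U - S \<noteq> {}" using ge2 by (metis card.empty not_numeral_le_zero)
      then have "real (card (cliques (U - S) (Suc q))) \<le> (real (card (U - S)) - 1) * T"
        by (intro bound) auto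
      \<comment> \<open>The bounds for \<open>S\<close> and for the rest add up to the extremal
        value, so both are attained.\<close>
      then have "real (card (cliques (U - S) (Suc q))) = (real (card (U - S)) - 1) * T"
        using S(4) eq card_cliques_remove[OF psubset.hyps, of "Suc q" S]
        unfolding cardD by (simp add: algebra_simps)
      then have IH: "(\<forall>X\<in>max_nonsep (U - S). card X = 2 * k \<and> clique X)"
        "(2 * k - 1) * card (max_nonsep (U - S)) = card (U - S) - 1"
        using S ge2 psubset.prems(2) psubset.IH[of "U - S"] by (auto simp: T_def intro: odd_cycles_le_mono)
      then have "max_nonsep (U - S) \<noteq> {}" using ge2 by auto
      then obtain X where "X \<in> max_nonsep (U - S)" by blast
      then have "X \<subseteq> U" "card X = 2 * k" "clique X" using IH by (auto simp: max_nonsep_def)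
      then show False
        using nonsep_clique_odd_cycle[OF psubset.hyps True, of X k] large \<open>6 \<le> k\<close> psubset.prems(2) by simp
    qed
    moreover have "\<not> card U < 2 * k"
    proof
      assume "card U < 2 * k"
      then have "real (card U choose Suc q) < (real (card U) - 1) * T"
        unfolding T_def using assms psubset.prems by (intro choose_less_clique_density) auto
      then show False
        using eq card_cliques_le[OF psubset.hyps, of "Suc q"] by simp
    qed
    ultimately have card: "card U = 2 * k" by simp
    have "(real (card U) - 1) * T = real (2 * k choose Suc q)"
      using \<open>6 \<le> k\<close> by (simp add: T_def clique_density_def card)
    then have "card (cliques U (Suc q)) = card U choose Suc q" using eq card by simp
    then have "clique U" using assms card psubset.hyps by (intro clique_if_all_subsets_cliques) auto
    then show ?thesis using conn card max by simp
  next
    case False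
    then obtain v where v: "v \<in> U" "U - {v} \<noteq> {}" "\<not> conn (U - {v})" using conn by (auto simp: nonsep_def)
    then obtain A where A: "A \<subseteq> U - {v}" "A \<noteq> {}" "A \<noteq> U - {v}"
      and no: "\<And>a b. a \<in> A \<Longrightarrow> b \<in> U - {v} - A \<Longrightarrow> \<not> E a b"
      by (auto simp: conn_def)
    \<comment> \<open>The sides share exactly \<open>v\<close>, so
      \<open>(card U1 - 1) + (card U2 - 1) = card U - 1\<close> and the two upper bounds add up
      without slack.\<close>
    define U1 U2 where "U1 = insert v A" and "U2 = U - A"
    have U12: "U1 \<union> U2 = U" "U1 \<inter> U2 = {v}" "U1 \<subset> U" "U2 \<subset> U" using A v by (auto simp: U1_def U2_def)
    then have sub: "U1 \<subseteq> U" "U2 \<subseteq> U" by auto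
    have "A = U1 - {v}" "U - {v} - A = U2 - {v}" using A by (auto simp: U1_def U2_def)
    then have cards: "card U1 + card U2 = card U + 1"
      using card_Un_Int[of U1 U2] fin sub U12 by simp
    have ge2: "2 \<le> card U1" "2 \<le> card U2"
    proof -
      obtain a where "a \<in> A" using A by blast
      then have "{a, v} \<subseteq> U1" "a \<noteq> v" using A by (auto simp: U1_def)
      then show "2 \<le> card U1" using fin[OF sub(1)] by (metis card_2_iff card_mono)
      obtain b where "b \<in> U - {v} - A" using A by blast
      then have "{b, v} \<subseteq> U2" "b \<noteq> v" using A v by (auto simp: U2_def)
      then show "2 \<le> card U2" using fin[OF sub(2)] by (metis card_2_iff card_mono)
    qed
    have no12: "\<not> E a b" if "a \<in> U1 - U2" "b \<in> U2 - U1" for a b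
      using that v(1) no[of a b] by (auto simp: U1_def U2_def)
    have le: "card (cliques U (Suc q)) \<le> card (cliques U1 (Suc q)) + card (cliques U2 (Suc q))"
      using card_cliques_Un_le[of U1 U2 "Suc q"] no12 fin sub U12 by simp
    have b1: "real (card (cliques U1 (Suc q))) \<le> (real (card U1) - 1) * T"
      and b2: "real (card (cliques U2 (Suc q))) \<le> (real (card U2) - 1) * T"
      using ge2 sub by (auto intro!: bound)
    have "(real (card U1) - 1) * T + (real (card U2) - 1) * T = (real (card U1 + card U2) - 2) * T"
      by (simp add: algebra_simps)
    also have "\<dots> = real (card (cliques U (Suc q)))" using eq cards by simp
    finally have eqs: "real (card (cliques U1 (Suc q))) = (real (card U1) - 1) * T"
      "real (card (cliques U2 (Suc q))) = (real (card U2) - 1) * T"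
      using le b1 b2 by linarith+
    have IH1: "(\<forall>X\<in>max_nonsep U1. card X = 2 * k \<and> clique X)" "(2 * k - 1) * card (max_nonsep U1) = card U1 - 1"
      using psubset.IH[of U1] U12 ge2 eqs psubset.prems(2) sub by (auto simp: T_def intro: odd_cycles_le_mono)
    have IH2: "(\<forall>X\<in>max_nonsep U2. card X = 2 * k \<and> clique X)" "(2 * k - 1) * card (max_nonsep U2) = card U2 - 1"
      using psubset.IH[of U2] U12 ge2 eqs psubset.prems(2) sub by (auto simp: T_def intro: odd_cycles_le_mono)
    have small: "\<not> (X \<subseteq> U1 \<and> X \<subseteq> U2)" if "card X = 2 * k" for X
    proof
      assume "X \<subseteq> U1 \<and> X \<subseteq> U2"
      then have "card X \<le> card {v}" using U12 by (intro card_mono) auto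
      then show False using that \<open>6 \<le> k\<close> by simp
    qed
    \<comment> \<open>A nonseparable set stays connected without \<open>v\<close>, but no edge runs
      between the two sides then.\<close>
    have side: "X \<subseteq> U1 \<or> X \<subseteq> U2" if "X \<subseteq> U" "nonsep X" for X
    proof (rule ccontr)
      assume "\<not> (X \<subseteq> U1 \<or> X \<subseteq> U2)"
      then obtain x y where x: "x \<in> X" "x \<notin> U1" and y: "y \<in> X" "y \<notin> U2" by blast
      have x': "x \<in> X - {v}" "x \<notin> A" using x by (auto simp: U1_def)
      have y': "y \<in> X - {v}" "y \<in> A" using y that(1) A by (auto simp: U2_def)
      have "conn (X - {v})" using that(2) x'(1) unfolding nonsep_def
        by (cases "v \<in> X") auto
  then obtain a b where "a \<in> (X - {v}) \<inter> A" "b \<in> X - {v} - (X - {v}) \<inter> A" "E a b"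
        using connD[of "X - {v}" "(X - {v}) \<inter> A"] x' y' by blast
      then show False using no[of a b] that(1) by blast
    qed
    have "max_nonsep U = max_nonsep U1 \<union> max_nonsep U2"
    proof (intro equalityI subsetI)
      fix X assume X: "X \<in> max_nonsep U"
      then have "X \<subseteq> U1 \<or> X \<subseteq> U2" using side max_nonsepD(1,2)[OF X] by simp
      then show "X \<in> max_nonsep U1 \<union> max_nonsep U2"
        using max_nonsep_subset[OF X] sub by blast
    next
      fix X assume X: "X \<in> max_nonsep U1 \<union> max_nonsep U2"
      then have card: "card X = 2 * k" and ns: "nonsep X" "X \<subseteq> U"
        using IH1 IH2 sub by (auto simp: max_nonsep_def)
      have "Y = X" if Y: "Y \<subseteq> U" "nonsep Y" "X \<subseteq> Y" for Y
      proof -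
        consider "Y \<subseteq> U1" | "Y \<subseteq> U2" using side[OF Y(1,2)] by blast
        then show ?thesis
        proof cases
          case 1
          then have "\<not> X \<subseteq> U2" using small[OF card] Y(3) by auto
          then have "X \<in> max_nonsep U1" using X max_nonsepD(1)[of X U2] by auto
          then show ?thesis using 1 Y(2,3) by (rule max_nonsepD(3))
        next
          case 2
          then have "\<not> X \<subseteq> U1" using small[OF card] Y(3) by auto
          then have "X \<in> max_nonsep U2" using X max_nonsepD(1)[of X U1] by auto
          then show ?thesis using 2 Y(2,3) by (rule max_nonsepD(3))
        qed
      qed
      then show "X \<in> max_nonsep U" using ns by (intro max_nonsepI)
    qed
    moreover have "max_nonsep U1 \<inter> max_nonsep U2 = {}"
    proof -
      have False if "X \<in> max_nonsep U1" "X \<in> max_nonsep U2" for X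
        using that small[of X] IH1 by (auto simp: max_nonsep_def)
      then show ?thesis by blast
    qed
    ultimately have "card (max_nonsep U) = card (max_nonsep U1) + card (max_nonsep U2)"
      using fin sub by (simp add: card_Un_disjoint finite_max_nonsep)
    then have "(2 * k - 1) * card (max_nonsep U) = (card U1 - 1) + (card U2 - 1)"
      using IH1(2) IH2(2) by (simp add: add_mult_distrib2)
    also have "\<dots> = card U - 1" using cards ge2 by simp
    finally show ?thesis
      using conn IH1(1) IH2(1) \<open>max_nonsep U = max_nonsep U1 \<union> max_nonsep U2\<close> by auto
  qed
qed

section \<open>Graphs whose blocks are cliques\<close>

text \<open>The vertex set of a cycle is nonseparable, hence contained in a block.\<close>

lemma clique_blocks_odd_cycles_le:
  assumes "finite U" and blocks: "\<And>X. X \<in> max_nonsep U \<Longrightarrow> card X \<le> l"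
  shows "odd_cycles_le l U"
  unfolding odd_cycles_le_def
proof (intro allI impI)
  fix xs assume xs: "set xs \<subseteq> U \<and> cycle xs \<and> odd (length xs)"
  then have "nonsep (set xs)" by (intro nonsep_cycle) auto
  then obtain X where X: "X \<in> max_nonsep U" "set xs \<subseteq> X" using nonsep_extend assms(1) xs by meson
  have "finite X" using X(1) assms(1) finite_subset by (auto simp: max_nonsep_def)
  then have "card (set xs) \<le> card X" using X(2) by (rule card_mono)
  then show "length xs \<le> l" using blocks[OF X(1)] xs by (simp add: cycle_def distinct_card)
qed

lemma card_cliques_clique: "finite X \<Longrightarrow> clique X \<Longrightarrow> card (cliques X r) = card X choose r"
proof -
  assume "finite X" "clique X"
  moreover from this have "cliques X r = {Q. Q \<subseteq> X \<and> card Q = r}"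
    by (auto simp: cliques_def clique_def)
  ultimately show ?thesis by (simp add: n_subsets)
qed

text \<open>A clique is nonseparable and so lies in a block, and in only one: two blocks sharing two
  vertices would have a nonseparable union.\<close>

lemma card_cliques_clique_blocks:
  assumes "finite U" "2 \<le> r" and blocks: "\<And>X. X \<in> max_nonsep U \<Longrightarrow> card X = l \<and> clique X"
  shows "card (cliques U r) = card (max_nonsep U) * (l choose r)"
proof -
  have finX: "finite X" if "X \<in> max_nonsep U" for X
    using that assms(1) finite_subset by (auto simp: max_nonsep_def)
  have "cliques U r = (\<Union>X\<in>max_nonsep U. cliques X r)"
  proof (intro equalityI subsetI)
    fix Q assume Q: "Q \<in> cliques U r"
    then have "clique Q" "Q \<noteq> {}" "Q \<subseteq> U" using \<open>2 \<le> r\<close> by (auto simp: cliques_def clique_def)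
    then obtain X where "X \<in> max_nonsep U" "Q \<subseteq> X"
      using nonsep_extend[OF assms(1)] nonsep_clique by meson
    then show "Q \<in> (\<Union>X\<in>max_nonsep U. cliques X r)" using Q by (auto simp: cliques_def)
  qed (auto simp: cliques_def max_nonsep_def)
  moreover have "cliques X r \<inter> cliques Y r = {}"
    if XY: "X \<in> max_nonsep U" "Y \<in> max_nonsep U" "X \<noteq> Y" for X Y
  proof (rule ccontr)
    assume "cliques X r \<inter> cliques Y r \<noteq> {}"
    then obtain Q where Q: "Q \<subseteq> X \<inter> Y" "card Q = r" by (auto simp: cliques_def)
    then obtain x y where "x \<in> Q" "y \<in> Q" "x \<noteq> y"
      using \<open>2 \<le> r\<close> by (metis card_le_Suc0_iff_eq card.infinite not_less_eq_eq numeral_2_eq_2 zero_le)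
    then have "nonsep (X \<union> Y)" using Q XY by (intro nonsep_Un[of X Y x y]) (auto simp: max_nonsep_def)
    moreover have "X \<union> Y \<subseteq> U" using XY by (auto simp: max_nonsep_def)
    ultimately have "X \<union> Y = X" "X \<union> Y = Y" using XY by (auto simp: max_nonsep_def)
    then show False using \<open>X \<noteq> Y\<close> by simp
  qed
  ultimately have "card (cliques U r) = (\<Sum>X\<in>max_nonsep U. card (cliques X r))"
    using assms(1) finX by (simp add: card_UN_disjoint finite_max_nonsep)
  also have "\<dots> = (\<Sum>X\<in>max_nonsep U. l choose r)"
    using blocks finX by (intro sum.cong refl) (metis card_cliques_clique)
  finally show ?thesis by simp
qed

end

section \<open>Symmetric digraphs as adjacency relations\<close>

definition adj :: "'a pair_pre_digraph \<Rightarrow> 'a \<Rightarrow> 'a \<Rightarrow> bool" where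
  "adj G x y \<longleftrightarrow> (x, y) \<in> parcs G"

definition induced :: "'a pair_pre_digraph \<Rightarrow> 'a set \<Rightarrow> 'a pair_pre_digraph" where
  "induced G X = \<lparr>pverts = X, parcs = {(x, y). x \<in> X \<and> y \<in> X \<and> (x, y) \<in> parcs G}\<rparr>"

lemma induced_simps [simp]:
  "pverts (induced G X) = X"
  "(x, y) \<in> parcs (induced G X) \<longleftrightarrow> x \<in> X \<and> y \<in> X \<and> (x, y) \<in> parcs G"
  by (auto simp: induced_def)

lemma pair_graphI:
  assumes "finite (pverts H)"
    and "\<And>x y. (x, y) \<in> parcs H \<Longrightarrow> x \<in> pverts H \<and> y \<in> pverts H \<and> x \<noteq> y \<and> (y, x) \<in> parcs H"
  shows "pair_graph H"
proof
  show "finite (parcs H)"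
    using assms by (intro finite_subset[of "parcs H" "pverts H \<times> pverts H"]) auto
qed (use assms in \<open>auto simp: symmetric_def sym_def\<close>)

lemma pair_graphD:
  assumes "pair_graph H"
  shows "finite (pverts H)"
    and "(x, y) \<in> parcs H \<Longrightarrow> x \<in> pverts H" "(x, y) \<in> parcs H \<Longrightarrow> y \<in> pverts H"
    and "(x, y) \<in> parcs H \<Longrightarrow> x \<noteq> y" "(x, y) \<in> parcs H \<Longrightarrow> (y, x) \<in> parcs H"
proof -
  interpret pair_graph H by fact
  show "finite (pverts H)" by (rule pair_finite_verts)
  show "(x, y) \<in> parcs H \<Longrightarrow> x \<in> pverts H" by (rule in_arcsD1)
  show "(x, y) \<in> parcs H \<Longrightarrow> y \<in> pverts H" by (rule in_arcsD2)
  show "(x, y) \<in> parcs H \<Longrightarrow> x \<noteq> y" by (rule no_loops')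
  show "(x, y) \<in> parcs H \<Longrightarrow> (y, x) \<in> parcs H" by (rule arcs_symmetric)
qed

lemma pair_graph_induced:
  assumes "pair_graph G" "X \<subseteq> pverts G"
  shows "pair_graph (induced G X)"
proof (rule pair_graphI)
  show "finite (pverts (induced G X))"
    using assms pair_graphD(1) finite_subset by fastforce
  fix x y assume "(x, y) \<in> parcs (induced G X)"
  then show "x \<in> pverts (induced G X) \<and> y \<in> pverts (induced G X) \<and> x \<noteq> y \<and> (y, x) \<in> parcs (induced G X)"
    using pair_graphD(4,5)[OF assms(1), of x y] by auto
qed

lemma adjacency_adj:
  assumes "pair_graph G"
  shows "adjacency (adj G)"
proof
  fix x y
  show "adj G x y \<Longrightarrow> adj G y x" unfolding adj_def using assms by (rule pair_graphD(5))
  show "\<not> adj G x x" using pair_graphD(4)[OF assms, of x x] by (auto simp: adj_def)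
qed

lemma subgraph_with_proj_iff:
  assumes "pair_graph H" "pair_graph G"
  shows "subgraph (with_proj H) (with_proj G) \<longleftrightarrow> pverts H \<subseteq> pverts G \<and> parcs H \<subseteq> parcs G"
proof -
  have "wf_digraph (with_proj K)" if "pair_graph K" for K :: "'a pair_pre_digraph"
    using that by (simp add: wf_digraph_wp_iff pair_graph_def pair_digraph_def pair_fin_digraph_def)
  then show ?thesis using assms by (auto simp: subgraph_def)
qed

lemma subgraph_eq_with_proj:
  assumes "subgraph H (with_proj G)"
  shows "H = with_proj \<lparr>pverts = verts H, parcs = arcs H\<rparr>"
  using assms by (intro pre_digraph.equality) (auto simp: subgraph_def compatible_def with_proj_def)

lemma with_proj_eq_iff: "with_proj G = with_proj H \<longleftrightarrow> pverts G = pverts H \<and> parcs G = parcs H"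
  by (auto simp: with_proj_def)

subsection \<open>Isomorphic copies\<close>

text \<open>An isomorphism also carries an arc map and new end maps. Between pair graphs the end
  maps are the projections, so the vertex map determines the rest; \<open>g\<close> is its inverse
  and points from the model \<open>K\<close> to \<open>H\<close>.\<close>

lemma digraph_iso_iff:
  assumes "pair_graph H" "pair_graph K"
  shows "digraph_iso (with_proj H) (with_proj K) \<longleftrightarrow>
    (\<exists>g. bij_betw g (pverts K) (pverts H) \<and> parcs H = (\<lambda>(x, y). (g x, g y)) ` parcs K)"
proof
  assume "digraph_iso (with_proj H) (with_proj K)"
  then obtain hom where hom: "pre_digraph.digraph_isomorphism (with_proj H) hom"
    and K: "with_proj K = app_iso hom (with_proj H)"
    by (auto simp: digraph_iso_def)
  define f where "f = iso_verts hom"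
  have inj: "inj_on f (pverts H)"
    and ends: "\<And>a. a \<in> parcs H \<Longrightarrow> f (fst a) = iso_tail hom (iso_arcs hom a) \<and> f (snd a) = iso_head hom (iso_arcs hom a)"
    using hom by (auto simp: pre_digraph.digraph_isomorphism_def f_def)
  have "verts (with_proj K) = f ` pverts H" "arcs (with_proj K) = iso_arcs hom ` parcs H"
    and "tail (with_proj K) = iso_tail hom" "head (with_proj K) = iso_head hom"
    unfolding K by (simp_all add: f_def)
  then have KV: "pverts K = f ` pverts H" and KA: "parcs K = iso_arcs hom ` parcs H"
    and proj: "iso_tail hom = fst" "iso_head hom = snd"
    by simp_all
  have arcs: "iso_arcs hom a = (f (fst a), f (snd a))" if "a \<in> parcs H" for a
    using ends[OF that] by (simp add: proj)
  define g where "g = the_inv_into (pverts H) f"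
  have gf: "g (f x) = x" if "x \<in> pverts H" for x
    using inj that by (simp add: g_def the_inv_into_f_f)
  have "bij_betw g (pverts K) (pverts H)"
    unfolding KV g_def using inj by (intro bij_betw_the_inv_into) (simp add: bij_betw_def)
  moreover have "(\<lambda>(x, y). (g x, g y)) ` parcs K = parcs H"
  proof -
    have "(\<lambda>(x, y). (g x, g y)) ` parcs K = (\<lambda>a. a) ` parcs H"
      unfolding KA image_image
    proof (rule image_cong[OF refl])
      fix a assume a: "a \<in> parcs H"
      then have "fst a \<in> pverts H" "snd a \<in> pverts H"
        using pair_graphD(2,3)[OF assms(1), of "fst a" "snd a"] by auto
      then show "(case iso_arcs hom a of (x, y) \<Rightarrow> (g x, g y)) = a"
        using a by (simp add: arcs gf)
    qed
    then show ?thesis by simp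
  qed
  ultimately show "\<exists>g. bij_betw g (pverts K) (pverts H) \<and> parcs H = (\<lambda>(x, y). (g x, g y)) ` parcs K"
    by metis
next
  assume "\<exists>g. bij_betw g (pverts K) (pverts H) \<and> parcs H = (\<lambda>(x, y). (g x, g y)) ` parcs K"
  then obtain g where g: "bij_betw g (pverts K) (pverts H)" and H: "parcs H = (\<lambda>(x, y). (g x, g y)) ` parcs K"
    by blast
  define f where "f = the_inv_into (pverts K) g"
  have f: "bij_betw f (pverts H) (pverts K)" unfolding f_def using g by (rule bij_betw_the_inv_into)
  have fg: "f (g x) = x" if "x \<in> pverts K" for x
    using g that by (simp add: f_def bij_betw_def the_inv_into_f_f)
  have arcs: "(\<lambda>(x, y). (f x, f y)) ` parcs H = parcs K"
  proof -
    have "(\<lambda>(x, y). (f x, f y)) ` parcs H = (\<lambda>a. a) ` parcs K"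
      unfolding H image_image
    proof (rule image_cong[OF refl])
      fix a assume "a \<in> parcs K"
      then have "fst a \<in> pverts K" "snd a \<in> pverts K"
        using pair_graphD(2,3)[OF assms(2), of "fst a" "snd a"] by auto
      then show "(\<lambda>(x, y). (f x, f y)) (case a of (x, y) \<Rightarrow> (g x, g y)) = a"
        by (simp add: fg split_def)
    qed
    then show ?thesis by simp
  qed
  define hom where "hom = \<lparr>iso_verts = f, iso_arcs = (\<lambda>(x, y). (f x, f y)), iso_head = snd, iso_tail = fst\<rparr>"
  have wf: "wf_digraph (with_proj H)"
    using assms(1) by (simp add: wf_digraph_wp_iff pair_graph_def pair_digraph_def pair_fin_digraph_def)
  have "inj_on (\<lambda>(x, y). (f x, f y)) (parcs H)"
  proof (rule inj_onI)
    fix a b assume ab: "a \<in> parcs H" "b \<in> parcs H" "(\<lambda>(x, y). (f x, f y)) a = (\<lambda>(x, y). (f x, f y)) b"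
    then have "fst a \<in> pverts H" "snd a \<in> pverts H" "fst b \<in> pverts H" "snd b \<in> pverts H"
      using pair_graphD(2,3)[OF assms(1)] by (metis prod.collapse)+
    then show "a = b" using ab(3) f unfolding bij_betw_def inj_on_def by (auto simp: split_def prod_eq_iff)
  qed
  then have "pre_digraph.digraph_isomorphism (with_proj H) hom"
    using wf f by (auto simp: pre_digraph.digraph_isomorphism_def hom_def bij_betw_def)
  moreover have "with_proj K = app_iso hom (with_proj H)"
    using f arcs by (auto simp: app_iso_def with_proj_def hom_def bij_betw_def)
  ultimately show "digraph_iso (with_proj H) (with_proj K)" by (auto simp: digraph_iso_def)
qed

definition complete_on :: "'a set \<Rightarrow> 'a pair_pre_digraph" where
  "complete_on Q = \<lparr>pverts = Q, parcs = {(x, y). x \<in> Q \<and> y \<in> Q \<and> x \<noteq> y}\<rparr>"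

lemma digraph_iso_complete_graph:
  assumes "pair_graph H"
  shows "digraph_iso (with_proj H) (with_proj (complete_graph r)) \<longleftrightarrow>
    card (pverts H) = r \<and> H = complete_on (pverts H)"
  unfolding digraph_iso_iff[OF assms pair_graph_complete_graph]
proof
  assume "\<exists>g. bij_betw g (pverts (complete_graph r)) (pverts H) \<and>
    parcs H = (\<lambda>(x, y). (g x, g y)) ` parcs (complete_graph r)"
  then obtain g where g: "bij_betw g {..<r} (pverts H)"
    and H: "parcs H = (\<lambda>(x, y). (g x, g y)) ` {(i, j). i < r \<and> j < r \<and> i \<noteq> j}"
    by (auto simp: complete_graph_def)
  have "card (pverts H) = r" using bij_betw_same_card[OF g] by simp
  moreover have "parcs H = {(x, y). x \<in> pverts H \<and> y \<in> pverts H \<and> x \<noteq> y}"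
  proof (intro equalityI subsetI)
    fix a assume "a \<in> parcs H"
    then show "a \<in> {(x, y). x \<in> pverts H \<and> y \<in> pverts H \<and> x \<noteq> y}"
      using pair_graphD(2-4)[OF assms, of "fst a" "snd a"] by (auto simp: split_def)
  next
    fix a assume a: "a \<in> {(x, y). x \<in> pverts H \<and> y \<in> pverts H \<and> x \<noteq> y}"
    then have "fst a \<in> g ` {..<r}" "snd a \<in> g ` {..<r}" "fst a \<noteq> snd a"
      using g by (auto simp: bij_betw_def)
    then obtain i j where "i < r" "j < r" "a = (g i, g j)" "i \<noteq> j"
      by (metis imageE lessThan_iff prod.collapse)
    then show "a \<in> parcs H" unfolding H by (intro image_eqI[of _ _ "(i, j)"]) auto
  qed
  ultimately show "card (pverts H) = r \<and> H = complete_on (pverts H)"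
    by (simp add: complete_on_def)
next
  assume *: "card (pverts H) = r \<and> H = complete_on (pverts H)"
  have "finite (pverts H)" using assms by (rule pair_graphD)
  then obtain g where g: "bij_betw g {..<r} (pverts H)"
    using ex_bij_betw_nat_finite[of "pverts H"] conjunct1[OF *] by (auto simp: atLeast0LessThan)
  have arcs: "parcs H = {(x, y). x \<in> pverts H \<and> y \<in> pverts H \<and> x \<noteq> y}"
    by (subst conjunct2[OF *]) (simp add: complete_on_def)
  have "(x, y) \<in> parcs H \<longleftrightarrow> (x, y) \<in> (\<lambda>(x, y). (g x, g y)) ` {(i, j). i < r \<and> j < r \<and> i \<noteq> j}" for x y
  proof
    assume "(x, y) \<in> parcs H"
    then have "x \<in> g ` {..<r}" "y \<in> g ` {..<r}" "x \<noteq> y" using g by (auto simp: arcs bij_betw_def)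
    then show "(x, y) \<in> (\<lambda>(x, y). (g x, g y)) ` {(i, j). i < r \<and> j < r \<and> i \<noteq> j}" by force
  next
    assume "(x, y) \<in> (\<lambda>(x, y). (g x, g y)) ` {(i, j). i < r \<and> j < r \<and> i \<noteq> j}"
    then show "(x, y) \<in> parcs H" using g by (auto simp: arcs bij_betw_def inj_on_def)
  qed
  then have "parcs H = (\<lambda>(x, y). (g x, g y)) ` {(i, j). i < r \<and> j < r \<and> i \<noteq> j}" by auto
  then show "\<exists>g. bij_betw g (pverts (complete_graph r)) (pverts H) \<and>
      parcs H = (\<lambda>(x, y). (g x, g y)) ` parcs (complete_graph r)"
    using g by (auto simp: complete_graph_def)
qed

text \<open>A copy of the complete graph is determined by its vertex set.\<close>

lemma card_copies_complete_graph:
  assumes "pair_graph G" "1 \<le> r"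
  shows "card (copies (complete_graph r) G) = card (adjacency.cliques (adj G) (pverts G) r)"
proof -
  interpret adjacency "adj G" using assms(1) by (rule adjacency_adj)
  have "copies (complete_graph r) G = complete_on ` cliques (pverts G) r"
  proof (intro equalityI subsetI)
    fix H assume "H \<in> copies (complete_graph r) G"
    then have H: "pair_graph H" "subgraph (with_proj H) (with_proj G)" "card (pverts H) = r"
      "H = complete_on (pverts H)"
      using digraph_iso_complete_graph[of H r] by (auto simp: copies_def)
    have "parcs H = {(x, y). x \<in> pverts H \<and> y \<in> pverts H \<and> x \<noteq> y}"
      by (subst H(4)) (simp add: complete_on_def)
    then have "pverts H \<in> cliques (pverts G) r"
      using H(2,3) subgraph_with_proj_iff[OF H(1) assms(1)] by (auto simp: cliques_def adj_def)
    then show "H \<in> complete_on ` cliques (pverts G) r" using H(4) by blast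
  next
    fix H assume "H \<in> complete_on ` cliques (pverts G) r"
    then obtain Q where Q: "Q \<in> cliques (pverts G) r" "H = complete_on Q" by blast
    have "finite Q" using Q(1) assms by (auto simp: cliques_def intro: card_ge_0_finite)
    then have "pair_graph H" using Q(2) by (intro pair_graphI) (auto simp: complete_on_def)
    moreover have "pverts H = Q" using Q(2) by (simp add: complete_on_def)
    moreover have "parcs H \<subseteq> parcs G" "Q \<subseteq> pverts G" "card Q = r"
      using Q by (auto simp: complete_on_def cliques_def adj_def)
    ultimately show "H \<in> copies (complete_graph r) G"
      using digraph_iso_complete_graph[of H r] subgraph_with_proj_iff[of H G] assms(1) Q(2)
      by (simp add: copies_def)
  qed
  moreover have "inj_on complete_on (cliques (pverts G) r)"
    by (rule inj_onI) (simp add: complete_on_def)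
  ultimately show ?thesis by (simp add: card_image)
qed

text \<open>The entries of a cyclic list are the images of \<open>0, \<dots>, l - 1\<close> under an
  isomorphism from \<open>cycle_graph l\<close>, and conversely.\<close>

lemma is_free_odd_cycles_iff:
  assumes "pair_graph G" "1 \<le> k"
  shows "is_free (odd_cycles_from (2 * k + 1)) G \<longleftrightarrow> adjacency.odd_cycles_le (adj G) (2 * k) (pverts G)"
proof -
  interpret adjacency "adj G" using assms(1) by (rule adjacency_adj)
  show ?thesis
  proof
    assume free: "is_free (odd_cycles_from (2 * k + 1)) G"
    show "odd_cycles_le (2 * k) (pverts G)"
      unfolding odd_cycles_le_def
    proof (intro allI impI, rule ccontr)
      fix xs assume xs: "set xs \<subseteq> pverts G \<and> cycle xs \<and> odd (length xs)" and long: "\<not> length xs \<le> 2 * k"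
      define l where "l = length xs"
      have l: "l \<ge> 3" "l \<ge> 2 * k + 1" "odd l" using long xs \<open>1 \<le> k\<close> by (auto simp: l_def)
      have ne: "xs \<noteq> []" using l by (auto simp: l_def)
      have dist: "distinct xs" using xs by (simp add: cycle_def)
      define H where "H = \<lparr>pverts = set xs, parcs = (\<lambda>(i, j). (xs ! i, xs ! j)) ` parcs (cycle_graph l)\<rparr>"
      have next_edge: "(xs ! i, xs ! ((i + 1) mod l)) \<in> parcs G" if "i < l" for i
      proof (cases "i + 1 = l")
        case True
        then have "xs ! i = last xs" using ne by (metis add_diff_cancel_right' l_def last_conv_nth)
        moreover have "xs ! ((i + 1) mod l) = hd xs" using True ne by (simp add: hd_conv_nth)
        ultimately show ?thesis using xs by (simp add: cycle_def adj_def)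
      next
        case False
        then have "adj G (xs ! i) (xs ! Suc i)" using that xs by (intro cycle_nth_Suc) (auto simp: l_def)
        then show ?thesis using False that by (simp add: adj_def)
      qed
      have arcs: "(xs ! i, xs ! j) \<in> parcs G" if "(i, j) \<in> parcs (cycle_graph l)" for i j
      proof -
        have ij: "i < l" "j < l" "j = (i + 1) mod l \<or> i = (j + 1) mod l"
          using that by (auto simp: cycle_graph_def)
        then consider "j = (i + 1) mod l" | "i = (j + 1) mod l" by blast
        then show ?thesis
        proof cases
          case 1
          then show ?thesis using next_edge[OF ij(1)] by simp
        next
          case 2
          then have "(xs ! j, xs ! i) \<in> parcs G" using next_edge[OF ij(2)] by simp
          then show ?thesis by (rule pair_graphD(5)[OF assms(1)])
        qed
      qed
      have sub: "parcs H \<subseteq> parcs G" using arcs by (auto simp: H_def)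
      have "pair_graph H"
      proof (rule pair_graphI)
        show "finite (pverts H)" by (simp add: H_def)
        fix x y assume xy: "(x, y) \<in> parcs H"
        then obtain i j where ij: "(i, j) \<in> parcs (cycle_graph l)" "x = xs ! i" "y = xs ! j"
          by (auto simp: H_def)
        then have "(j, i) \<in> parcs (cycle_graph l)" "i < l" "j < l" by (auto simp: cycle_graph_def)
        then have "(y, x) \<in> parcs H" "x \<in> set xs" "y \<in> set xs" using ij by (auto simp: H_def l_def)
        moreover have "x \<noteq> y" using xy sub pair_graphD(4)[OF assms(1)] by blast
        ultimately show "x \<in> pverts H \<and> y \<in> pverts H \<and> x \<noteq> y \<and> (y, x) \<in> parcs H"
          by (simp add: H_def)
      qed
      moreover have "bij_betw ((!) xs) (pverts (cycle_graph l)) (pverts H)"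
        using bij_betw_nth[OF dist, of "{..<l}" "set xs"] by (simp add: H_def cycle_graph_def l_def)
      then have "digraph_iso (with_proj H) (with_proj (cycle_graph l))"
        unfolding digraph_iso_iff[OF \<open>pair_graph H\<close> pair_graph_cycle_graph[OF l(1)]]
        by (intro exI[of _ "(!) xs"]) (simp add: H_def)
      moreover have "subgraph (with_proj H) (with_proj G)"
        using sub xs unfolding subgraph_with_proj_iff[OF \<open>pair_graph H\<close> assms(1)] by (simp add: H_def)
      ultimately have "H \<in> copies (cycle_graph l) G" by (simp add: copies_def)
      moreover have "cycle_graph l \<in> odd_cycles_from (2 * k + 1)" using l by (auto simp: odd_cycles_from_def)
      ultimately show False using free by (auto simp: is_free_def)
    qed
  next
    assume odd: "odd_cycles_le (2 * k) (pverts G)"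
    show "is_free (odd_cycles_from (2 * k + 1)) G"
      unfolding is_free_def
    proof (intro ballI, rule ccontr)
      fix F assume "F \<in> odd_cycles_from (2 * k + 1)" and "copies F G \<noteq> {}"
      then obtain l H where l: "odd l" "l \<ge> 2 * k + 1" and "H \<in> copies (cycle_graph l) G"
        by (auto simp: odd_cycles_from_def)
      then have H: "pair_graph H" "subgraph (with_proj H) (with_proj G)"
        "digraph_iso (with_proj H) (with_proj (cycle_graph l))" by (auto simp: copies_def)
      have "l \<ge> 3" using l \<open>1 \<le> k\<close> by simp
      then obtain g where g: "bij_betw g {..<l} (pverts H)"
        and arcs: "parcs H = (\<lambda>(x, y). (g x, g y)) ` parcs (cycle_graph l)"
        using H(3) digraph_iso_iff[OF H(1) pair_graph_cycle_graph] by (auto simp: cycle_graph_def)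
      have sub: "pverts H \<subseteq> pverts G" "parcs H \<subseteq> parcs G"
        using H(2) subgraph_with_proj_iff[OF H(1) assms(1)] by auto
      have edge: "adj G (g i) (g ((i + 1) mod l))" if "i < l" for i
      proof -
        have "(i, (i + 1) mod l) \<in> parcs (cycle_graph l)"
          using that \<open>l \<ge> 3\<close> by (simp add: cycle_graph_def)
        then have "(g i, g ((i + 1) mod l)) \<in> parcs H" unfolding arcs by force
        then show ?thesis using sub by (auto simp: adj_def)
      qed
      define xs where "xs = map g [0..<l]"
      have "successively (adj G) xs"
        unfolding successively_conv_nth
      proof (intro allI impI)
        fix i assume "Suc i < length xs"
        then show "adj G (xs ! i) (xs ! Suc i)" using edge[of i] by (simp add: xs_def)
      qed
      moreover have "distinct xs"
        using g by (simp add: xs_def distinct_map bij_betw_def atLeast0LessThan)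
      moreover have "adj G (last xs) (hd xs)"
        using edge[of "l - 1"] \<open>l \<ge> 3\<close> by (simp add: xs_def last_map hd_map)
      ultimately have "cycle xs" by (simp add: cycle_def)
      moreover have "set xs \<subseteq> pverts G"
        using g sub by (auto simp: xs_def bij_betw_def)
      moreover have "length xs = l" by (simp add: xs_def)
      ultimately have "l \<le> 2 * k" using odd_cycles_leD[OF odd] l by blast
      then show False using l by simp
    qed
  qed
qed

subsection \<open>Connectedness and blocks\<close>

lemma mk_symmetric_pair_graph:
  assumes "pair_graph H"
  shows "mk_symmetric (with_proj H) = H"
proof (rule pair_pre_digraph.equality)
  have "(x, y) \<in> parcs (mk_symmetric (with_proj H)) \<longleftrightarrow> (x, y) \<in> parcs H" for x y
    using pair_graphD(5)[OF assms, of y x] by (force simp: mk_symmetric_def)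
  then show "parcs (mk_symmetric (with_proj H)) = parcs H" by auto
qed (simp_all add: mk_symmetric_def)

text \<open>A walk out of a set has to use an edge that leaves it; conversely, no edge leaves the
  set of vertices reachable from \<open>u\<close>.\<close>

lemma strongly_connected_iff_conn:
  assumes "pair_graph H"
  shows "strongly_connected (with_proj H) \<longleftrightarrow> adjacency.conn (adj H) (pverts H)"
proof -
  interpret adjacency "adj H" using assms by (rule adjacency_adj)
  interpret wf: wf_digraph "with_proj H"
    using assms by (simp add: wf_digraph_wp_iff pair_graph_def pair_digraph_def pair_fin_digraph_def)
  show ?thesis
  proof
    assume sc: "strongly_connected (with_proj H)"
    show "conn (pverts H)"
      unfolding conn_def
    proof (intro conjI allI impI)
      show "pverts H \<noteq> {}" using sc by (simp add: strongly_connected_def)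
      fix A assume A: "A \<subseteq> pverts H \<and> A \<noteq> {} \<and> A \<noteq> pverts H"
      then obtain u v where uv: "u \<in> A" "v \<in> pverts H - A" by blast
      have reach: "u \<rightarrow>\<^sup>*\<^bsub>with_proj H\<^esub> v" using sc uv A by (auto simp: strongly_connected_def)
      show "\<exists>a\<in>A. \<exists>b\<in>pverts H - A. adj H a b"
      proof (rule ccontr)
        assume no: "\<not> (\<exists>a\<in>A. \<exists>b\<in>pverts H - A. adj H a b)"
        from reach have "v \<in> A"
        proof (induction rule: wf.reachable_induct)
          case base
          then show ?case using uv by simp
        next
          case (step x y)
          then have "(x, y) \<in> parcs H" "x \<in> A" by auto
          moreover from this have "y \<in> pverts H" using pair_graphD(3)[OF assms] by blast
          ultimately show ?case using no by (auto simp: adj_def)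
        qed
        then show False using uv by simp
      qed
    qed
  next
    assume conn: "conn (pverts H)"
    have "u \<rightarrow>\<^sup>*\<^bsub>with_proj H\<^esub> v" if "u \<in> pverts H" "v \<in> pverts H" for u v
    proof -
      define A where "A = {w \<in> pverts H. u \<rightarrow>\<^sup>*\<^bsub>with_proj H\<^esub> w}"
      have "u \<in> A" using that by (simp add: A_def)
      have "A = pverts H"
      proof (rule ccontr)
        assume "A \<noteq> pverts H"
        then obtain a b where ab: "a \<in> A" "b \<in> pverts H - A" "adj H a b"
          using connD[OF conn, of A] \<open>u \<in> A\<close> by (auto simp: A_def)
        then have "u \<rightarrow>\<^sup>*\<^bsub>with_proj H\<^esub> a" "(a, b) \<in> arcs_ends (with_proj H)"
          by (auto simp: A_def adj_def)
        then have "u \<rightarrow>\<^sup>*\<^bsub>with_proj H\<^esub> b" by (rule wf.reachable_adj_trans)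
        then show False using ab by (simp add: A_def)
      qed
      then show ?thesis using that by (auto simp: A_def)
    qed
    then show "strongly_connected (with_proj H)" using conn by (auto simp: strongly_connected_def conn_def)
  qed
qed

lemma connected_iff_conn:
  assumes "pair_graph H"
  shows "Digraph_Component.connected (with_proj H) \<longleftrightarrow> adjacency.conn (adj H) (pverts H)"
  using strongly_connected_iff_conn[OF assms] mk_symmetric_pair_graph[OF assms]
  by (simp add: Digraph_Component.connected_def)

text \<open>Adjacency is compared on \<open>U\<close> only, so connectedness passes from a subgraph
  to \<open>G\<close>, and from \<open>G\<close> to an induced subgraph.\<close>

lemma conn_mono:
  assumes "adjacency E" "adjacency E'" "\<And>x y. x \<in> U \<Longrightarrow> y \<in> U \<Longrightarrow> E x y \<Longrightarrow> E' x y"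
    and "adjacency.conn E U"
  shows "adjacency.conn E' U"
  using assms(4) unfolding adjacency.conn_def[OF assms(1)] adjacency.conn_def[OF assms(2)]
  using assms(3) by (meson DiffD1 subsetD)

lemma nonsep_mono:
  assumes "adjacency E" "adjacency E'" "\<And>x y. x \<in> U \<Longrightarrow> y \<in> U \<Longrightarrow> E x y \<Longrightarrow> E' x y"
    and "adjacency.nonsep E U"
  shows "adjacency.nonsep E' U"
  unfolding adjacency.nonsep_def[OF assms(2)]
proof (intro conjI ballI impI)
  have E: "adjacency.conn E U" "\<And>v. v \<in> U \<Longrightarrow> U - {v} \<noteq> {} \<Longrightarrow> adjacency.conn E (U - {v})"
    using assms(4) unfolding adjacency.nonsep_def[OF assms(1)] by blast+
  show "adjacency.conn E' U" using conn_mono[OF assms(1,2,3) E(1)] .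
  fix v assume "v \<in> U" "U - {v} \<noteq> {}"
  then show "adjacency.conn E' (U - {v})"
    using assms(3) by (intro conn_mono[OF assms(1,2) _ E(2)]) auto
qed

lemma del_vert_with_proj:
  assumes "pair_graph H"
  shows "pre_digraph.del_vert (with_proj H) v = with_proj (induced H (pverts H - {v}))"
proof -
  have "{a \<in> parcs H. fst a \<noteq> v \<and> snd a \<noteq> v}
    = {(x, y). x \<in> pverts H - {v} \<and> y \<in> pverts H - {v} \<and> (x, y) \<in> parcs H}"
    using pair_graphD(2,3)[OF assms] by auto
  then show ?thesis
    by (simp add: pre_digraph.del_vert_def induced_def with_proj_def)
qed

lemma conn_induced_iff:
  assumes "pair_graph H" "X \<subseteq> pverts H"
  shows "adjacency.conn (adj (induced H X)) X \<longleftrightarrow> adjacency.conn (adj H) X"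
  using conn_mono[OF adjacency_adj[OF pair_graph_induced[OF assms]] adjacency_adj[OF assms(1)], of X]
    conn_mono[OF adjacency_adj[OF assms(1)] adjacency_adj[OF pair_graph_induced[OF assms]], of X]
  by (auto simp: adj_def)

text \<open>In a connected graph all pairs are reachable, so only the rest after deletion matters.
  An empty rest is not \<open>conn\<close> but has no separated pair either, hence the separate
  condition.\<close>

lemma cut_vertex_iff:
  assumes "pair_graph H" "Digraph_Component.connected (with_proj H)"
  shows "cut_vertex (with_proj H) v \<longleftrightarrow>
    v \<in> pverts H \<and> pverts H - {v} \<noteq> {} \<and> \<not> adjacency.conn (adj H) (pverts H - {v})"
proof -
  have reach: "x \<rightarrow>\<^sup>*\<^bsub>with_proj H\<^esub> y" if "x \<in> pverts H" "y \<in> pverts H" for x y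
    using assms that mk_symmetric_pair_graph[OF assms(1)]
    by (simp add: Digraph_Component.connected_def strongly_connected_def)
  define K where "K = induced H (pverts H - {v})"
  have K: "pair_graph K" unfolding K_def using assms(1) by (intro pair_graph_induced) auto
  have "adjacency.conn (adj H) (pverts H - {v}) \<longleftrightarrow> strongly_connected (with_proj K)"
    using strongly_connected_iff_conn[OF K] conn_induced_iff[OF assms(1), of "pverts H - {v}"] by (simp add: K_def)
  also have "\<dots> \<longleftrightarrow> pverts H - {v} \<noteq> {} \<and>
    (\<forall>x\<in>pverts H - {v}. \<forall>y\<in>pverts H - {v}. x \<rightarrow>\<^sup>*\<^bsub>with_proj K\<^esub> y)"
    by (simp add: strongly_connected_def K_def)
  finally show ?thesis
    using reach unfolding cut_vertex_def del_vert_with_proj[OF assms(1)] K_def[symmetric] by auto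
qed

lemma block_prop_iff:
  assumes "pair_graph H"
  shows "Digraph_Component.connected (with_proj H) \<and> (\<forall>v. \<not> cut_vertex (with_proj H) v) \<longleftrightarrow>
    adjacency.nonsep (adj H) (pverts H)"
  unfolding adjacency.nonsep_def[OF adjacency_adj[OF assms]]
  using cut_vertex_iff[OF assms] connected_iff_conn[OF assms] by blast

text \<open>Filling in all arcs of \<open>G\<close> among the vertices of a block preserves
  connectedness and creates no cut vertex. Maximality therefore makes blocks induced, and they
  correspond to maximal vertex sets.\<close>

lemma blocks_eq:
  assumes "pair_graph G"
  shows "blocks G = induced G ` adjacency.max_nonsep (adj G) (pverts G)"
proof -
  interpret adjacency "adj G" using assms by (rule adjacency_adj)
  define P where "P H \<longleftrightarrow> graph H \<and> Digraph_Component.connected H \<and> (\<forall>v. \<not> cut_vertex H v)"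
    for H :: "('a, 'a \<times> 'a) pre_digraph"
  have P_nonsep: "nonsep (pverts B)" and P_pair: "pair_graph B"
    if "P (with_proj B)" "subgraph (with_proj B) (with_proj G)" for B
  proof -
    show B: "pair_graph B" using that(1) by (auto simp: P_def intro: pair_graphI_graph)
    have "adjacency.nonsep (adj B) (pverts B)" using that(1) block_prop_iff[OF B] by (simp add: P_def)
    then show "nonsep (pverts B)"
      using that(2) subgraph_with_proj_iff[OF B assms]
      by (intro nonsep_mono[OF adjacency_adj[OF B] adjacency_adj[OF assms]]) (auto simp: adj_def)
  qed
  have P_induced: "P (with_proj (induced G X))" "subgraph (with_proj (induced G X)) (with_proj G)"
    if "nonsep X" "X \<subseteq> pverts G" for X
  proof -
    have I: "pair_graph (induced G X)" using assms that(2) by (rule pair_graph_induced)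
    have "adjacency.nonsep (adj (induced G X)) X"
      using that(1) by (intro nonsep_mono[OF adjacency_adj[OF assms] adjacency_adj[OF I]]) (auto simp: adj_def)
    then show "P (with_proj (induced G X))"
      using block_prop_iff[OF I] pair_graph.pair_graphD_graph[OF I] by (simp add: P_def)
    show "subgraph (with_proj (induced G X)) (with_proj G)"
      unfolding subgraph_with_proj_iff[OF I assms] using that(2) by auto
  qed
  have sub_induced: "subgraph (with_proj B) (with_proj (induced G X))"
    if "pair_graph B" "subgraph (with_proj B) (with_proj G)" "pverts B \<subseteq> X" "X \<subseteq> pverts G" for B X
  proof -
    have "parcs B \<subseteq> parcs G" using that(2) subgraph_with_proj_iff[OF that(1) assms] by simp
    moreover have "x \<in> X \<and> y \<in> X" if "(x, y) \<in> parcs B" for x y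
      using that \<open>pverts B \<subseteq> X\<close> pair_graphD(2,3)[OF \<open>pair_graph B\<close> that] by auto
    ultimately show ?thesis
      unfolding subgraph_with_proj_iff[OF that(1) pair_graph_induced[OF assms that(4)]]
      using that(3) by (auto simp: induced_def)
  qed
  have eq_induced: "B = induced G (pverts B)"
    if "with_proj (induced G (pverts B)) = with_proj B" for B
    using that by (cases B) (simp add: with_proj_eq_iff)
  have block_iff: "B \<in> blocks G \<longleftrightarrow> pre_digraph.max_subgraph (with_proj G) P (with_proj B)" for B
    by (simp add: blocks_def P_def[abs_def])
  show ?thesis
  proof (intro equalityI subsetI)
    fix B assume "B \<in> blocks G"
    then have B: "subgraph (with_proj B) (with_proj G)" "P (with_proj B)"
      and max: "\<And>H. subgraph (with_proj B) H \<Longrightarrow> subgraph H (with_proj G) \<Longrightarrow> P H \<Longrightarrow> H = with_proj B"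
      unfolding block_iff pre_digraph.max_subgraph_def by blast+
    have pB: "pair_graph B" using P_pair[OF B(2,1)] .
    have sub: "pverts B \<subseteq> pverts G" using B(1) subgraph_with_proj_iff[OF pB assms] by simp
    have max': "with_proj (induced G X) = with_proj B"
      if "nonsep X" "pverts B \<subseteq> X" "X \<subseteq> pverts G" for X
      using max[OF sub_induced[OF pB B(1) that(2,3)] P_induced(2,1)[OF that(1,3)]] .
    have "pverts B \<in> max_nonsep (pverts G)"
    proof (rule max_nonsepI[OF sub])
      show "nonsep (pverts B)" using P_nonsep[OF B(2,1)] .
      fix Y assume "Y \<subseteq> pverts G" "nonsep Y" "pverts B \<subseteq> Y"
      then show "Y = pverts B" using max'[of Y] by (simp add: with_proj_eq_iff)
    qed
    moreover have "B = induced G (pverts B)"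
      using max'[OF P_nonsep[OF B(2,1)] subset_refl sub] by (rule eq_induced)
    ultimately show "B \<in> induced G ` max_nonsep (pverts G)" by blast
  next
    fix B assume "B \<in> induced G ` max_nonsep (pverts G)"
    then obtain X where X: "X \<in> max_nonsep (pverts G)" "B = induced G X" by blast
    note X' = max_nonsepD[OF X(1)]
    have "H = with_proj B" if H: "subgraph (with_proj B) H" "subgraph H (with_proj G)" "P H" for H
    proof -
      \<comment> \<open>\<open>H\<close> is an arbitrary digraph record; as a subgraph of a pair
        graph it has the projections as end maps.\<close>
      define K where "K = \<lparr>pverts = verts H, parcs = arcs H\<rparr>"
      have HK: "H = with_proj K" unfolding K_def using H(2) by (rule subgraph_eq_with_proj)
      have K: "nonsep (pverts K)" "pair_graph K"
        using P_nonsep[of K] P_pair[of K] H(2,3) by (simp_all add: HK)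
      have KG: "pverts K \<subseteq> pverts G" "parcs K \<subseteq> parcs G"
        using H(2) subgraph_with_proj_iff[OF K(2) assms] by (simp_all add: HK)
      have BK: "X \<subseteq> pverts K" "parcs B \<subseteq> parcs K"
        using H(1) subgraph_with_proj_iff[OF pair_graph_induced[OF assms X'(1)] K(2)] by (simp_all add: HK X(2))
      have "pverts K = X" using X'(3)[OF KG(1) K(1) BK(1)] .
      moreover from this have "parcs K \<subseteq> parcs B"
        using KG(2) pair_graphD(2,3)[OF K(2)] by (auto simp: X(2))
      ultimately show "H = with_proj B" using BK(2) by (simp add: HK with_proj_eq_iff X(2))
    qed
    then show "B \<in> blocks G"
      unfolding block_iff pre_digraph.max_subgraph_def
      using P_induced[OF X'(2,1)] by (auto simp: X(2))
  qed
qed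

lemma card_blocks:
  assumes "pair_graph G"
  shows "card (blocks G) = card (adjacency.max_nonsep (adj G) (pverts G))"
proof -
  have "inj_on (induced G) (adjacency.max_nonsep (adj G) (pverts G))"
    by (rule inj_onI) (metis induced_simps(1))
  then show ?thesis unfolding blocks_eq[OF assms] by (rule card_image)
qed

lemma induced_iso_complete_graph:
  assumes "pair_graph G" "X \<subseteq> pverts G"
  shows "digraph_iso (with_proj (induced G X)) (with_proj (complete_graph l)) \<longleftrightarrow>
    card X = l \<and> adjacency.clique (adj G) X"
proof -
  interpret adjacency "adj G" using assms(1) by (rule adjacency_adj)
  have "induced G X = complete_on X \<longleftrightarrow> clique X"
  proof
    assume "induced G X = complete_on X"
    then have "parcs (induced G X) = {(x, y). x \<in> X \<and> y \<in> X \<and> x \<noteq> y}"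
      by (simp add: complete_on_def)
    then show "clique X" by (auto simp: clique_def adj_def induced_def)
  next
    assume "clique X"
    then have "x \<in> X \<and> y \<in> X \<and> (x, y) \<in> parcs G \<longleftrightarrow> x \<in> X \<and> y \<in> X \<and> x \<noteq> y" for x y
      using pair_graphD(4)[OF assms(1), of x y] by (auto simp: clique_def adj_def)
    then show "induced G X = complete_on X" by (simp add: complete_on_def induced_def)
  qed
  then show ?thesis
    using digraph_iso_complete_graph[OF pair_graph_induced[OF assms]] by simp
qed

section \<open>Complete graphs sharing a vertex\<close>

text \<open>Vertex \<open>0\<close> is common to all \<open>c\<close> complete graphs on
  \<open>s + 1\<close> vertices; the other vertices are numbered in consecutive groups of
  \<open>s\<close>.\<close>

definition windmill :: "nat \<Rightarrow> nat \<Rightarrow> nat pair_pre_digraph" where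
  "windmill s c = \<lparr>pverts = {..c * s}, parcs = {(i, j). i \<le> c * s \<and> j \<le> c * s \<and> i \<noteq> j \<and>
     (i = 0 \<or> j = 0 \<or> (i - 1) div s = (j - 1) div s)}\<rparr>"

lemma pair_graph_windmill: "pair_graph (windmill s c)"
  by (rule pair_graphI) (auto simp: windmill_def)

text \<open>A nonseparable set stays connected without \<open>0\<close>, and no edge away from
  \<open>0\<close> joins different groups, so the set lies in one of the complete graphs.\<close>

lemma max_nonsep_windmill:
  assumes "1 \<le> s" "0 < c"
  shows "adjacency.max_nonsep (adj (windmill s c)) (pverts (windmill s c)) =
      (\<lambda>b. insert 0 {b * s + 1..b * s + s}) ` {..<c}"
    and "b < c \<Longrightarrow> adjacency.clique (adj (windmill s c)) (insert 0 {b * s + 1..b * s + s})"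
proof -
  define G where "G = windmill s c"
  interpret adjacency "adj G" unfolding G_def by (rule adjacency_adj[OF pair_graph_windmill])
  define B where "B b = insert 0 {b * s + 1..b * s + s}" for b
  have div: "(i - 1) div s = b" if "i \<in> B b" "i \<noteq> 0" for i b
  proof -
    have "i - 1 = b * s + (i - 1 - b * s)" "i - 1 - b * s < s" using that \<open>1 \<le> s\<close> by (auto simp: B_def)
    then show ?thesis using \<open>1 \<le> s\<close> by (metis add.right_neutral div_less div_mult_self3 less_nat_zero_code)
  qed
  have B_div: "i \<in> B ((i - 1) div s)" for i
  proof (cases "i = 0")
    case False
    define d where "d = (i - 1) div s"
    have "d * s \<le> i - 1" unfolding d_def by (rule div_times_less_eq_dividend)
    moreover have "i - 1 < d * s + s"
      using dividend_less_div_times[of s "i - 1"] \<open>1 \<le> s\<close> by (simp add: d_def add.commute)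
    ultimately have "d * s + 1 \<le> i" "i \<le> d * s + s" using False by linarith+
    then show ?thesis by (simp add: B_def d_def)
  qed (simp add: B_def)
  have B_sub: "B b \<subseteq> pverts G" if "b < c" for b
  proof -
    have "b * s + s \<le> c * s" using that by (metis Suc_leI add.commute mult_Suc mult_le_mono1)
    then show ?thesis by (auto simp: B_def G_def windmill_def)
  qed
  have B_clique: "clique (B b)" if "b < c" for b
    unfolding clique_def
  proof (intro ballI impI)
    fix x y assume xy: "x \<in> B b" "y \<in> B b" "x \<noteq> y"
    then have "x \<le> c * s" "y \<le> c * s" using B_sub[OF that] by (auto simp: G_def windmill_def)
    moreover have "x = 0 \<or> y = 0 \<or> (x - 1) div s = (y - 1) div s"
      using div[OF xy(1)] div[OF xy(2)] by metis
    ultimately show "adj G x y" using xy(3) by (simp add: adj_def G_def windmill_def)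
  qed
  then show "b < c \<Longrightarrow> adjacency.clique (adj (windmill s c)) (insert 0 {b * s + 1..b * s + s})"
    by (simp add: B_def G_def)
  have B_inj: "b = b'" if "B b \<subseteq> B b'" for b b'
  proof -
    have "b * s + 1 \<in> B b" using \<open>1 \<le> s\<close> by (simp add: B_def)
    then show ?thesis using that div[of "b * s + 1"] by (metis add_eq_0_iff_both_eq_0 subsetD zero_neq_one)
  qed
  have nonsep_sub: "\<exists>b<c. X \<subseteq> B b" if X: "nonsep X" "X \<subseteq> pverts G" for X
  proof (cases "X - {0} = {}")
    case True
    then show ?thesis using \<open>0 < c\<close> by (intro exI[of _ 0]) (auto simp: B_def)
  next
    case False
    then obtain x where x: "x \<in> X" "x \<noteq> 0" by blast
    have conn: "conn (X - {0})" using X(1) False by (cases "0 \<in> X") (auto simp: nonsep_def)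
    define A where "A = {y \<in> X - {0}. (y - 1) div s = (x - 1) div s}"
    have "A = X - {0}"
    proof (rule ccontr)
      assume "A \<noteq> X - {0}"
      then obtain a b where "a \<in> A" "b \<in> X - {0} - A" "adj G a b"
      proof -
        have "A \<subseteq> X - {0}" "A \<noteq> {}" using x by (auto simp: A_def)
        then show thesis using connD[OF conn _ _ \<open>A \<noteq> X - {0}\<close>] that by blast
      qed
      then show False by (auto simp: A_def adj_def G_def windmill_def)
    qed
    have "y \<in> B ((x - 1) div s)" if "y \<in> X" for y
    proof (cases "y = 0")
      case False
      then have "y \<in> A" using that \<open>A = X - {0}\<close> by simp
      then show ?thesis using B_div[of y] by (simp add: A_def)
    qed (simp add: B_def)
    moreover have "(x - 1) div s < c"
    proof -
      have "x - 1 < c * s" using x X(2) by (auto simp: G_def windmill_def)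
      then show ?thesis by (simp add: less_mult_imp_div_less)
    qed
    ultimately show ?thesis by blast
  qed
  have "max_nonsep (pverts G) = B ` {..<c}"
  proof (intro equalityI subsetI)
    fix X assume X: "X \<in> max_nonsep (pverts G)"
    then obtain b where b: "b < c" "X \<subseteq> B b" using nonsep_sub max_nonsepD(1,2)[OF X] by blast
    have "nonsep (B b)" using B_clique[OF b(1)] by (intro nonsep_clique) (auto simp: B_def)
    then have "B b = X" using max_nonsepD(3)[OF X B_sub[OF b(1)] _ b(2)] by simp
    then show "X \<in> B ` {..<c}" using b(1) by blast
  next
    fix X assume "X \<in> B ` {..<c}"
    then obtain b where b: "b < c" "X = B b" by blast
    show "X \<in> max_nonsep (pverts G)"
    proof (rule max_nonsepI)
      show "X \<subseteq> pverts G" using B_sub b by simp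
      show "nonsep X" using B_clique[OF b(1)] b(2) by (intro nonsep_clique) (auto simp: B_def)
      fix Y assume Y: "Y \<subseteq> pverts G" "nonsep Y" "X \<subseteq> Y"
      then obtain b' where b': "b' < c" "Y \<subseteq> B b'" using nonsep_sub by blast
      then have "b = b'" using Y(3) b by (intro B_inj) auto
      then show "Y = X" using b b' Y(3) by auto
    qed
  qed
  then show "adjacency.max_nonsep (adj (windmill s c)) (pverts (windmill s c)) =
      (\<lambda>b. insert 0 {b * s + 1..b * s + s}) ` {..<c}"
    by (simp add: B_def[abs_def] G_def)
qed

lemma windmill_extremal:
  assumes "1 \<le> k" "0 < c" "2 \<le> r"
  defines "G \<equiv> windmill (2 * k - 1) c"
  shows "is_free (odd_cycles_from (2 * k + 1)) G"
    and "card (copies (complete_graph r) G) = c * (2 * k choose r)"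
proof -
  have G: "pair_graph G" unfolding G_def by (rule pair_graph_windmill)
  interpret adjacency "adj G" using G by (rule adjacency_adj)
  define B where "B b = insert 0 {b * (2 * k - 1) + 1..b * (2 * k - 1) + (2 * k - 1)}" for b
  have max: "max_nonsep (pverts G) = B ` {..<c}" and clique: "\<And>b. b < c \<Longrightarrow> clique (B b)"
    using max_nonsep_windmill[of "2 * k - 1" c] assms(1,2) by (simp_all add: G_def B_def[abs_def])
  have card: "card (B b) = 2 * k" for b using assms(1) by (simp add: B_def)
  have blocks: "card X = 2 * k \<and> clique X" if "X \<in> max_nonsep (pverts G)" for X
    using that card clique by (auto simp: max)
  have fin: "finite (pverts G)" using G by (rule pair_graphD)
  have "odd_cycles_le (2 * k) (pverts G)"
    using fin blocks by (intro clique_blocks_odd_cycles_le) auto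
  then show "is_free (odd_cycles_from (2 * k + 1)) G"
    using is_free_odd_cycles_iff[OF G assms(1)] by simp
  \<comment> \<open>The largest element tells the complete graphs apart, so there are exactly
    \<open>c\<close> blocks.\<close>
  have Max: "Max (B b) = (b + 1) * (2 * k - 1)" for b
    by (rule Max_eqI) (use assms(1) in \<open>auto simp: B_def\<close>)
  have "b = b'" if "B b = B b'" for b b'
  proof -
    have "(b + 1) * (2 * k - 1) = (b' + 1) * (2 * k - 1)"
      using that Max by metis
    moreover have "2 * k - 1 \<noteq> 0" using assms(1) by simp
    ultimately have "b + 1 = b' + 1" by (metis mult_cancel2)
    then show ?thesis by simp
  qed
  then have "inj_on B {..<c}" by (rule inj_onI)
  then have "card (max_nonsep (pverts G)) = c" by (simp add: max card_image)
  then have "card (cliques (pverts G) r) = c * (2 * k choose r)"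
    using card_cliques_clique_blocks[OF fin assms(3) blocks] by simp
  then show "card (copies (complete_graph r) G) = c * (2 * k choose r)"
    using card_copies_complete_graph[OF G, of r] assms(3) by simp
qed

section \<open>The theorem\<close>

lemma card_copies_le:
  assumes "pair_graph G" "is_free (odd_cycles_from (2 * k + 1)) G" "pverts G \<noteq> {}" "6 \<le> k" "3 \<le> r"
  shows "real (card (copies (complete_graph r) G)) \<le> (real (card (pverts G)) - 1) * clique_density k r"
proof -
  interpret adjacency "adj G" using assms(1) by (rule adjacency_adj)
  have "Suc (r - 1) = r" using assms(5) by simp
  then show ?thesis
    using card_cliques_le_density[of "pverts G" k "r - 1"] assms is_free_odd_cycles_iff[OF assms(1), of k]
      pair_graphD(1)[OF assms(1)] card_copies_complete_graph[OF assms(1), of r] by simp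
qed

text \<open>One direction is \<open>extremal_structure\<close>. In the other, odd cycles stay inside
  blocks of \<open>2 * k\<close> vertices, and each block contributes \<open>2 * k choose r\<close>
  cliques without overlap.\<close>

lemma extremal_iff:
  assumes G: "pair_graph G" and n: "2 \<le> card (pverts G)" and "6 \<le> k" "3 \<le> r" "r \<le> 2 * k"
  shows "is_free (odd_cycles_from (2 * k + 1)) G \<and>
      real (card (copies (complete_graph r) G)) = (real (card (pverts G)) - 1) * clique_density k r \<longleftrightarrow>
    (2 * k - 1) dvd (card (pverts G) - 1) \<and> Digraph_Component.connected (with_proj G) \<and>
      card (blocks G) = (card (pverts G) - 1) div (2 * k - 1) \<and>
      (\<forall>B\<in>blocks G. digraph_iso (with_proj B) (with_proj (complete_graph (2 * k))))"
proof -
  interpret adjacency "adj G" using G by (rule adjacency_adj)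
  define n where "n = card (pverts G)"
  define M where "M = max_nonsep (pverts G)"
  have fin: "finite (pverts G)" using G by (rule pair_graphD)
  have r: "Suc (r - 1) = r" "2 \<le> r - 1" "1 \<le> r" using \<open>3 \<le> r\<close> by auto
  have free: "is_free (odd_cycles_from (2 * k + 1)) G \<longleftrightarrow> odd_cycles_le (2 * k) (pverts G)"
    using is_free_odd_cycles_iff[OF G] \<open>6 \<le> k\<close> by simp
  have copies: "card (copies (complete_graph r) G) = card (cliques (pverts G) r)"
    using card_copies_complete_graph[OF G] r by simp
  have blocks: "(\<forall>B\<in>blocks G. digraph_iso (with_proj B) (with_proj (complete_graph (2 * k)))) \<longleftrightarrow>
      (\<forall>X\<in>M. card X = 2 * k \<and> clique X)"
    unfolding blocks_eq[OF G] M_def using induced_iso_complete_graph[OF G] max_nonsepD(1) by simp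
  have conn: "Digraph_Component.connected (with_proj G) \<longleftrightarrow> conn (pverts G)"
    using connected_iff_conn[OF G] .
  have "odd_cycles_le (2 * k) (pverts G) \<and> real (card (cliques (pverts G) r)) = (real n - 1) * clique_density k r \<longleftrightarrow>
    (2 * k - 1) dvd (n - 1) \<and> conn (pverts G) \<and> card M = (n - 1) div (2 * k - 1) \<and>
      (\<forall>X\<in>M. card X = 2 * k \<and> clique X)" (is "?L \<longleftrightarrow> ?R")
  proof
    assume ?L
    then have *: "conn (pverts G) \<and> (\<forall>X\<in>M. card X = 2 * k \<and> clique X) \<and> (2 * k - 1) * card M = n - 1"
      using extremal_structure[of "pverts G" k "r - 1"] fin n assms(3-5) r unfolding n_def M_def by simp
    then have "(2 * k - 1) dvd (n - 1)" by (metis dvd_triv_left)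
    moreover have "card M = (n - 1) div (2 * k - 1)"
    proof -
      have "2 * k - 1 \<noteq> 0" using \<open>6 \<le> k\<close> by simp
      then show ?thesis using * by (metis nonzero_mult_div_cancel_left)
    qed
    ultimately show ?R using * by blast
  next
    assume R: ?R
    then have blocks: "\<And>X. X \<in> max_nonsep (pverts G) \<Longrightarrow> card X = 2 * k \<and> clique X" by (auto simp: M_def)
    have "odd_cycles_le (2 * k) (pverts G)"
      using fin blocks by (intro clique_blocks_odd_cycles_le) auto
    moreover have "real (card (cliques (pverts G) r)) = (real n - 1) * clique_density k r"
    proof -
      \<comment> \<open>Divisibility makes the rounded quotient exact.\<close>
      have "card M * (2 * k - 1) = n - 1" using R by simp
      then have "real (card M) * real (2 * k - 1) = real (n - 1)" by (metis of_nat_mult)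
      moreover have "real (2 * k - 1) = 2 * real k - 1" "real (n - 1) = real n - 1"
        using \<open>6 \<le> k\<close> n by (auto simp: n_def)
      ultimately have "real (card M) * (2 * real k - 1) = real n - 1" by simp
      moreover have "2 * real k - 1 > 0" using \<open>6 \<le> k\<close> by simp
      ultimately have "(real n - 1) / (2 * real k - 1) = real (card M)" by (simp add: nonzero_divide_eq_eq)
      moreover have "card (cliques (pverts G) r) = card M * (2 * k choose r)"
        unfolding M_def using fin r blocks by (intro card_cliques_clique_blocks) auto
      ultimately show ?thesis by (simp add: clique_density_def flip: times_divide_eq_left)
    qed
    ultimately show ?L by blast
  qed
  then show ?thesis unfolding free copies blocks conn card_blocks[OF G] by (simp add: n_def M_def)
qed

text \<open>For \<open>r = 2\<close> the bound fails for large \<open>n\<close>, since balanced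
  complete bipartite graphs have no odd cycles. The last conjunct allows any vertex type, whereas
  \<open>gen_turan\<close> ranges over graphs on natural numbers.\<close>

theorem theorem1:
  fixes n k r :: nat
  assumes "n \<ge> 2 * k" and "2 * k \<ge> r" and "r \<ge> 3" and "k \<ge> 6"
  shows "real (gen_turan n (complete_graph r) (odd_cycles_from (2 * k + 1)))
           \<le> (real n - 1) / (2 * real k - 1) * real (2 * k choose r)
    \<and> (real (gen_turan n (complete_graph r) (odd_cycles_from (2 * k + 1)))
           = (real n - 1) / (2 * real k - 1) * real (2 * k choose r)
         \<longleftrightarrow> (2 * k - 1) dvd (n - 1))
    \<and> (\<forall>G :: 'a pair_pre_digraph. pair_graph G \<and> card (pverts G) = n \<longrightarrow>
         (is_free (odd_cycles_from (2 * k + 1)) G \<and>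
          real (card (copies (complete_graph r) G))
            = (real n - 1) / (2 * real k - 1) * real (2 * k choose r)
         \<longleftrightarrow>
          (2 * k - 1) dvd (n - 1) \<and>
          Digraph_Component.connected G \<and>
          card (blocks G) = (n - 1) div (2 * k - 1) \<and>
          (\<forall>B\<in>blocks G. digraph_iso B (complete_graph (2 * k)))))"
proof (intro conjI allI impI)
  have T: "(real n - 1) / (2 * real k - 1) * real (2 * k choose r) = (real n - 1) * clique_density k r"
    by (simp add: clique_density_def)
  define S where "S = {card (copies (complete_graph r) G) |G :: nat pair_pre_digraph.
     pair_graph G \<and> card (pverts G) = n \<and> is_free (odd_cycles_from (2 * k + 1)) G}"
  have arcs: "parcs F \<noteq> {}" if F: "F \<in> odd_cycles_from (2 * k + 1)" for F
  proof -
    obtain l where "F = cycle_graph l" "2 * k + 1 \<le> l" using F unfolding odd_cycles_from_def by blast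
    then have "(0, 1) \<in> parcs F" using \<open>k \<ge> 6\<close> by (simp add: cycle_graph_def)
    then show ?thesis by blast
  qed
  have turan: "gen_turan n (complete_graph r) (odd_cycles_from (2 * k + 1)) = Max S"
    unfolding gen_turan_def S_def ..
  have fin: "finite S" and "S \<noteq> {}"
    unfolding S_def using gen_turan_wf[OF arcs] by blast+
  \<comment> \<open>The maximum is attained by some graph, to which the bound and the
    characterisation of equality apply.\<close>
  then have "Max S \<in> S" by (rule Max_in)
  then obtain G :: "nat pair_pre_digraph" where G: "pair_graph G" "card (pverts G) = n"
    "is_free (odd_cycles_from (2 * k + 1)) G" "Max S = card (copies (complete_graph r) G)"
    by (auto simp: S_def)
  have "pverts G \<noteq> {}" using G(2) assms by auto
  then have le: "real (Max S) \<le> (real n - 1) * clique_density k r"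
    using card_copies_le[OF G(1,3)] G(2,4) assms by simp
  then show "real (gen_turan n (complete_graph r) (odd_cycles_from (2 * k + 1)))
      \<le> (real n - 1) / (2 * real k - 1) * real (2 * k choose r)"
    by (simp only: turan T)
  have "real (Max S) = (real n - 1) * clique_density k r \<longleftrightarrow> (2 * k - 1) dvd (n - 1)"
  proof
    assume "real (Max S) = (real n - 1) * clique_density k r"
    then show "(2 * k - 1) dvd (n - 1)"
      using extremal_iff[OF G(1), of k r] G assms by simp
  next
    assume "(2 * k - 1) dvd (n - 1)"
    \<comment> \<open>The windmill of \<open>c\<close> complete graphs attains the bound;
      \<open>c\<close> is positive because \<open>n\<close> is at least
      \<open>2 * k\<close>.\<close>
    then obtain c where c: "n - 1 = c * (2 * k - 1)" by (metis dvd_def mult.commute)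
    have "0 < c"
    proof (rule ccontr)
      assume "\<not> 0 < c"
      then show False using c assms by simp
    qed
    define H where "H = windmill (2 * k - 1) c"
    have "pair_graph H" unfolding H_def by (rule pair_graph_windmill)
    moreover have "card (pverts H) = n"
      using c assms by (simp add: H_def windmill_def)
    moreover have "is_free (odd_cycles_from (2 * k + 1)) H"
      and copies: "card (copies (complete_graph r) H) = c * (2 * k choose r)"
      using windmill_extremal[of k c r] \<open>0 < c\<close> assms by (simp_all add: H_def)
    ultimately have "c * (2 * k choose r) \<in> S" by (auto simp: S_def intro!: exI[of _ H])
    then have "real (c * (2 * k choose r)) \<le> real (Max S)"
      using fin by (intro of_nat_mono Max_ge)
    moreover have "real (c * (2 * k choose r)) = (real n - 1) * clique_density k r"
    proof -
      have "real (n - 1) = real c * real (2 * k - 1)" unfolding c by (rule of_nat_mult)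
      moreover have "real (2 * k - 1) = 2 * real k - 1" "real (n - 1) = real n - 1"
        using assms by auto
      ultimately have "real n - 1 = real c * (2 * real k - 1)" by simp
      then show ?thesis using assms by (simp add: clique_density_def)
    qed
    ultimately show "real (Max S) = (real n - 1) * clique_density k r" using le by simp
  qed
  then show "real (gen_turan n (complete_graph r) (odd_cycles_from (2 * k + 1)))
      = (real n - 1) / (2 * real k - 1) * real (2 * k choose r) \<longleftrightarrow> (2 * k - 1) dvd (n - 1)"
    by (simp only: turan T)
  fix G :: "'a pair_pre_digraph"
  assume G: "pair_graph G \<and> card (pverts G) = n"
  then show "is_free (odd_cycles_from (2 * k + 1)) G \<and>
          real (card (copies (complete_graph r) G))
            = (real n - 1) / (2 * real k - 1) * real (2 * k choose r)
         \<longleftrightarrow>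
          (2 * k - 1) dvd (n - 1) \<and>
          Digraph_Component.connected G \<and>
          card (blocks G) = (n - 1) div (2 * k - 1) \<and>
          (\<forall>B\<in>blocks G. digraph_iso B (complete_graph (2 * k)))"
    using extremal_iff[of G k r] assms unfolding T by simp
qed

end
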